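(* Let $\alpha$ be an irrational number with sequence of convergent denominators $(q_n)$, and let $g:\mathbb{T}\to\mathbb{R}$ be a function such that: (i) $g$ is continuous; (ii) $\sup_{x\in\mathbb{T}}|S_{q_n}(g)(x)|=o\big(q_{n+1}^{-4/5}\big)$ as $n\to\infty$; (iii) for every $r\in\mathbb{R}\setminus\{0\}$ and every $\beta\in\mathbb{R}$ there is no measurable function $\psi:\mathbb{T}\to\mathbb{R}$ such that $r g(x)\equiv\psi(x+\alpha)-\psi(x)+\beta \pmod 1$ for almost every $x\in\mathbb{T}$. Let $C>-\min_{x\in\mathbb{T}}g(x)$ be a real number, and let $(T_t)_{t\in\mathbb{R}}$ be the special flow over the rotation by $\alpha$ on $\mathbb{T}$ under the function $g+C$, acting on the space $X_{g+C}$. Then the dynamical system $(X_{g+C},T_C)$ (the time-$C$ map of the flow) is weakly mixing with respect to the normalized Lebesgue measure $\mu$ on $X_{g+C}$, and every square orbit is equidistributed: for every $z\in X_{g+C}$ and every $f\in C(X_{g+C})$, $$\lim_{N\to\infty}\frac1N\sum_{0\le n<N}f\big((T_C)^{n^2}z\big)=\int_{X_{g+C}}f\,d\mu.$$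
   Context: $\mathbb{T}=\mathbb{R}/\mathbb{Z}$. $(q_n)$ is the sequence of denominators of the continued fraction convergents of $\alpha$. For a positive integer $n$, $S_n(g)(x)=\sum_{i=0}^{n-1}g(x+i\alpha)$. Special flow: for a continuous function $F:\mathbb{T}\to(0,\infty)$, $X_F$ is the quotient of $\mathbb{T}\times\mathbb{R}$ by the equivalence relation generated by $(x,y)\sim(x+\alpha,\,y-F(x))$, equipped with the normalized Lebesgue measure and the metric induced from the Euclidean metric on $\mathbb{T}\times\mathbb{R}$ (so $X_F$ can be identified with $\{(x,y):0\le y<F(x)\}$ as a measure space, each equivalence class having exactly one representative there). The special flow under $F$ is $T_t([(x,y)])=[(x,y+t)]$, $t\in\mathbb{R}$. A measure-preserving system $(X,\mathcal{B},\mu,T)$ with $\mu(X)=1$ is weakly mixing if for all $A,B\in\mathcal{B}$, $\lim_{n\to\infty}\frac1n\sum_{0\le i<n}|\mu(T^{-i}A\cap B)-\mu(A)\mu(B)|=0$. *)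

theory Defs
  imports "HOL-Analysis.Analysis" "HOL-Library.Real_Mod" "HOL-Library.Landau_Symbols"
begin

section \<open>Continued fraction denominators\<close>

text \<open>For irrational \<open>\<alpha>\<close> the fractional part below never vanishes, so no division by zero occurs.\<close>

fun cf_remainder :: "real \<Rightarrow> nat \<Rightarrow> real" where
  "cf_remainder \<alpha> 0 = \<alpha>"
| "cf_remainder \<alpha> (Suc n) = 1 / frac (cf_remainder \<alpha> n)"

definition partial_quotient :: "real \<Rightarrow> nat \<Rightarrow> int" where
  "partial_quotient \<alpha> n = \<lfloor>cf_remainder \<alpha> n\<rfloor>"

text \<open>The partial quotients with positive index are positive, so \<open>nat\<close> loses nothing.\<close>

fun conv_denom :: "real \<Rightarrow> nat \<Rightarrow> nat" where
  "conv_denom \<alpha> 0 = 1"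
| "conv_denom \<alpha> (Suc 0) = nat (partial_quotient \<alpha> 1)"
| "conv_denom \<alpha> (Suc (Suc n)) =
     nat (partial_quotient \<alpha> (Suc (Suc n))) * conv_denom \<alpha> (Suc n) + conv_denom \<alpha> n"

section \<open>Functions on the circle\<close>

text \<open>Functions on \<open>\<real>/\<int>\<close> are represented as functions on the reals of period 1. Continuity,
  Borel measurability and almost-everywhere statements agree for the two representations.\<close>

definition one_periodic :: "(real \<Rightarrow> 'a) \<Rightarrow> bool" where
  "one_periodic g \<longleftrightarrow> (\<forall>x. g (x + 1) = g x)"

definition birkhoff_sum :: "real \<Rightarrow> (real \<Rightarrow> real) \<Rightarrow> nat \<Rightarrow> real \<Rightarrow> real" where
  "birkhoff_sum \<alpha> g n x = (\<Sum>i<n. g (x + real i * \<alpha>))"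

section \<open>Weak mixing\<close>

definition measure_preserving_map :: "'a measure \<Rightarrow> ('a \<Rightarrow> 'a) \<Rightarrow> bool" where
  "measure_preserving_map M T \<longleftrightarrow>
     T \<in> measurable M M \<and> (\<forall>A\<in>sets M. emeasure M (T -` A \<inter> space M) = emeasure M A)"

definition weakly_mixing :: "'a measure \<Rightarrow> ('a \<Rightarrow> 'a) \<Rightarrow> bool" where
  "weakly_mixing M T \<longleftrightarrow>
     emeasure M (space M) = 1 \<and> measure_preserving_map M T \<and>
     (\<forall>A\<in>sets M. \<forall>B\<in>sets M.
        (\<lambda>n. (\<Sum>i<n. \<bar>measure M (((T ^^ i) -` A \<inter> space M) \<inter> B) - measure M A * measure M B\<bar>) / real n)
          \<longlonglongrightarrow> 0)"

section \<open>Special flows\<close>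

text \<open>The quotient of \<open>(\<real>/\<int>) \<times> \<real>\<close> is formed in one go as a quotient of the plane; the generator
  \<open>(x, y) \<sim> (x + 1, y)\<close> accounts for the passage from \<open>\<real>\<close> to \<open>\<real>/\<int>\<close>.\<close>

definition sf_step :: "real \<Rightarrow> (real \<Rightarrow> real) \<Rightarrow> real \<times> real \<Rightarrow> real \<times> real \<Rightarrow> bool" where
  "sf_step \<alpha> F p q \<longleftrightarrow>
     q = (fst p + 1, snd p) \<or> q = (fst p + \<alpha>, snd p - F (fst p))"

definition sf_rel :: "real \<Rightarrow> (real \<Rightarrow> real) \<Rightarrow> ((real \<times> real) \<times> (real \<times> real)) set" where
  "sf_rel \<alpha> F = {(p, q). equivclp (sf_step \<alpha> F) p q}"

definition sf_space :: "real \<Rightarrow> (real \<Rightarrow> real) \<Rightarrow> (real \<times> real) set set" where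
  "sf_space \<alpha> F = UNIV // sf_rel \<alpha> F"

definition sf_proj :: "real \<Rightarrow> (real \<Rightarrow> real) \<Rightarrow> real \<times> real \<Rightarrow> (real \<times> real) set" where
  "sf_proj \<alpha> F p = sf_rel \<alpha> F `` {p}"

text \<open>The topology is the quotient topology of the Euclidean one.\<close>

definition sf_topology :: "real \<Rightarrow> (real \<Rightarrow> real) \<Rightarrow> (real \<times> real) set topology" where
  "sf_topology \<alpha> F = topology (\<lambda>U. U \<subseteq> sf_space \<alpha> F \<and> open (sf_proj \<alpha> F -` U))"

definition sf_domain :: "(real \<Rightarrow> real) \<Rightarrow> (real \<times> real) set" where
  "sf_domain F = {(x, y). 0 \<le> x \<and> x < 1 \<and> 0 \<le> y \<and> y < F x}"

definition sf_borel :: "real \<Rightarrow> (real \<Rightarrow> real) \<Rightarrow> (real \<times> real) set measure" where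
  "sf_borel \<alpha> F = sigma (sf_space \<alpha> F) {U. openin (sf_topology \<alpha> F) U}"

text \<open>Normalized Lebesgue measure: transported from the fundamental domain, which contains exactly
  one representative of each class.\<close>

definition sf_measure :: "real \<Rightarrow> (real \<Rightarrow> real) \<Rightarrow> (real \<times> real) set measure" where
  "sf_measure \<alpha> F =
     distr (uniform_measure lborel (sf_domain F)) (sf_borel \<alpha> F) (sf_proj \<alpha> F)"

text \<open>Vertical translation commutes with the generators of the relation, so the image of a class
  is again a class; see \<open>sf_flow_proj\<close>.\<close>

definition sf_flow :: "real \<Rightarrow> (real \<times> real) set \<Rightarrow> (real \<times> real) set" where
  "sf_flow t c = (\<lambda>(x, y). (x, y + t)) ` c"

lemma equiv_sf_rel: "equiv UNIV (sf_rel \<alpha> F)"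
  unfolding sf_rel_def
  by (rule equivI)
     (auto simp: refl_on_def sym_def trans_def
           intro: equivclp_sym equivclp_trans reflpD[OF reflp_equivclp])

lemma sf_proj_in_space: "sf_proj \<alpha> F p \<in> sf_space \<alpha> F"
  by (simp add: sf_proj_def sf_space_def quotientI)

lemma sf_space_eq: "sf_space \<alpha> F = range (sf_proj \<alpha> F)"
  by (auto simp: sf_proj_def sf_space_def quotient_def)

lemma sf_proj_eq_iff: "sf_proj \<alpha> F p = sf_proj \<alpha> F q \<longleftrightarrow> equivclp (sf_step \<alpha> F) p q"
  using eq_equiv_class_iff[OF equiv_sf_rel, of p q \<alpha> F]
  by (simp add: sf_proj_def sf_rel_def)

lemma sf_rel_shift:
  assumes "equivclp (sf_step \<alpha> F) p q"
  shows "equivclp (sf_step \<alpha> F) (fst p, snd p + t) (fst q, snd q + t)"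
  using assms
proof (induction rule: equivclp_induct)
  case base
  show ?case by (rule reflpD[OF reflp_equivclp])
next
  case (step y z)
  have "sf_step \<alpha> F (fst y, snd y + t) (fst z, snd z + t) \<or>
        sf_step \<alpha> F (fst z, snd z + t) (fst y, snd y + t)"
    using step(2) by (auto simp: sf_step_def)
  then show ?case
    using step(3) by (meson equivclp_into_equivclp)
qed

lemma sf_flow_proj: "sf_flow t (sf_proj \<alpha> F (x, y)) = sf_proj \<alpha> F (x, y + t)"
proof (intro set_eqI iffI)
  fix q assume "q \<in> sf_flow t (sf_proj \<alpha> F (x, y))"
  then show "q \<in> sf_proj \<alpha> F (x, y + t)"
    using sf_rel_shift[of \<alpha> F "(x, y)" _ t]
    by (fastforce simp: sf_flow_def sf_proj_def sf_rel_def)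
next
  fix q assume "q \<in> sf_proj \<alpha> F (x, y + t)"
  then have "equivclp (sf_step \<alpha> F) (x, y) (fst q, snd q - t)"
    using sf_rel_shift[of \<alpha> F "(x, y + t)" q "- t"] by (simp add: sf_proj_def sf_rel_def)
  then show "q \<in> sf_flow t (sf_proj \<alpha> F (x, y))"
    by (force simp: sf_flow_def sf_proj_def sf_rel_def)
qed

lemma openin_sf_topology:
  "openin (sf_topology \<alpha> F) U \<longleftrightarrow> U \<subseteq> sf_space \<alpha> F \<and> open (sf_proj \<alpha> F -` U)"
proof -
  have "istopology (\<lambda>U. U \<subseteq> sf_space \<alpha> F \<and> open (sf_proj \<alpha> F -` U))"
    unfolding istopology_def by (auto simp: vimage_Union)
  then show ?thesis
    by (simp add: sf_topology_def)
qed

lemma topspace_sf_topology: "topspace (sf_topology \<alpha> F) = sf_space \<alpha> F"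
proof (rule antisym)
  show "topspace (sf_topology \<alpha> F) \<subseteq> sf_space \<alpha> F"
    by (auto simp: topspace_def openin_sf_topology)
  have "sf_proj \<alpha> F -` sf_space \<alpha> F = UNIV"
    by (auto simp: sf_proj_in_space)
  then show "sf_space \<alpha> F \<subseteq> topspace (sf_topology \<alpha> F)"
    by (intro openin_subset) (simp add: openin_sf_topology)
qed

lemma quotient_map_sf_proj: "quotient_map euclidean (sf_topology \<alpha> F) (sf_proj \<alpha> F)"
  by (auto simp: quotient_map_def topspace_sf_topology sf_space_eq openin_sf_topology vimage_def)

lemma measurable_sf_proj: "sf_proj \<alpha> F \<in> borel \<rightarrow>\<^sub>M sf_borel \<alpha> F"
  unfolding sf_borel_def
proof (rule measurable_measure_of)
  show "{U. openin (sf_topology \<alpha> F) U} \<subseteq> Pow (sf_space \<alpha> F)"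
    by (auto simp: openin_sf_topology)
qed (auto simp: openin_sf_topology sf_proj_in_space)

end

theory Submission
  imports Defs
begin

text \<open>Moving a point along the equivalence relation turns the time-\<open>C\<close> map into a skew product:
  \<open>T\<^sub>C\<^sup>n [(x, y)] = [(x + n \<alpha>, y - S\<^sub>n(g)(x))]\<close>. With \<open>q = q\<^sub>n\<close> and \<open>Q = q\<^sub>n\<^sub>+\<^sub>1\<close>,
  hypothesis (ii) and \<open>\<parallel>q \<alpha>\<parallel> < 1/Q\<close> make \<open>T\<^sub>C\<^sup>i\<^sup>q\<close> uniformly close to the
  identity for \<open>i = O(Q\<^sup>4\<^sup>/\<^sup>5)\<close>.

  Squares: on a block of about \<open>Q\<^sup>4\<^sup>/\<^sup>5\<close> consecutive integers \<open>m = O(Q)\<close>, the point \<open>T\<^sub>C\<close> to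
  the power \<open>m\<^sup>2\<close> applied to \<open>z\<close> depends essentially only on \<open>m\<^sup>2\<close> modulo \<open>Q\<close>, and the resulting
  function on \<open>\<int>/Q\<int>\<close> hardly changes under translation by \<open>i q\<close>, \<open>i = O(Q\<^sup>4\<^sup>/\<^sup>5)\<close>. Hence
  only the frequencies \<open>b/Q\<close> with \<open>b q\<close> congruent to some \<open>j = O(Q\<^sup>1\<^sup>/\<^sup>5)\<close> modulo \<open>Q\<close>
  matter; for \<open>j \<noteq> 0\<close> these have denominator at least of order \<open>Q\<^sup>4\<^sup>/\<^sup>5\<close> in lowest terms, so
  Weyl's bound for quadratic exponential sums applies and the block average is close to the
  full average over \<open>\<int>/Q\<int>\<close>, which tends to the integral by unique ergodicity. The
  same at the level below gives the average over \<open>m < q\<close>; since the cross term of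
  \<open>(j q + k)\<^sup>2\<close> is a multiple of \<open>q\<close>, rigidity carries it over to all blocks of length \<open>q\<close>
  with \<open>m = O(Q\<^sup>4\<^sup>/\<^sup>5)\<close>. The two ranges together cover all \<open>N\<close>.

  Weak mixing and unique ergodicity both follow from the absence of eigenfunctions: the Fourier
  coefficients of an eigenfunction along the flow direction solve the cohomological equation
  excluded by hypothesis (iii).\<close>

section \<open>Continued fraction denominators\<close>

text \<open>The exponent 4/5 is used as follows. If the block of squares and the family of
  translates both have length P, about Q^(4/5), then Cauchy-Schwarz over all nonzero frequencies
  leaves a relative error of order log Q * Q / P^(3/2), that is log Q * Q^(-1/5). Squaring calls for
  rigidity on two levels. Translation by multiples of q uses that of q, but reducing (M + k)^2 - M^2
  modulo Q discards O(P) multiples of Q, and this is paid for by the rigidity of Q relative to the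
  denominator after it. A block of length P gives nothing until N is large against Q^(4/5), because
  the incomplete last block is only bounded trivially; for smaller N the blocks have length q. Each
  reduction moves the starting point of the orbit, so all estimates are kept uniform in that
  point.\<close>

lemma irrational_cf_remainder:
  assumes "\<alpha> \<notin> \<rat>"
  shows "cf_remainder \<alpha> n \<notin> \<rat>"
proof (induction n)
  case (Suc n)
  show ?case
  proof
    assume *: "cf_remainder \<alpha> (Suc n) \<in> \<rat>"
    then have "1 / cf_remainder \<alpha> (Suc n) \<in> \<rat>" by (intro Rats_divide) auto
    then have "frac (cf_remainder \<alpha> n) \<in> \<rat>" by simp
    then have "frac (cf_remainder \<alpha> n) + of_int \<lfloor>cf_remainder \<alpha> n\<rfloor> \<in> \<rat>" by (intro Rats_add) auto
    then show False using Suc by (simp add: frac_def)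
  qed
qed (use assms in simp)

lemma frac_cf_remainder:
  assumes "\<alpha> \<notin> \<rat>"
  shows "0 < frac (cf_remainder \<alpha> n)" "frac (cf_remainder \<alpha> n) < 1"
  using irrational_cf_remainder[OF assms, of n] Ints_subset_Rats
  by (auto simp: frac_gt_0_iff frac_lt_1)

lemma partial_quotient_pos:
  assumes "\<alpha> \<notin> \<rat>"
  shows "partial_quotient \<alpha> (Suc n) \<ge> 1"
  unfolding partial_quotient_def using frac_cf_remainder[OF assms, of n]
  by (simp add: le_floor_iff)

lemma conv_denom_pos:
  assumes "\<alpha> \<notin> \<rat>"
  shows "conv_denom \<alpha> n \<ge> 1"
proof (induction n rule: less_induct)
  case (less n)
  consider "n = 0" | "n = 1" | k where "n = Suc (Suc k)" by (metis One_nat_def not0_implies_Suc)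
  then show ?case
  proof cases
    case 2
    then show ?thesis using partial_quotient_pos[OF assms, of 0] by simp
  next
    case 3
    then show ?thesis using less[of k] by simp
  qed simp
qed

lemma conv_denom_add_le:
  assumes "\<alpha> \<notin> \<rat>"
  shows "conv_denom \<alpha> (Suc n) + conv_denom \<alpha> n \<le> conv_denom \<alpha> (Suc (Suc n))"
proof -
  have "1 \<le> nat (partial_quotient \<alpha> (Suc (Suc n)))"
    using partial_quotient_pos[OF assms, of "Suc n"] by linarith
  then have "1 * conv_denom \<alpha> (Suc n) \<le> nat (partial_quotient \<alpha> (Suc (Suc n))) * conv_denom \<alpha> (Suc n)"
    by (intro mult_right_mono) auto
  then show ?thesis by simp
qed

lemma conv_denom_mono:
  assumes "\<alpha> \<notin> \<rat>"
  shows "conv_denom \<alpha> n \<le> conv_denom \<alpha> (Suc n)"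
proof (cases n)
  case 0
  then show ?thesis using conv_denom_pos[OF assms, of 1] by simp
next
  case (Suc m)
  then show ?thesis using conv_denom_add_le[OF assms, of m] by (simp del: conv_denom.simps)
qed

lemma conv_denom_ge:
  assumes "\<alpha> \<notin> \<rat>"
  shows "conv_denom \<alpha> n \<ge> n"
proof (induction n)
  case (Suc n)
  show ?case
  proof (cases n)
    case 0
    then show ?thesis using conv_denom_pos[OF assms, of 1] by simp
  next
    case (Suc m)
    then show ?thesis
      using conv_denom_add_le[OF assms, of m] conv_denom_pos[OF assms, of m] Suc.IH
      by (simp del: conv_denom.simps)
  qed
qed simp

lemma coprime_conv_denom: "coprime (conv_denom \<alpha> n) (conv_denom \<alpha> (Suc n))"
proof (induction n)
  case (Suc n)
  have "gcd (conv_denom \<alpha> (Suc n)) (nat (partial_quotient \<alpha> (Suc (Suc n))) * conv_denom \<alpha> (Suc n) + conv_denom \<alpha> n)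
      = gcd (conv_denom \<alpha> (Suc n)) (conv_denom \<alpha> n)"
    by (rule gcd_add_mult)
  with Suc show ?case
    by (simp add: coprime_iff_gcd_eq_1 gcd.commute)
qed simp

text \<open>The signed distances \<open>\<delta>\<^sub>n = q\<^sub>n \<alpha> - p\<^sub>n\<close> satisfy the recurrence of the denominators and
  \<open>\<delta>\<^sub>n\<^sub>+\<^sub>1 = - \<delta>\<^sub>n frac x\<^sub>n\<^sub>+\<^sub>1\<close>, whence \<open>q\<^sub>n\<^sub>+\<^sub>1 \<bar>\<delta>\<^sub>n\<bar> + q\<^sub>n \<bar>\<delta>\<^sub>n\<^sub>+\<^sub>1\<bar> = 1\<close>.\<close>

lemma conv_denom_approx:
  assumes irr: "\<alpha> \<notin> \<rat>"
  shows "\<exists>p::int. \<bar>real (conv_denom \<alpha> n) * \<alpha> - of_int p\<bar> \<le> 1 / real (conv_denom \<alpha> (Suc n))"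
proof -
  define x where "x = cf_remainder \<alpha>"
  define q where "q = conv_denom \<alpha>"
  define a where "a = partial_quotient \<alpha>"
  have xS: "x (Suc k) * frac (x k) = 1" for k
    using frac_cf_remainder[OF irr, of k] by (simp add: x_def)
  have fr: "frac (x k) = x k - a k" for k
    by (simp add: x_def a_def partial_quotient_def frac_def)
  have qS: "real (q (Suc (Suc k))) = a (Suc (Suc k)) * q (Suc k) + q k" for k
    using partial_quotient_pos[OF irr, of "Suc k"] by (simp add: q_def a_def)
  have q01: "q 0 = 1" "real (q (Suc 0)) = a 1"
    using partial_quotient_pos[OF irr, of 0] by (simp_all add: q_def a_def)
  \<comment> \<open>Besides the recursion the induction carries the determinant identity and the
    sign of \<open>d\<close>. The sign allows the absolute value of \<open>d\<close> to be replaced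
    by multiplication with (-1)^k at the end.\<close>
  have main: "\<exists>(p::int) p'::int. (let d = q k * \<alpha> - p; d' = q (Suc k) * \<alpha> - p' in
      d' = - d * frac (x (Suc k)) \<and> (q (Suc k) * d - q k * d') = (-1)^k \<and> (-1)^k * d > 0)" for k
  proof (induction k)
    case 0
    have "q 1 * \<alpha> - (a 0 * a 1 + 1) = a 1 * frac (x 0) - x 1 * frac (x 0)"
      using xS[of 0] q01 by (simp add: fr) (simp add: x_def algebra_simps)
    also have "\<dots> = - frac (x 0) * frac (x 1)" by (simp add: fr algebra_simps)
    finally have 1: "q 1 * \<alpha> - (a 0 * a 1 + 1) = - frac (x 0) * frac (x 1)" .
    have 2: "q 0 * \<alpha> - a 0 = frac (x 0)" using q01 by (simp add: fr) (simp add: x_def)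
    have 3: "q 1 * frac (x 0) - q 0 * (- frac (x 0) * frac (x 1)) = 1"
      using xS[of 0] q01 by (simp add: fr algebra_simps)
    show ?case
      by (rule exI[of _ "a 0"], rule exI[of _ "a 0 * a 1 + 1"])
         (use 1 2 3 frac_cf_remainder[OF irr, of 0] in \<open>simp add: Let_def x_def\<close>)
  next
    case (Suc k)
    then obtain p p' :: int where *: "q (Suc k) * \<alpha> - p' = - (q k * \<alpha> - p) * frac (x (Suc k))"
      "q (Suc k) * (q k * \<alpha> - p) - q k * (q (Suc k) * \<alpha> - p') = (-1)^k" "(-1)^k * (q k * \<alpha> - p) > 0"
      unfolding Let_def by blast
    define d where "d = q k * \<alpha> - p"
    define d' where "d' = q (Suc k) * \<alpha> - p'"
    define p'' where "p'' = a (Suc (Suc k)) * p' + p"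
    have n: "q (Suc (Suc k)) * \<alpha> - p'' = a (Suc (Suc k)) * d' + d"
      unfolding qS p''_def d_def d'_def by (simp add: algebra_simps)
    have "x (Suc (Suc k)) * d' = - d * (x (Suc (Suc k)) * frac (x (Suc k)))"
      using *(1) by (simp add: d_def d'_def)
    \<comment> \<open>As \<open>x (Suc (Suc k))\<close> is the reciprocal of
      \<open>frac (x (Suc k))\<close>, the recursion can be solved for \<open>d\<close>; the
      three-term recurrence then collapses to -(x - a) d' = - d' frac x.\<close>
    then have dd: "d = - x (Suc (Suc k)) * d'" using xS by simp
    have c1: "q (Suc (Suc k)) * \<alpha> - p'' = - d' * frac (x (Suc (Suc k)))"
      unfolding n fr using dd by (simp add: algebra_simps)
    have c2: "q (Suc (Suc k)) * d' - q (Suc k) * (q (Suc (Suc k)) * \<alpha> - p'') = (-1)^(Suc k)"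
    proof -
      have "q (Suc k) * d - q k * d' = (-1)^k" unfolding d_def d'_def by (rule *(2))
      then show ?thesis unfolding n unfolding qS by (simp add: algebra_simps)
    qed
    have c3: "(-1)^Suc k * d' > 0"
    proof -
      have "(-1)^Suc k * d' = ((-1)^k * d) * frac (x (Suc k))"
        unfolding d'_def *(1) d_def by (simp add: algebra_simps)
      then show ?thesis using *(3) frac_cf_remainder[OF irr, of "Suc k"] by (simp add: d_def x_def)
    qed
    show ?case
      by (rule exI[of _ p'], rule exI[of _ p''])
         (use c1 c2 c3 in \<open>simp add: Let_def d'_def[symmetric]\<close>)
  qed
  obtain p p' :: int where *: "q (Suc n) * \<alpha> - p' = - (q n * \<alpha> - p) * frac (x (Suc n))"
      "q (Suc n) * (q n * \<alpha> - p) - q n * (q (Suc n) * \<alpha> - p') = (-1)^n" "(-1)^n * (q n * \<alpha> - p) > 0"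
    using main[of n] unfolding Let_def by blast
  define d where "d = (-1)^n * (q n * \<alpha> - p)"
  have d0: "d > 0" using * by (simp add: d_def)
  have abs_d: "\<bar>q n * \<alpha> - p\<bar> = d"
    using d0 unfolding d_def by (cases "even n") auto
  have e: "(-1)^n * (q (Suc n) * \<alpha> - p') = - d * frac (x (Suc n))"
    unfolding *(1) d_def by (simp add: algebra_simps)
  have "(-1)^n * (q (Suc n) * (q n * \<alpha> - p) - q n * (q (Suc n) * \<alpha> - p')) = (1::real)"
    unfolding *(2) by (simp flip: power_mult_distrib)
  then have "q (Suc n) * d - q n * ((-1)^n * (q (Suc n) * \<alpha> - p')) = 1"
    unfolding d_def by (simp add: algebra_simps)
  then have "q (Suc n) * d + q n * d * frac (x (Suc n)) = 1"
    unfolding e by simp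
  moreover have "q n * d * frac (x (Suc n)) \<ge> 0" using d0 by (simp add: frac_ge_0)
  ultimately have "q (Suc n) * d \<le> 1" by linarith
  moreover have "q (Suc n) > 0" using conv_denom_pos[OF irr, of "Suc n"] by (simp add: q_def)
  ultimately have "d \<le> 1 / q (Suc n)" by (simp add: field_simps)
  then show ?thesis using abs_d by (auto simp: q_def)
qed

section \<open>Characters and the discrete Fourier transform\<close>

definition ee :: "real \<Rightarrow> complex" where
  "ee x = cis (2 * pi * x)"

lemma ee_add: "ee (x + y) = ee x * ee y"
  by (simp add: ee_def cis_mult algebra_simps)

lemma ee_0 [simp]: "ee 0 = 1"
  by (simp add: ee_def)

lemma norm_ee [simp]: "norm (ee x) = 1"
  by (simp add: ee_def)

lemma ee_nonzero [simp]: "ee x \<noteq> 0"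
  by (simp add: ee_def)

lemma cnj_ee: "cnj (ee x) = ee (- x)"
  by (simp add: ee_def cis_cnj)

lemma ee_of_int [simp]: "ee (of_int k) = 1"
  using cis_multiple_2pi[of "of_int k"] by (simp add: ee_def)

lemma ee_add_of_int: "ee (x + of_int k) = ee x"
  by (simp add: ee_add)

lemma ee_eq_1_iff: "ee x = 1 \<longleftrightarrow> x \<in> \<int>"
proof
  assume "ee x = 1"
  then have "cos (2 * pi * x) = 1"
    by (metis ee_def cis.simps(1) one_complex.simps(1))
  then obtain k :: int where "2 * pi * x = of_int k * 2 * pi"
    using cos_one_2pi_int by auto
  then have "x = of_int k" by simp
  then show "x \<in> \<int>" by simp
qed (auto elim!: Ints_cases)

lemma ee_eq_iff: "ee x = ee y \<longleftrightarrow> x - y \<in> \<int>"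
  using ee_eq_1_iff[of "x - y"] ee_add[of "x - y" y] by auto

lemma ee_mult_nat: "ee (of_nat k * x) = ee x ^ k"
  by (simp add: ee_def Complex.DeMoivre algebra_simps)

text \<open>A weak Jordan inequality. The double angle formula and the mean value theorem give sin x
  = x cos z cos (x/2) with z < x/2, and both cosines are at least sqrt 2 / 2.\<close>

lemma sin_ge_half:
  assumes "0 \<le> x" "x \<le> pi / 2"
  shows "x / 2 \<le> sin x"
proof (cases "x = 0")
  case False
  then have x: "0 < x / 2" using assms by simp
  have "\<exists>z. 0 < z \<and> z < x/2 \<and> sin (x/2) - sin 0 = (x/2 - 0) * cos z"
    by (rule MVT2[OF x]) (auto intro!: derivative_eq_intros)
  then obtain z where z: "0 < z" "z < x/2" "sin (x/2) = x/2 * cos z" by auto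
  have c: "cos (pi/4) \<le> cos t" if "0 \<le> t" "t \<le> pi/4" for t
    using that by (intro cos_monotone_0_pi_le) auto
  have c': "sqrt 2 / 2 \<le> cos t" if "0 \<le> t" "t \<le> pi/4" for t
    using c[OF that] by (simp add: cos_45)
  have "sin x = 2 * sin (x/2) * cos (x/2)"
    using sin_double[of "x/2"] by simp
  also have "\<dots> = x * (cos z * cos (x/2))" using z by simp
  also have "\<dots> \<ge> x * (sqrt 2 / 2 * (sqrt 2 / 2))"
    using z assms c'[of z] c'[of "x/2"] order_trans[of 0 "sqrt 2 / 2" "cos z"]
    by (intro mult_left_mono mult_mono) auto
  finally show ?thesis by simp
qed simp

lemma norm_one_minus_ee: "norm (1 - ee x) = 2 * \<bar>sin (pi * x)\<bar>"
proof -
  have "(norm (1 - ee x))\<^sup>2 = (1 - cos (2 * (pi * x)))\<^sup>2 + (sin (2 * (pi * x)))\<^sup>2"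
    by (simp add: ee_def cmod_power2 mult.assoc)
  also have "\<dots> = 2 - 2 * cos (2 * (pi * x))"
    using sin_cos_squared_add[of "2 * (pi * x)"] by (simp add: power2_eq_square algebra_simps)
  also have "\<dots> = (2 * \<bar>sin (pi * x)\<bar>)\<^sup>2"
    by (simp add: cos_double_sin)
  finally show ?thesis by (subst (asm) power2_eq_iff_nonneg) auto
qed

text \<open>The distance from \<open>m\<close> to the nearest multiple of \<open>Q\<close>; divided
  by \<open>Q\<close> it is the distance of m/Q from the nearest integer.\<close>

definition int_dist :: "int \<Rightarrow> int \<Rightarrow> int" where
  "int_dist Q m = min (m mod Q) (Q - m mod Q)"

lemma int_dist_pos: "Q > 0 \<Longrightarrow> \<not> Q dvd m \<Longrightarrow> int_dist Q m > 0"
  unfolding int_dist_def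
  by (metis diff_gt_0_iff_gt dvd_eq_mod_eq_0 min_less_iff_conj pos_mod_bound pos_mod_sign order_le_less)

lemma ee_cong:
  assumes "Q \<noteq> 0" "m mod Q = m' mod Q"
  shows "ee (of_int m / of_int Q) = ee (of_int m' / of_int Q)"
proof -
  obtain k where k: "m - m' = Q * k" using assms by (metis mod_eq_dvd_iff dvd_def)
  have "of_int m / of_int Q - of_int m' / (of_int Q :: real) = of_int (m - m') / of_int Q"
    by (simp add: diff_divide_distrib)
  also have "\<dots> = of_int k" using assms k by simp
  finally show ?thesis by (simp add: ee_eq_iff)
qed

text \<open>The left side is 2 |sin (pi s)| with s the fractional part of m/Q.
  \<open>sin_ge_half\<close> applies to s or to 1 - s, whichever is at most 1/2, and the factor pi
  is rounded down to 1.\<close>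

lemma norm_one_minus_ee_ge:
  assumes Q: "Q > 0" and m: "\<not> Q dvd m"
  shows "norm (1 - ee (of_int m / of_int Q)) \<ge> of_int (int_dist Q m) / of_int Q"
proof -
  define t where "t = m mod Q"
  have t: "0 < t" "t < Q"
    using Q m pos_mod_bound[of Q m] pos_mod_sign[of Q m]
    by (auto simp: t_def dvd_eq_mod_eq_0 simp del: pos_mod_bound pos_mod_sign)
  define s where "s = (of_int t / of_int Q :: real)"
  have s: "0 < s" "s < 1" using t by (auto simp: s_def)
  have "ee (of_int m / of_int Q) = ee s"
    unfolding s_def t_def using Q by (intro ee_cong) auto
  then have n: "norm (1 - ee (of_int m / of_int Q)) = 2 * \<bar>sin (pi * s)\<bar>"
    by (simp add: norm_one_minus_ee)
  have d: "of_int (int_dist Q m) / of_int Q = min s (1 - s)"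
    unfolding int_dist_def t_def[symmetric] s_def using Q
    by (auto simp: min_def field_simps)
  have pi1: "3 < pi" by (rule pi_gt3)
  have "min s (1 - s) \<le> 2 * sin (pi * s)"
  proof (cases "s \<le> 1/2")
    case True
    have "pi * s / 2 \<le> sin (pi * s)"
      using s True by (intro sin_ge_half) auto
    moreover have "1 * s \<le> pi * s" using s pi1 by (intro mult_right_mono) auto
    ultimately show ?thesis by simp
  next
    case False
    have "pi * (1 - s) / 2 \<le> sin (pi * (1 - s))"
      using s False by (intro sin_ge_half) (auto simp: algebra_simps)
    moreover have "sin (pi * (1 - s)) = sin (pi * s)"
      by (simp add: right_diff_distrib)
    moreover have "1 * (1 - s) \<le> pi * (1 - s)" using s pi1 by (intro mult_right_mono) auto
    ultimately show ?thesis by simp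
  qed
  then show ?thesis using n d by linarith
qed

text \<open>The bound does not see the length of the interval. The phase \<open>c\<close> absorbs
  the part of a differenced quadratic phase that does not depend on the summation variable.\<close>

lemma norm_geometric_sum_ee:
  fixes A B :: int
  assumes Q: "Q > 0" and m: "\<not> Q dvd m"
  shows "norm (\<Sum>n\<in>{A..<B}. ee (of_int (m * n + c) / of_int Q)) \<le> 2 * of_int Q / of_int (int_dist Q m)"
proof (cases "A \<le> B")
  case True
  define z where "z = ee (of_int m / of_int Q)"
  have pos: "0 < (of_int (int_dist Q m) :: real)"
    using int_dist_pos[OF Q m] by simp
  have nz1: "norm (1 - z) \<ge> of_int (int_dist Q m) / of_int Q"
    unfolding z_def by (rule norm_one_minus_ee_ge[OF Q m])
  moreover have "of_int (int_dist Q m) / of_int Q > (0::real)" using pos Q by simp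
  ultimately have nz: "norm (1 - z) > 0" by linarith
  define N where "N = nat (B - A)"
  have "(\<Sum>n\<in>{A..<B}. ee (of_int (m * n + c) / of_int Q)) =
        (\<Sum>k<N. ee (of_int (m * (A + int k) + c) / of_int Q))"
    by (rule sum.reindex_bij_witness[of _ "\<lambda>k. A + int k" "\<lambda>n. nat (n - A)"])
       (use True in \<open>auto simp: N_def\<close>)
  also have "\<dots> = (\<Sum>k<N. ee (of_int (m * A + c) / of_int Q) * z ^ k)"
    unfolding z_def ee_mult_nat[symmetric] ee_add[symmetric]
    by (intro sum.cong refl arg_cong[where f = ee]) (simp add: algebra_simps add_divide_distrib)
  also have "\<dots> = ee (of_int (m * A + c) / of_int Q) * (\<Sum>k<N. z ^ k)"
    by (simp add: sum_distrib_left)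
  finally have "norm (\<Sum>n\<in>{A..<B}. ee (of_int (m * n + c) / of_int Q)) = norm (\<Sum>k<N. z ^ k)"
    by (simp add: norm_mult)
  also have "(1 - z) * (\<Sum>k<N. z ^ k) = 1 - z ^ N"
    by (simp add: one_diff_power_eq)
  then have "norm (1 - z) * norm (\<Sum>k<N. z ^ k) = norm (1 - z ^ N)"
    by (metis norm_mult)
  then have "norm (\<Sum>k<N. z ^ k) = norm (1 - z ^ N) / norm (1 - z)"
    using nz by (simp add: field_simps)
  also have "\<dots> \<le> 2 / (of_int (int_dist Q m) / of_int Q)"
  proof (rule frac_le)
    show "norm (1 - z ^ N) \<le> 2"
      using norm_triangle_ineq4[of 1 "z ^ N"] by (simp add: norm_power z_def)
    show "0 < real_of_int (int_dist Q m) / real_of_int Q" using pos Q by simp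
  qed (use nz1 in auto)
  finally show ?thesis by simp
next
  case False
  then show ?thesis using int_dist_pos[OF Q m] Q by simp
qed

lemma sum_ee_orthogonal:
  assumes Q: "(Q::int) > 0"
  shows "(\<Sum>b\<in>{0..<Q}. ee (of_int (b * m) / of_int Q)) = (if Q dvd m then of_int Q else 0)"
proof (cases "Q dvd m")
  case True
  then obtain k where "m = Q * k" by auto
  then have "ee (of_int (b * m) / of_int Q) = 1" for b
    using Q ee_of_int[of "b * k"] by simp
  then show ?thesis using True Q by simp
next
  case False
  define z where "z = ee (of_int m / of_int Q)"
  have "z \<noteq> 1"
  proof
    assume "z = 1"
    then obtain k where "of_int m / of_int Q = (of_int k :: real)"
      unfolding z_def ee_eq_1_iff by (auto elim: Ints_cases)
    then have "of_int m = (of_int (k * Q) :: real)" using Q by (simp add: field_simps)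
    then have "m = k * Q" using of_int_eq_iff by blast
    then show False using False by simp
  qed
  have "(\<Sum>b\<in>{0..<Q}. ee (of_int (b * m) / of_int Q)) = (\<Sum>k<nat Q. z ^ k)"
    by (rule sum.reindex_bij_witness[of _ "\<lambda>k. int k" "\<lambda>n. nat n"])
       (use Q in \<open>auto simp: z_def ee_mult_nat[symmetric]\<close>)
  also have "\<dots> = 0"
  proof -
    have "z ^ nat Q = ee (of_int m)"
      unfolding z_def ee_mult_nat[symmetric] using Q by simp
    then have "(1 - z) * (\<Sum>k<nat Q. z ^ k) = 0"
      by (simp add: one_diff_power_eq[symmetric])
    then show ?thesis using \<open>z \<noteq> 1\<close> by simp
  qed
  finally show ?thesis using False by simp
qed

text \<open>The exponents \<open>t i\<close> may coincide modulo \<open>Q\<close>; orthogonality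
  keeps exactly the pairs that agree. This generality serves the correlations of a dynamical system,
  where an index is a pair of times and its exponent their difference.\<close>

lemma dft_parseval_general:
  assumes Q: "(Q::int) > 0" and fin: "finite I"
  shows "(\<Sum>b\<in>{0..<Q}. (norm (\<Sum>i\<in>I. a i * ee (of_int (b * t i) / of_int Q)))\<^sup>2) =
         Re (of_int Q * (\<Sum>i\<in>I. \<Sum>i'\<in>I. if Q dvd t i - t i' then a i * cnj (a i') else 0))"
proof -
  have "complex_of_real (\<Sum>b\<in>{0..<Q}. (norm (\<Sum>i\<in>I. a i * ee (of_int (b * t i) / of_int Q)))\<^sup>2) =
        (\<Sum>b\<in>{0..<Q}. \<Sum>i\<in>I. \<Sum>i'\<in>I. a i * cnj (a i') * ee (of_int (b * (t i - t i')) / of_int Q))"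
    unfolding of_real_sum complex_norm_square cnj_sum
    by (simp add: sum_product cnj_ee ee_add[symmetric] mult_ac flip: diff_divide_distrib)
       (simp add: algebra_simps ee_add[symmetric] diff_divide_distrib)
  also have "\<dots> = (\<Sum>i\<in>I. \<Sum>i'\<in>I. a i * cnj (a i') * (\<Sum>b\<in>{0..<Q}. ee (of_int (b * (t i - t i')) / of_int Q)))"
    by (subst sum.swap, rule sum.cong[OF refl], subst sum.swap) (simp add: sum_distrib_left)
  also have "\<dots> = of_int Q * (\<Sum>i\<in>I. \<Sum>i'\<in>I. if Q dvd t i - t i' then a i * cnj (a i') else 0)"
    unfolding sum_ee_orthogonal[OF Q] sum_distrib_left
    by (intro sum.cong refl) auto
  finally show ?thesis by (metis Re_complex_of_real)
qed

lemma dft_parseval: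
  assumes Q: "(Q::int) > 0"
  shows "(\<Sum>b\<in>{0..<Q}. (norm (\<Sum>k\<in>{0..<Q}. a k * ee (of_int (b * k) / of_int Q)))\<^sup>2) =
         of_int Q * (\<Sum>k\<in>{0..<Q}. (norm (a k))\<^sup>2)"
proof -
  have *: "(\<Sum>k'\<in>{0..<Q}. if Q dvd k - k' then a k * cnj (a k') else 0) = a k * cnj (a k)"
    if "k \<in> {0..<Q}" for k
  proof -
    have "Q dvd k - k' \<longleftrightarrow> k = k'" if "k' \<in> {0..<Q}" for k'
      using that \<open>k \<in> {0..<Q}\<close> by (auto simp flip: mod_eq_dvd_iff)
    then have "(\<Sum>k'\<in>{0..<Q}. if Q dvd k - k' then a k * cnj (a k') else 0) =
          (\<Sum>k'\<in>{0..<Q}. if k = k' then a k * cnj (a k') else 0)"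
      by (intro sum.cong refl) auto
    also have "\<dots> = a k * cnj (a k)" using that by (simp add: sum.delta)
    finally show ?thesis .
  qed
  have "(\<Sum>k\<in>{0..<Q}. \<Sum>k'\<in>{0..<Q}. if Q dvd k - k' then a k * cnj (a k') else 0) =
        of_real (\<Sum>k\<in>{0..<Q}. (norm (a k))\<^sup>2)"
    unfolding of_real_sum complex_norm_square by (rule sum.cong[OF refl]) (rule *)
  then show ?thesis
    using dft_parseval_general[OF Q, of "{0..<Q}" a "\<lambda>k. k"] by simp
qed

lemma dft_inversion:
  assumes Q: "(Q::int) > 0" and per: "\<And>m. u (m mod Q) = u m"
  shows "u m = (\<Sum>b\<in>{0..<Q}. (\<Sum>k\<in>{0..<Q}. u k * ee (of_int (b * (- k)) / of_int Q)) * ee (of_int (b * m) / of_int Q)) / of_int Q"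
proof -
  have "(\<Sum>b\<in>{0..<Q}. (\<Sum>k\<in>{0..<Q}. u k * ee (of_int (b * (- k)) / of_int Q)) * ee (of_int (b * m) / of_int Q)) =
     (\<Sum>b\<in>{0..<Q}. \<Sum>k\<in>{0..<Q}. u k * ee (of_int (b * (m - k)) / of_int Q))"
    unfolding sum_distrib_right mult.assoc ee_add[symmetric]
    by (intro sum.cong refl arg_cong2[where f = "(*)"] arg_cong[where f = ee])
       (simp add: algebra_simps diff_divide_distrib)
  also have "\<dots> = (\<Sum>k\<in>{0..<Q}. u k * (\<Sum>b\<in>{0..<Q}. ee (of_int (b * (m - k)) / of_int Q)))"
    by (subst sum.swap) (simp add: sum_distrib_left)
  also have "\<dots> = (\<Sum>k\<in>{0..<Q}. if k = m mod Q then u k * of_int Q else 0)"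
    unfolding sum_ee_orthogonal[OF Q]
    by (intro sum.cong refl) (auto simp flip: mod_eq_dvd_iff)
  also have "\<dots> = u m * of_int Q"
    using Q per by (simp add: sum.delta')
  finally show ?thesis using Q by simp
qed

section \<open>Weyl sums over squares\<close>

text \<open>Squaring out and putting s = n - n' makes the phase linear in n' with slope 2 b s.
  \<open>K\<close> bounds such a linear sum by its length if the slope vanishes modulo
  \<open>Q\<close>, and by a geometric series otherwise.\<close>

lemma weyl_differencing:
  fixes Q b M H :: int
  defines "K \<equiv> \<lambda>m. if Q dvd m then real_of_int H else 2 * of_int Q / of_int (int_dist Q m)"
  assumes Q: "Q > 0" and H: "H > 0"
  shows "(norm (\<Sum>n\<in>{M..<M+H}. ee (of_int (b * n\<^sup>2) / of_int Q)))\<^sup>2 \<le> (\<Sum>s\<in>{-H<..<H}. K (2 * b * s))"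
proof -
  \<comment> \<open>The n' for which both n' and n' + s lie in the block.\<close>
  define J where "J = (\<lambda>s. {max M (M - s)..<min (M + H) (M + H - s)})"
  define E where "E = (\<lambda>s n. ee (of_int (2 * b * s * n + b * s\<^sup>2) / of_int Q))"
  have "complex_of_real ((norm (\<Sum>n\<in>{M..<M+H}. ee (of_int (b * n\<^sup>2) / of_int Q)))\<^sup>2) =
     (\<Sum>n\<in>{M..<M+H}. \<Sum>n'\<in>{M..<M+H}. ee (of_int (b * n\<^sup>2) / of_int Q + - (of_int (b * n'\<^sup>2) / of_int Q)))"
    unfolding complex_norm_square cnj_sum sum_product cnj_ee ee_add ..
  also have "\<dots> = (\<Sum>n\<in>{M..<M+H}. \<Sum>n'\<in>{M..<M+H}. ee (of_int (b * (n\<^sup>2 - n'\<^sup>2)) / of_int Q))"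
    by (intro sum.cong refl arg_cong[where f = ee]) (simp add: algebra_simps diff_divide_distrib)
  also have "\<dots> = (\<Sum>(n, n')\<in>{M..<M+H} \<times> {M..<M+H}. ee (of_int (b * (n\<^sup>2 - n'\<^sup>2)) / of_int Q))"
    by (rule sum.cartesian_product)
  also have "\<dots> = (\<Sum>(s, n)\<in>Sigma {-H<..<H} J. E s n)"
    by (rule sum.reindex_bij_witness[of _ "\<lambda>(s, n). (n + s, n)" "\<lambda>(n, n'). (n - n', n')"])
       (auto simp: J_def E_def power2_eq_square algebra_simps)
  also have "\<dots> = (\<Sum>s\<in>{-H<..<H}. \<Sum>n\<in>J s. E s n)"
    by (rule sum.Sigma[symmetric]) (auto simp: J_def)
  finally have "(norm (\<Sum>n\<in>{M..<M+H}. ee (of_int (b * n\<^sup>2) / of_int Q)))\<^sup>2 = norm (\<Sum>s\<in>{-H<..<H}. \<Sum>n\<in>J s. E s n)"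
    by (metis abs_power2 norm_of_real)
  also have "\<dots> \<le> (\<Sum>s\<in>{-H<..<H}. norm (\<Sum>n\<in>J s. E s n))" by (rule norm_sum)
  also have "\<dots> \<le> (\<Sum>s\<in>{-H<..<H}. K (2 * b * s))"
  proof (rule sum_mono)
    fix s
    show "norm (\<Sum>n\<in>J s. E s n) \<le> K (2 * b * s)"
    proof (cases "Q dvd 2 * b * s")
      case True
      have "norm (\<Sum>n\<in>J s. E s n) \<le> (\<Sum>n\<in>J s. 1)"
        by (rule sum_norm_le) (simp add: E_def)
      also have "\<dots> \<le> H" using H by (simp add: J_def)
      finally show ?thesis using True by (simp add: K_def)
    next
      case False
      then show ?thesis
        unfolding J_def E_def K_def
        using norm_geometric_sum_ee[OF Q False, of "b * s\<^sup>2" "max M (M - s)" "min (M + H) (M + H - s)"]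
        by (simp only: if_False)
    qed
  qed
  finally show ?thesis .
qed

text \<open>Pigeonhole: a cell of length \<open>g\<close> holds at most one point, and the floor
  function numbers the cells. The gap is real because it will be Q / (2 j).\<close>

lemma card_separated:
  fixes H :: int and g :: real
  assumes S: "S \<subseteq> {-H<..<H}" and g: "g > 0" and H: "H > 0"
    and sep: "\<And>s s'. s \<in> S \<Longrightarrow> s' \<in> S \<Longrightarrow> s \<noteq> s' \<Longrightarrow> g \<le> of_int \<bar>s - s'\<bar>"
  shows "real (card S) \<le> 2 * of_int H / g + 1"
proof -
  define \<phi> where "\<phi> = (\<lambda>s::int. \<lfloor>of_int (s + H) / g\<rfloor>)"
  have inj: "inj_on \<phi> S"
  proof (rule inj_onI, rule ccontr)
    fix s s' assume *: "s \<in> S" "s' \<in> S" "\<phi> s = \<phi> s'" "s \<noteq> s'"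
    have "\<bar>of_int (s + H) / g - of_int (s' + H) / g\<bar> < 1"
      using *(3) unfolding \<phi>_def by linarith
    then have "\<bar>of_int (s - s') / g\<bar> < 1"
      by (simp add: diff_divide_distrib[symmetric])
    then have "of_int \<bar>s - s'\<bar> < g" using g by (simp add: abs_if field_simps split: if_splits)
    then show False using sep[OF *(1,2,4)] by simp
  qed
  have im: "\<phi> ` S \<subseteq> {0..\<lfloor>2 * of_int H / g\<rfloor>}"
  proof (rule image_subsetI)
    fix s assume "s \<in> S"
    then have s: "-H < s" "s < H" using S by auto
    have "of_int (s + H) / g \<le> 2 * of_int H / g"
      using s g by (intro divide_right_mono) auto
    then show "\<phi> s \<in> {0..\<lfloor>2 * of_int H / g\<rfloor>}"
      using s g unfolding \<phi>_def by (auto intro!: floor_mono)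
  qed
  have "card S \<le> card {0..\<lfloor>2 * of_int H / g\<rfloor>}"
    by (rule card_inj_on_le[OF inj im]) simp
  also have "\<dots> = nat (\<lfloor>2 * of_int H / g\<rfloor> + 1)" by simp
  finally have "real (card S) \<le> of_int \<lfloor>2 * of_int H / g\<rfloor> + 1"
    using g H by (simp add: le_nat_iff)
  then show ?thesis by linarith
qed

text \<open>The reciprocal of a minimum is at most the sum of both reciprocals, and each of the two
  resulting sums is harmonic.\<close>

lemma sum_inverse_int_dist:
  assumes Q: "(Q::int) > 0"
  shows "(\<Sum>t\<in>{1..<Q}. 1 / real_of_int (int_dist Q t)) \<le> 2 * harm (nat Q)"
proof -
  have h: "(\<Sum>t\<in>{1..<Q}. 1 / real_of_int t) \<le> harm (nat Q)"
  proof -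
    have "(\<Sum>t\<in>{1..<Q}. 1 / real_of_int t) = (\<Sum>k\<in>{1..<nat Q}. inverse (real k))"
      by (rule sum.reindex_bij_witness[of _ int nat]) (auto simp: field_simps)
    also have "\<dots> \<le> (\<Sum>k\<in>{1..nat Q}. inverse (real k))"
      by (rule sum_mono2) auto
    finally show ?thesis by (simp add: harm_def)
  qed
  have h': "(\<Sum>t\<in>{1..<Q}. 1 / real_of_int (Q - t)) = (\<Sum>t\<in>{1..<Q}. 1 / real_of_int t)"
    by (rule sum.reindex_bij_witness[of _ "\<lambda>t. Q - t" "\<lambda>t. Q - t"]) auto
  have "(\<Sum>t\<in>{1..<Q}. 1 / real_of_int (int_dist Q t)) \<le>
        (\<Sum>t\<in>{1..<Q}. 1 / real_of_int t + 1 / real_of_int (Q - t))"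
    by (rule sum_mono) (auto simp: int_dist_def min_def)
  also have "\<dots> \<le> 2 * harm (nat Q)"
    unfolding sum.distrib h' using h by simp
  finally show ?thesis .
qed

lemma int_dist_mod: "int_dist Q (m mod Q) = int_dist Q m"
  by (simp add: int_dist_def)

text \<open>After differencing, the question is how often 2 b s hits a given residue. If it does so
  for s and s', multiplication by q shows that Q divides 2 j (s - s') with j the distance of b q
  from the multiples of Q. So such s are Q / (2 j) apart, and each residue is hit at most 4 H j / Q
  + 1 times.\<close>

lemma weyl_square_sum:
  fixes Q b M H q :: int
  assumes Q: "Q > 0" and H: "H > 0" "H \<le> Q" and nd: "\<not> Q dvd b * q"
  shows "(norm (\<Sum>n\<in>{M..<M+H}. ee (of_int (b * n\<^sup>2) / of_int Q)))\<^sup>2 \<le>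
     5 * harm (nat Q) * (4 * of_int H * of_int (int_dist Q (b * q)) + of_int Q)"
proof -
  define h where "h = (harm (nat Q) :: real)"
  define j where "j = int_dist Q (b * q)"
  define K where "K = (\<lambda>m. if Q dvd m then real_of_int H else 2 * of_int Q / of_int (int_dist Q m))"
  have h1: "h \<ge> 1"
  proof -
    have "harm 1 \<le> h" unfolding h_def using Q by (intro harm_mono) auto
    then show ?thesis by (simp add: harm_def)
  qed
  have j: "j > 0" unfolding j_def by (rule int_dist_pos[OF Q nd])
  have K0: "K m \<ge> 0" for m
    using int_dist_pos[OF Q, of m] Q H by (auto simp: K_def)
  have Kmod: "K (m mod Q) = K m" for m
    by (auto simp: K_def int_dist_mod dvd_mod_iff)
  define S where "S = (\<lambda>t. {s\<in>{-H<..<H}. (2 * b * s) mod Q = t})"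
  have cardS: "real (card (S t)) \<le> 4 * of_int H * of_int j / of_int Q + 1" for t
  proof -
    have "real (card (S t)) \<le> 2 * of_int H / (of_int Q / (2 * of_int j)) + 1"
    proof (rule card_separated[OF _ _ H(1)])
      fix s s' assume s: "s \<in> S t" "s' \<in> S t" "s \<noteq> s'"
      then have "Q dvd 2 * b * s - 2 * b * s'"
        by (auto simp: S_def mod_eq_dvd_iff[symmetric])
      then have "Q dvd (2 * b * s - 2 * b * s') * q" by (rule dvd_mult2)
      then have 1: "Q dvd 2 * (b * q) * (s - s')" by (simp add: algebra_simps)
      have "Q dvd 2 * j * (s - s')"
      proof -
        define r where "r = (b * q) mod Q"
        have "2 * (b * q) * (s - s') mod Q = 2 * r * (s - s') mod Q"
          unfolding r_def by (intro mod_mult_cong) simp_all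
        with 1 have 2: "Q dvd 2 * r * (s - s')" by (simp add: dvd_eq_mod_eq_0)
        have "2 * (Q - r) * (s - s') = Q * (2 * (s - s')) - 2 * r * (s - s')" by (simp add: algebra_simps)
        then have "Q dvd 2 * (Q - r) * (s - s')" using 2 by simp
        with 2 show ?thesis unfolding j_def int_dist_def r_def[symmetric] min_def by auto
      qed
      moreover have "2 * j * (s - s') \<noteq> 0" using j s(3) by simp
      ultimately have "Q \<le> \<bar>2 * j * (s - s')\<bar>" using Q
        by (metis abs_of_pos dvd_imp_le_int)
      then have "Q \<le> 2 * j * \<bar>s - s'\<bar>" using j by (simp add: abs_mult)
      then have "real_of_int Q \<le> of_int (2 * j * \<bar>s - s'\<bar>)" by (simp only: of_int_le_iff)
      then show "of_int Q / (2 * of_int j) \<le> real_of_int \<bar>s - s'\<bar>"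
        using j by (simp add: field_simps)
    qed (use Q j in \<open>auto simp: S_def\<close>)
    then show ?thesis by (simp add: field_simps)
  qed
  \<comment> \<open>The residue 0 contributes H, at most Q h; the others contribute 2 Q times the
    sum of reciprocal distances, at most 4 Q h. Together they give the constant 5.\<close>
  have sumK: "(\<Sum>t\<in>{0..<Q}. K t) \<le> 5 * h * of_int Q"
  proof -
    have "{0..<Q} = insert 0 {1..<Q}" using Q by auto
    then have "(\<Sum>t\<in>{0..<Q}. K t) = of_int H + (\<Sum>t\<in>{1..<Q}. K t)" by (simp add: K_def)
    also have "(\<Sum>t\<in>{1..<Q}. K t) = (\<Sum>t\<in>{1..<Q}. 2 * of_int Q * (1 / of_int (int_dist Q t)))"
      by (intro sum.cong refl) (auto simp: K_def zdvd_not_zless)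
    also have "\<dots> = 2 * of_int Q * (\<Sum>t\<in>{1..<Q}. 1 / of_int (int_dist Q t))"
      by (simp add: sum_distrib_left)
    also have "\<dots> \<le> 2 * of_int Q * (2 * h)"
      unfolding h_def using sum_inverse_int_dist[OF Q] Q by (intro mult_left_mono) auto
    also have "real_of_int H \<le> of_int Q * h"
      using H h1 Q by (smt (verit) mult_le_cancel_left1 of_int_le_iff of_int_pos)
    finally show ?thesis by (simp add: algebra_simps)
  qed
  have "(norm (\<Sum>n\<in>{M..<M+H}. ee (of_int (b * n\<^sup>2) / of_int Q)))\<^sup>2 \<le> (\<Sum>s\<in>{-H<..<H}. K (2 * b * s))"
    unfolding K_def by (rule weyl_differencing[OF Q H(1)])
  also have "\<dots> = (\<Sum>t\<in>{0..<Q}. \<Sum>s\<in>S t. K (2 * b * s))"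
    unfolding S_def using Q by (intro sum.group[symmetric]) auto
  also have "\<dots> = (\<Sum>t\<in>{0..<Q}. real (card (S t)) * K t)"
  proof (rule sum.cong[OF refl])
    fix t
    have "(\<Sum>s\<in>S t. K (2 * b * s)) = (\<Sum>s\<in>S t. K t)"
      by (rule sum.cong[OF refl]) (use Kmod in \<open>force simp: S_def\<close>)
    then show "(\<Sum>s\<in>S t. K (2 * b * s)) = real (card (S t)) * K t" by simp
  qed
  also have "\<dots> \<le> (\<Sum>t\<in>{0..<Q}. (4 * of_int H * of_int j / of_int Q + 1) * K t)"
    by (intro sum_mono mult_right_mono cardS K0)
  also have "\<dots> = (4 * of_int H * of_int j / of_int Q + 1) * (\<Sum>t\<in>{0..<Q}. K t)"
    by (simp add: sum_distrib_left)
  also have "\<dots> \<le> (4 * of_int H * of_int j / of_int Q + 1) * (5 * h * of_int Q)"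
    using sumK H j Q by (intro mult_left_mono) auto
  also have "\<dots> = 5 * h * (4 * of_int H * of_int j + of_int Q)"
    using Q by (simp add: field_simps)
  finally show ?thesis unfolding h_def j_def .
qed

text \<open>Multiplication by \<open>q\<close> permutes the nonzero residues; the inverse
  permutation is multiplication by the Bezout coefficient \<open>c\<close>.\<close>

lemma sum_inverse_int_dist_mult:
  assumes Q: "(Q::int) > 0" and cop: "coprime q Q"
  shows "(\<Sum>b\<in>{1..<Q}. 1 / real_of_int (int_dist Q (b * q))) \<le> 2 * harm (nat Q)"
proof -
  obtain c d where cd: "c * q + d * Q = 1" using cop bezout_int[of q Q] by (auto simp: coprime_iff_gcd_eq_1)
  have "(q * c) mod Q = (c * q + d * Q) mod Q" by (simp add: mult.commute)
  then have c: "(q * c) mod Q = 1 mod Q" by (simp only: cd)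
  have inv: "(b * q mod Q) * c mod Q = b" "(b * c mod Q) * q mod Q = b" if "b \<in> {1..<Q}" for b
  proof -
    have "b * q mod Q * c mod Q = b * (q * c mod Q) mod Q"
      by (simp add: mod_mult_left_eq mod_mult_right_eq mult.assoc)
    also have "\<dots> = b * 1 mod Q" using c by (metis mod_mult_right_eq)
    finally show "(b * q mod Q) * c mod Q = b" using that by simp
    have "b * c mod Q * q mod Q = b * (q * c mod Q) mod Q"
      by (simp add: mod_mult_left_eq mod_mult_right_eq mult_ac)
    also have "\<dots> = b * 1 mod Q" using c by (metis mod_mult_right_eq)
    finally show "(b * c mod Q) * q mod Q = b" using that by simp
  qed
  have nz: "x mod Q \<in> {1..<Q}" if "(x mod Q) * y mod Q = b" "b \<in> {1..<Q}" for x y b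
  proof -
    have "x mod Q \<noteq> 0" using that by auto
    then show ?thesis using Q pos_mod_bound[of Q x] pos_mod_sign[of Q x]
      by (auto simp del: pos_mod_bound pos_mod_sign)
  qed
  have "(\<Sum>b\<in>{1..<Q}. 1 / real_of_int (int_dist Q (b * q))) = (\<Sum>t\<in>{1..<Q}. 1 / real_of_int (int_dist Q t))"
  proof (rule sum.reindex_bij_witness[of _ "\<lambda>t. t * c mod Q" "\<lambda>b. b * q mod Q"])
    fix t assume t: "t \<in> {1..<Q}"
    show "t * c mod Q * q mod Q = t" by (rule inv(2)[OF t])
    show "t * c mod Q \<in> {1..<Q}" by (rule nz[OF inv(2)[OF t] t])
  next
    fix b assume b: "b \<in> {1..<Q}"
    show "b * q mod Q * c mod Q = b" by (rule inv(1)[OF b])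
    show "b * q mod Q \<in> {1..<Q}" by (rule nz[OF inv(1)[OF b] b])
    show "1 / real_of_int (int_dist Q (b * q mod Q)) = 1 / real_of_int (int_dist Q (b * q))"
      by (simp only: int_dist_mod)
  qed
  then show ?thesis using sum_inverse_int_dist[OF Q] by simp
qed

text \<open>Expand \<open>u\<close> in characters: frequency 0 is the main term. For the others,
  \<open>U\<close> holds the coefficients of \<open>u\<close>, \<open>G\<close> the Weyl sum and
  \<open>D\<close> the geometric sum over translates. Parseval controls \<open>U\<close> in mean
  square. The bound for \<open>G\<close> grows with the distance \<open>j b\<close> while that for
  \<open>D\<close> decays, so that |G D|^2 is of order 1 / j b, whose sum over b is only
  logarithmic.\<close>

lemma square_sum_equidistribution:
  fixes u :: "int \<Rightarrow> complex" and Q q M H L :: int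
  assumes Q: "Q > 0" and cop: "coprime q Q" and H: "H > 0" "H \<le> Q" and L: "L > 0"
    and per: "\<And>m. u (m mod Q) = u m" and bound: "\<And>m. norm (u m) \<le> B"
  shows "norm ((\<Sum>n\<in>{M..<M+H}. \<Sum>i\<in>{0..<L}. u (n\<^sup>2 + i * q)) - of_int (H * L) / of_int Q * (\<Sum>k\<in>{0..<Q}. u k))
     \<le> B * (harm (nat Q) * of_int Q * sqrt (160 * of_int H + 20 * of_int L))"
proof -
  define h where "h = (harm (nat Q) :: real)"
  define U where "U = (\<lambda>b. \<Sum>k\<in>{0..<Q}. u k * ee (of_int (b * (- k)) / of_int Q))"
  define G where "G = (\<lambda>b. \<Sum>n\<in>{M..<M+H}. ee (of_int (b * n\<^sup>2) / of_int Q))"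
  define D where "D = (\<lambda>b. \<Sum>i\<in>{0..<L}. ee (of_int (b * q * i + 0) / of_int Q))"
  define j where "j = (\<lambda>b. real_of_int (int_dist Q (b * q)))"
  have h0: "h \<ge> 0" by (simp add: h_def harm_nonneg)
  have B0: "B \<ge> 0" using bound[of 0] norm_ge_zero order_trans by blast
  have nd: "\<not> Q dvd b * q" if "b \<in> {1..<Q}" for b
  proof
    assume "Q dvd b * q"
    then have "Q dvd b" using cop by (simp add: coprime_commute coprime_dvd_mult_left_iff)
    then show False using that zdvd_imp_le[of Q b] by simp
  qed
  have j0: "j b > 0" if "b \<in> {1..<Q}" for b
    unfolding j_def using int_dist_pos[OF Q nd[OF that]] by simp
  have "(\<Sum>n\<in>{M..<M+H}. \<Sum>i\<in>{0..<L}. u (n\<^sup>2 + i * q)) =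
        (\<Sum>n\<in>{M..<M+H}. \<Sum>i\<in>{0..<L}. (\<Sum>b\<in>{0..<Q}. U b * ee (of_int (b * (n\<^sup>2 + i * q)) / of_int Q)) / of_int Q)"
    unfolding U_def by (intro sum.cong refl dft_inversion[where u = u, OF Q per])
  also have "\<dots> = (\<Sum>n\<in>{M..<M+H}. \<Sum>b\<in>{0..<Q}. \<Sum>i\<in>{0..<L}. U b * ee (of_int (b * (n\<^sup>2 + i * q)) / of_int Q)) / of_int Q"
    unfolding sum_divide_distrib[symmetric] by (subst (2) sum.swap) simp
  also have "(\<Sum>n\<in>{M..<M+H}. \<Sum>b\<in>{0..<Q}. \<Sum>i\<in>{0..<L}. U b * ee (of_int (b * (n\<^sup>2 + i * q)) / of_int Q)) =
        (\<Sum>b\<in>{0..<Q}. U b * (\<Sum>n\<in>{M..<M+H}. \<Sum>i\<in>{0..<L}. ee (of_int (b * (n\<^sup>2 + i * q)) / of_int Q)))"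
    by (subst sum.swap) (simp add: sum_distrib_left)
  also have "\<dots> = (\<Sum>b\<in>{0..<Q}. U b * (G b * D b))"
    unfolding G_def D_def sum_product ee_add[symmetric]
    by (intro sum.cong refl arg_cong2[where f = "(*)"] arg_cong[where f = ee])
       (simp add: algebra_simps add_divide_distrib)
  also have "{0..<Q} = insert 0 {1..<Q}" using Q by auto
  also have "(\<Sum>b\<in>insert 0 {1..<Q}. U b * (G b * D b)) =
      (\<Sum>k\<in>{0..<Q}. u k) * of_int (H * L) + (\<Sum>b\<in>{1..<Q}. U b * (G b * D b))"
    using H L by (simp add: U_def G_def D_def)
  finally have "(\<Sum>n\<in>{M..<M+H}. \<Sum>i\<in>{0..<L}. u (n\<^sup>2 + i * q)) - of_int (H * L) / of_int Q * (\<Sum>k\<in>{0..<Q}. u k)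
     = (\<Sum>b\<in>{1..<Q}. U b * (G b * D b)) / of_int Q"
    by (simp add: add_divide_distrib)
  then have "norm ((\<Sum>n\<in>{M..<M+H}. \<Sum>i\<in>{0..<L}. u (n\<^sup>2 + i * q)) - of_int (H * L) / of_int Q * (\<Sum>k\<in>{0..<Q}. u k))
     = norm (\<Sum>b\<in>{1..<Q}. U b * (G b * D b)) / of_int Q"
    using Q by (simp add: norm_divide)
  also have "norm (\<Sum>b\<in>{1..<Q}. U b * (G b * D b)) \<le> (\<Sum>b\<in>{1..<Q}. norm (U b) * norm (G b * D b))"
    by (rule order_trans[OF norm_sum]) (simp add: norm_mult)
  also have "\<dots> \<le> (of_int Q * B) * (h * of_int Q * sqrt (160 * of_int H + 20 * of_int L))"
  proof (rule power2_le_imp_le)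
    have "(\<Sum>b\<in>{1..<Q}. (norm (U b))\<^sup>2) \<le> (\<Sum>b\<in>{0..<Q}. (norm (U b))\<^sup>2)"
      by (rule sum_mono2) auto
    \<comment> \<open>\<open>U\<close> carries negative frequencies; conjugation turns it into the
      transform of \<open>dft_parseval\<close>.\<close>
    also have "\<dots> = (\<Sum>b\<in>{0..<Q}. (norm (\<Sum>k\<in>{0..<Q}. cnj (u k) * ee (of_int (b * k) / of_int Q)))\<^sup>2)"
    proof (intro sum.cong refl arg_cong[where f = "\<lambda>x. x\<^sup>2"])
      fix b
      have "cnj (U b) = (\<Sum>k\<in>{0..<Q}. cnj (u k) * ee (of_int (b * k) / of_int Q))"
        by (simp add: U_def cnj_ee)
      then show "norm (U b) = norm (\<Sum>k\<in>{0..<Q}. cnj (u k) * ee (of_int (b * k) / of_int Q))"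
        by (metis complex_mod_cnj)
    qed
    also have "\<dots> = of_int Q * (\<Sum>k\<in>{0..<Q}. (norm (cnj (u k)))\<^sup>2)"
      by (rule dft_parseval[OF Q])
    also have "\<dots> \<le> of_int Q * (\<Sum>k\<in>{0..<Q}. B\<^sup>2)"
      using Q bound by (intro mult_left_mono sum_mono power_mono) auto
    also have "\<dots> = (of_int Q * B)\<^sup>2" using Q by (simp add: power2_eq_square)
    finally have U2: "(\<Sum>b\<in>{1..<Q}. (norm (U b))\<^sup>2) \<le> (of_int Q * B)\<^sup>2" .
    \<comment> \<open>The two terms of the Weyl bound meet two different bounds for
      \<open>D\<close>: the one growing with \<open>j b\<close> takes (2 Q / j)^2, the constant one
      takes L * 2 Q / j. Each leaves a single 1 / j. Summation over b contributes 2 h, whence 160 =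
      5 * 16 * 2 and 20 = 5 * 2 * 2.\<close>
    have GD: "(norm (G b * D b))\<^sup>2 \<le> 5 * h * (of_int Q)\<^sup>2 * (16 * of_int H + 2 * of_int L) * (1 / j b)"
      if b: "b \<in> {1..<Q}" for b
    proof -
      have g: "(norm (G b))\<^sup>2 \<le> 5 * h * (4 * of_int H * j b + of_int Q)"
        unfolding G_def h_def j_def by (rule weyl_square_sum[OF Q H nd[OF b]])
      have d1: "norm (D b) \<le> 2 * of_int Q / j b"
        unfolding D_def j_def by (rule norm_geometric_sum_ee[OF Q nd[OF b]])
      have "norm (D b) \<le> (\<Sum>i\<in>{0..<L}. 1)"
        unfolding D_def by (rule sum_norm_le) simp
      then have d2: "norm (D b) \<le> of_int L" using L by simp
      have d3: "(norm (D b))\<^sup>2 \<le> (2 * of_int Q / j b)\<^sup>2"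
        using d1 by (intro power_mono) auto
      have d4: "(norm (D b))\<^sup>2 \<le> of_int L * (2 * of_int Q / j b)"
        unfolding power2_eq_square using d1 d2 L by (intro mult_mono) auto
      have "(norm (G b * D b))\<^sup>2 \<le> 5 * h * (4 * of_int H * j b + of_int Q) * (norm (D b))\<^sup>2"
        unfolding norm_mult power_mult_distrib using g by (intro mult_right_mono) auto
      also have "\<dots> = 5 * h * (4 * of_int H * j b * (norm (D b))\<^sup>2 + of_int Q * (norm (D b))\<^sup>2)"
        by (simp add: algebra_simps)
      also have "\<dots> \<le> 5 * h * (4 * of_int H * j b * (2 * of_int Q / j b)\<^sup>2 + of_int Q * (of_int L * (2 * of_int Q / j b)))"
        using h0 H Q j0[OF b] d3 d4 by (intro mult_left_mono add_mono) auto
      also have "\<dots> = 5 * h * (of_int Q)\<^sup>2 * (16 * of_int H + 2 * of_int L) * (1 / j b)"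
        using j0[OF b] by (simp add: field_simps power2_eq_square)
      finally show ?thesis .
    qed
    have "(\<Sum>b\<in>{1..<Q}. (norm (G b * D b))\<^sup>2) \<le>
        (\<Sum>b\<in>{1..<Q}. 5 * h * (of_int Q)\<^sup>2 * (16 * of_int H + 2 * of_int L) * (1 / j b))"
      by (rule sum_mono[OF GD])
    also have "\<dots> = 5 * h * (of_int Q)\<^sup>2 * (16 * of_int H + 2 * of_int L) * (\<Sum>b\<in>{1..<Q}. 1 / j b)"
      by (simp add: sum_distrib_left)
    also have "\<dots> \<le> 5 * h * (of_int Q)\<^sup>2 * (16 * of_int H + 2 * of_int L) * (2 * h)"
      unfolding j_def h_def using sum_inverse_int_dist_mult[OF Q cop] h0[unfolded h_def] H L
      by (intro mult_left_mono) auto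
    also have "\<dots> = (h * of_int Q * sqrt (160 * of_int H + 20 * of_int L))\<^sup>2"
      using H L by (simp add: power_mult_distrib) (simp add: power2_eq_square algebra_simps)
    finally have GD2: "(\<Sum>b\<in>{1..<Q}. (norm (G b * D b))\<^sup>2) \<le> (h * of_int Q * sqrt (160 * of_int H + 20 * of_int L))\<^sup>2" .
    have "(\<Sum>b\<in>{1..<Q}. norm (U b) * norm (G b * D b))\<^sup>2 \<le>
        (\<Sum>b\<in>{1..<Q}. (norm (U b))\<^sup>2) * (\<Sum>b\<in>{1..<Q}. (norm (G b * D b))\<^sup>2)"
      by (rule Cauchy_Schwarz_ineq_sum)
    also have "\<dots> \<le> (of_int Q * B)\<^sup>2 * (h * of_int Q * sqrt (160 * of_int H + 20 * of_int L))\<^sup>2"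
      by (intro mult_mono U2 GD2) (auto intro: sum_nonneg)
    finally show "(\<Sum>b\<in>{1..<Q}. norm (U b) * norm (G b * D b))\<^sup>2 \<le>
        ((of_int Q * B) * (h * of_int Q * sqrt (160 * of_int H + 20 * of_int L)))\<^sup>2"
      by (simp only: power_mult_distrib)
  qed (use Q B0 h0 H L in auto)
  also have "\<dots> / of_int Q = B * (h * of_int Q * sqrt (160 * of_int H + 20 * of_int L))"
    using Q by simp
  finally show ?thesis using Q by (simp add: h_def divide_right_mono)
qed

text \<open>Averaging over the translates by \<open>0, q, \<dots>, (L - 1) q\<close>, under which \<open>u\<close> hardly changes, replaces
  the point masses at the squares by a density that square-root cancellation shows to be
  almost constant.\<close>

lemma square_sum_almost_invariant:
  fixes u :: "int \<Rightarrow> complex" and Q q M H L :: int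
  assumes Q: "Q > 0" and cop: "coprime q Q" and H: "H > 0" "H \<le> Q" and L: "L > 0"
    and per: "\<And>m. u (m mod Q) = u m" and bound: "\<And>m. norm (u m) \<le> B"
    and inv: "\<And>m i. 0 \<le> i \<Longrightarrow> i < L \<Longrightarrow> norm (u (m + i * q) - u m) \<le> \<epsilon>"
  shows "norm ((\<Sum>n\<in>{M..<M+H}. u (n\<^sup>2)) - of_int H / of_int Q * (\<Sum>k\<in>{0..<Q}. u k))
     \<le> of_int H * \<epsilon> + B * (harm (nat Q) * of_int Q * sqrt (160 * of_int H + 20 * of_int L)) / of_int L"
proof -
  define E where "E = B * (harm (nat Q) * of_int Q * sqrt (160 * of_int H + 20 * of_int L))"
  define A where "A = (\<Sum>n\<in>{M..<M+H}. \<Sum>i\<in>{0..<L}. u (n\<^sup>2 + i * q))"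
  define W where "W = (\<Sum>k\<in>{0..<Q}. u k)"
  have 1: "norm (A - of_int (H * L) / of_int Q * W) \<le> E"
    unfolding A_def E_def W_def
    by (rule square_sum_equidistribution[where u = u, OF Q cop H L per bound])
  have "A - of_int L * (\<Sum>n\<in>{M..<M+H}. u (n\<^sup>2)) = (\<Sum>n\<in>{M..<M+H}. \<Sum>i\<in>{0..<L}. u (n\<^sup>2 + i * q) - u (n\<^sup>2))"
    using L by (simp add: A_def sum_subtractf sum_distrib_left)
  then have "norm (A - of_int L * (\<Sum>n\<in>{M..<M+H}. u (n\<^sup>2))) \<le> (\<Sum>n\<in>{M..<M+H}. \<Sum>i\<in>{0..<L}. \<epsilon>)"
    by (simp only:) (intro sum_norm_le order_trans[OF norm_sum] inv sum_mono; simp)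
  also have "\<dots> = of_int H * of_int L * \<epsilon>" using H L by simp
  finally have 2: "norm (A - of_int L * (\<Sum>n\<in>{M..<M+H}. u (n\<^sup>2))) \<le> of_int H * of_int L * \<epsilon>" .
  have "norm (of_int L * ((\<Sum>n\<in>{M..<M+H}. u (n\<^sup>2)) - of_int H / of_int Q * W)) =
     norm ((A - of_int (H * L) / of_int Q * W) - (A - of_int L * (\<Sum>n\<in>{M..<M+H}. u (n\<^sup>2))))"
    by (rule arg_cong[where f = norm]) (simp add: algebra_simps)
  also have "\<dots> \<le> E + of_int H * of_int L * \<epsilon>"
    by (rule order_trans[OF norm_triangle_ineq4]) (use 1 2 in simp)
  finally have "of_int L * norm ((\<Sum>n\<in>{M..<M+H}. u (n\<^sup>2)) - of_int H / of_int Q * W) \<le> E + of_int H * of_int L * \<epsilon>"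
    using L by (simp add: norm_mult)
  then show ?thesis using L unfolding W_def E_def[symmetric] by (simp add: field_simps)
qed

section \<open>Fourier coefficients on the circle\<close>

lemma continuous_on_ee [continuous_intros]:
  "continuous_on A f \<Longrightarrow> continuous_on A (\<lambda>x. ee (f x))"
  unfolding ee_def by (intro continuous_intros)

lemma borel_measurable_ee [measurable]: "ee \<in> borel_measurable borel"
  by (intro borel_measurable_continuous_onI continuous_intros)

text \<open>Finite sums of scaled characters of period \<open>p\<close>. The inductive form reduces
  linear assertions to a single character and one addition step.\<close>

inductive trig_poly :: "real \<Rightarrow> (real \<Rightarrow> complex) \<Rightarrow> bool" for p where
  char: "trig_poly p (\<lambda>x. c * ee (of_int k * x / p))"
| add: "trig_poly p f \<Longrightarrow> trig_poly p g \<Longrightarrow> trig_poly p (\<lambda>x. f x + g x)"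

lemma trig_poly_const: "trig_poly p (\<lambda>x. c)"
  using trig_poly.char[of p c 0] by simp

lemma trig_poly_char_mult: "trig_poly p f \<Longrightarrow> trig_poly p (\<lambda>x. (c * ee (of_int k * x / p)) * f x)"
proof (induction rule: trig_poly.induct)
  case (char d l)
  have "(c * ee (of_int k * x / p)) * (d * ee (of_int l * x / p)) = (c * d) * ee (of_int (k + l) * x / p)" for x
    by (simp add: ee_add add_divide_distrib distrib_right)
  then show ?case by (simp only: trig_poly.char)
next
  case (add f g)
  then show ?case by (simp add: distrib_left trig_poly.add)
qed

lemma trig_poly_mult: "trig_poly p f \<Longrightarrow> trig_poly p g \<Longrightarrow> trig_poly p (\<lambda>x. f x * g x)"
proof (induction rule: trig_poly.induct)
  case (char c k)
  then show ?case by (rule trig_poly_char_mult)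
next
  case (add f f')
  then show ?case by (simp add: distrib_right trig_poly.add)
qed

lemma trig_poly_continuous: "trig_poly p f \<Longrightarrow> continuous_on A f"
  by (induction rule: trig_poly.induct)
     (simp_all only: divide_inverse, (intro continuous_intros | assumption)+)

lemma trig_poly_measurable: "trig_poly p f \<Longrightarrow> f \<in> borel_measurable borel"
  by (intro borel_measurable_continuous_onI trig_poly_continuous)

lemma trig_poly_bounded: "trig_poly p f \<Longrightarrow> \<exists>B. \<forall>x. norm (f x) \<le> B"
proof (induction rule: trig_poly.induct)
  case (char c k)
  then show ?case by (intro exI[of _ "norm c"]) (simp add: norm_mult)
next
  case (add f g)
  then obtain B B' where "\<forall>x. norm (f x) \<le> B" "\<forall>x. norm (g x) \<le> B'" by auto
  then show ?case by (intro exI[of _ "B + B'"]) (auto intro: norm_triangle_le add_mono)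
qed

lemma trig_poly_periodic: "trig_poly p f \<Longrightarrow> p \<noteq> 0 \<Longrightarrow> f (x + p) = f x"
proof (induction rule: trig_poly.induct)
  case (char c k)
  then have "of_int k * (x + p) / p = of_int k * x / p + of_int k" by (simp add: field_simps)
  then show ?case by (simp only: ee_add_of_int)
qed auto

text \<open>On the unit circle conjugation inverts, so the real and imaginary parts are combinations
  of the characters of index 1 and -1. A real-linear functional is determined by its values at 1 and
  at the imaginary unit.\<close>

lemma trig_poly_of_real_polynomial:
  assumes "real_polynomial_function (P :: complex \<Rightarrow> real)"
  shows "trig_poly p (\<lambda>x. of_real (P (ee (x / p))))"
  using assms
proof (induction rule: real_polynomial_function.induct)
  case (linear f)
  have f: "f z = Re z * f 1 + Im z * f \<i>" for z
  proof -
    have "f z = f (Re z *\<^sub>R 1 + Im z *\<^sub>R \<i>)"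
      by (rule arg_cong[where f = f]) (simp add: complex_eq_iff)
    also have "\<dots> = Re z * f 1 + Im z * f \<i>"
      by (simp only: bounded_linear.linear[OF linear] linear_add linear_scale real_scaleR_def)
    finally show ?thesis .
  qed
  have z: "of_real (Re z) = (z + cnj z) / 2" "of_real (Im z) = (z - cnj z) / (2 * \<i>)" for z
    by (simp_all add: complex_eq_iff Re_divide Im_divide power2_eq_square)
  have "(\<lambda>x. complex_of_real (f (ee (x / p)))) =
     (\<lambda>x. (of_real (f 1) / 2 + of_real (f \<i>) / (2 * \<i>)) * ee (of_int 1 * x / p) +
          (of_real (f 1) / 2 - of_real (f \<i>) / (2 * \<i>)) * ee (of_int (- 1) * x / p))"
  proof (rule ext)
    fix x
    have "complex_of_real (f (ee (x / p))) = of_real (Re (ee (x / p))) * of_real (f 1) + of_real (Im (ee (x / p))) * of_real (f \<i>)"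
      by (subst f) simp
    also have "\<dots> = (of_real (f 1) / 2 + of_real (f \<i>) / (2 * \<i>)) * ee (of_int 1 * x / p) +
          (of_real (f 1) / 2 - of_real (f \<i>) / (2 * \<i>)) * ee (of_int (- 1) * x / p)"
      unfolding z cnj_ee by (simp add: field_simps)
    finally show "complex_of_real (f (ee (x / p))) = \<dots>" .
  qed
  then show ?case by (simp only: trig_poly.intros)
next
  case (const c)
  show ?case by (rule trig_poly_const)
next
  case (add f g)
  then show ?case by (simp add: trig_poly.add)
next
  case (mult f g)
  then show ?case by (simp add: trig_poly_mult)
qed

lemma trig_poly_dense:
  fixes w :: "real \<Rightarrow> real"
  assumes p: "p > 0" and w: "continuous_on {0..p} w" "w 0 = w p" and e: "e > 0"
  obtains f where "trig_poly p f" "\<And>x. x \<in> {0..p} \<Longrightarrow> norm (of_real (w x) - f x) < e"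
proof -
  \<comment> \<open>The transport of \<open>w\<close> to the unit circle by choice of a preimage.
    Preimages in [0, p] are ambiguous only for the two end points, where \<open>w\<close> takes the
    same value.\<close>
  define W where "W = (\<lambda>z. w (SOME x. x \<in> {0..p} \<and> ee (x / p) = z))"
  have W: "W (ee (x / p)) = w x" if x: "x \<in> {0..p}" for x
  proof -
    define y where "y = (SOME y. y \<in> {0..p} \<and> ee (y / p) = ee (x / p))"
    have y: "y \<in> {0..p}" "ee (y / p) = ee (x / p)"
      using someI[of "\<lambda>y. y \<in> {0..p} \<and> ee (y / p) = ee (x / p)" x] x by (auto simp: y_def)
    then obtain k where "y / p - x / p = of_int k" by (auto simp: ee_eq_iff elim: Ints_cases)
    then have k: "y - x = of_int k * p" using p by (simp add: field_simps)
    have "\<bar>y - x\<bar> \<le> p" using x y by auto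
    then have "\<bar>of_int k * p\<bar> \<le> 1 * p" using k by simp
    then have "\<bar>real_of_int k\<bar> \<le> 1" using p by (simp add: abs_mult)
    then have "k = 0 \<or> k = 1 \<or> k = -1" by linarith
    then have "y = x \<or> (y = p \<and> x = 0) \<or> (y = 0 \<and> x = p)" using k x y by auto
    then have "w y = w x" using w(2) by auto
    then show ?thesis by (simp add: W_def y_def)
  qed
  have sph: "sphere 0 1 = (\<lambda>x. ee (x / p)) ` {0..p}"
  proof (intro equalityI subsetI)
    fix z :: complex assume "z \<in> sphere 0 1"
    then obtain t where t: "0 \<le> t" "t < 2 * pi" and "z = Complex (cos t) (sin t)"
      using complex_unimodular_polar[of z] by auto
    then have "z = cis t" by (simp add: complex_eq_iff)
    note t = t this
    show "z \<in> (\<lambda>x. ee (x / p)) ` {0..p}"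
      by (rule image_eqI[of _ _ "t * p / (2 * pi)"]) (use t p in \<open>auto simp: ee_def field_simps\<close>)
  qed auto
  have cw: "compact (w ` {0..p})" by (rule compact_continuous_image[OF w(1)]) simp
  \<comment> \<open>The graph of \<open>W\<close> is the continuous image of [0, p], hence compact,
    so the closed graph criterion replaces a continuous choice of argument.\<close>
  have "continuous_on (sphere 0 1) W"
  proof (rule continuous_from_closed_graph[OF cw])
    show "W \<in> sphere 0 1 \<rightarrow> w ` {0..p}" unfolding sph using W by auto
    have "(\<lambda>z. (z, W z)) ` sphere 0 1 = (\<lambda>x. (ee (x / p), w x)) ` {0..p}"
      unfolding sph image_image using W by (intro image_cong) auto
    moreover have "compact ((\<lambda>x. (ee (x / p), w x)) ` {0..p})"
      using p by (intro compact_continuous_image continuous_intros w) auto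
    ultimately show "closed ((\<lambda>z. (z, W z)) ` sphere 0 1)" by (simp add: compact_imp_closed)
  qed
  then obtain P where P: "real_polynomial_function P" "\<And>z. z \<in> sphere 0 1 \<Longrightarrow> \<bar>W z - P z\<bar> < e"
    using Stone_Weierstrass_real_polynomial_function[of "sphere 0 1" W e] e by auto
  show thesis
  proof (rule that)
    show "trig_poly p (\<lambda>x. of_real (P (ee (x / p))))" by (rule trig_poly_of_real_polynomial[OF P(1)])
    show "norm (of_real (w x) - complex_of_real (P (ee (x / p)))) < e" if "x \<in> {0..p}" for x
      using P(2)[of "ee (x / p)"] W[OF that] by (simp flip: of_real_diff)
  qed
qed

section \<open>Uniqueness of Fourier coefficients for bounded measurable functions\<close>

lemma bounded_atLeastLessThan_real: "bounded {a..<b::real}"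
  by (rule bounded_subset[OF bounded_closed_interval[of a b]]) auto

lemma integrable_bounded_interval:
  fixes f :: "real \<Rightarrow> 'a :: {banach, second_countable_topology}"
  assumes "f \<in> borel_measurable borel" "\<And>x. x \<in> {a..<b} \<Longrightarrow> norm (f x) \<le> B"
  shows "set_integrable lborel {a..<b} f"
  unfolding set_integrable_def
  by (rule integrableI_bounded_set[where A = "{a..<b}" and B = B])
     (use assms emeasure_bounded_finite[OF bounded_atLeastLessThan_real[of a b]] in \<open>auto simp: indicator_def split: if_splits\<close>)

lemma norm_set_integral_le:
  fixes f :: "real \<Rightarrow> 'a :: {banach, second_countable_topology}"
  assumes "f \<in> borel_measurable borel" "a \<le> b" "\<And>x. x \<in> {a..<b} \<Longrightarrow> norm (f x) \<le> B"
  shows "norm (LINT x:{a..<b}|lborel. f x) \<le> B * (b - a)"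
proof -
  have "norm (LINT x:{a..<b}|lborel. f x) \<le> (LINT x|lborel. norm (indicator {a..<b} x *\<^sub>R f x))"
    unfolding set_lebesgue_integral_def by (rule integral_norm_bound)
  also have "\<dots> \<le> (LINT x|lborel. B * indicator {a..<b} x)"
  proof (rule integral_mono)
    show "integrable lborel (\<lambda>x. norm (indicator {a..<b} x *\<^sub>R f x))"
      using integrable_bounded_interval[OF assms(1,3)] unfolding set_integrable_def
      by (rule integrable_norm)
    show "integrable lborel (\<lambda>x. B * indicator {a..<b} x)"
      using emeasure_bounded_finite[OF bounded_atLeastLessThan_real[of a b]]
      by (intro integrable_mult_right integrable_real_indicator) auto
  qed (use assms in \<open>auto simp: indicator_def\<close>)
  also have "\<dots> = B * (b - a)" using assms by simp
  finally show ?thesis .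
qed

text \<open>Linearity takes the vanishing from characters to trigonometric polynomials, and uniform
  density takes it to continuous periodic \<open>w\<close>.\<close>

lemma fourier_coefficients_zero_imp_orthogonal:
  fixes h :: "real \<Rightarrow> complex"
  assumes p: "p > 0" and h: "h \<in> borel_measurable borel" and B: "\<And>x. norm (h x) \<le> B"
    and coef: "\<And>k::int. (LINT x:{0..<p}|lborel. ee (of_int k * x / p) * h x) = 0"
    and w: "continuous_on {0..p} w" "w 0 = w p" and wm: "w \<in> borel_measurable borel"
    and wB: "\<And>x. \<bar>w x\<bar> \<le> B'"
  shows "(LINT x:{0..<p}|lborel. of_real (w x) * h x) = 0"
proof -
  have B0: "B \<ge> 0" using B[of 0] norm_ge_zero order_trans by blast
  note [measurable] = h wm
  have tp: "(LINT x:{0..<p}|lborel. f x * h x) = 0" if "trig_poly p f" for f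
    using that
  proof (induction rule: trig_poly.induct)
    case (char c k)
    have "(LINT x:{0..<p}|lborel. c * ee (of_int k * x / p) * h x) = c * (LINT x:{0..<p}|lborel. ee (of_int k * x / p) * h x)"
      by (simp add: mult.assoc)
    then show ?case using coef by simp
  next
    case (add f g)
    note [measurable] = add.hyps[THEN trig_poly_measurable]
    have i: "set_integrable lborel {0..<p} (\<lambda>x. f' x * h x)" if tpf: "trig_poly p f'" for f'
    proof -
      obtain Bf where Bf: "\<forall>x. norm (f' x) \<le> Bf" using trig_poly_bounded[OF tpf] by auto
      then have "Bf \<ge> 0" using norm_ge_zero order_trans by blast
      note [measurable] = trig_poly_measurable[OF tpf]
      show ?thesis
        by (rule integrable_bounded_interval[where B = "Bf * B"])
           (use Bf B \<open>Bf \<ge> 0\<close> in \<open>auto simp: norm_mult intro!: mult_mono\<close>)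
    qed
    show ?case using add i by (simp add: distrib_right set_integral_add)
  qed
  have "norm (LINT x:{0..<p}|lborel. of_real (w x) * h x) \<le> e" if e: "e > 0" for e
  proof -
    \<comment> \<open>Chosen so that the error e' * (B + 1) * p is exactly \<open>e\<close>; the
      summand 1 keeps the denominator positive when \<open>B\<close> is 0.\<close>
    define e' where "e' = e / (p * (B + 1))"
    have e': "e' > 0" using e p B0 by (simp add: e'_def)
    obtain f where f: "trig_poly p f" "\<And>x. x \<in> {0..p} \<Longrightarrow> norm (of_real (w x) - f x) < e'"
      using trig_poly_dense[OF p w e'] by blast
    note [measurable] = trig_poly_measurable[OF f(1)]
    obtain Bf where Bf: "\<forall>x. norm (f x) \<le> Bf" using trig_poly_bounded[OF f(1)] by auto
    then have Bf0: "Bf \<ge> 0" using norm_ge_zero order_trans by blast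
    have B'0: "B' \<ge> 0" using wB[of 0] by simp
    have "(LINT x:{0..<p}|lborel. (of_real (w x) - f x) * h x) =
       (LINT x:{0..<p}|lborel. of_real (w x) * h x) - (LINT x:{0..<p}|lborel. f x * h x)"
      unfolding left_diff_distrib
    proof (rule set_integral_diff)
      show "set_integrable lborel {0..<p} (\<lambda>x. of_real (w x) * h x)"
        by (rule integrable_bounded_interval[where B = "B' * B"])
           (use wB B B'0 in \<open>auto simp: norm_mult intro!: mult_mono\<close>)
      show "set_integrable lborel {0..<p} (\<lambda>x. f x * h x)"
        by (rule integrable_bounded_interval[where B = "Bf * B"])
           (use Bf B Bf0 in \<open>auto simp: norm_mult intro!: mult_mono\<close>)
    qed
    then have "norm (LINT x:{0..<p}|lborel. of_real (w x) * h x) = norm (LINT x:{0..<p}|lborel. (of_real (w x) - f x) * h x)"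
      using tp[OF f(1)] by simp
    also have "\<dots> \<le> (e' * (B + 1)) * (p - 0)"
    proof (rule norm_set_integral_le)
      fix x assume "x \<in> {0..<p}"
      then have "norm (of_real (w x) - f x) \<le> e'" using f(2)[of x] by simp
      then show "norm ((of_real (w x) - f x) * h x) \<le> e' * (B + 1)"
        unfolding norm_mult using B[of x] e' by (intro mult_mono) auto
    qed (use p in auto)
    also have "\<dots> = e" using p B0 by (simp add: e'_def)
    finally show ?thesis .
  qed
  then have "norm (LINT x:{0..<p}|lborel. of_real (w x) * h x) \<le> 0"
    by (rule field_le_epsilon[of _ 0, simplified])
  then show ?thesis by simp
qed

lemma AE_lborel_shift:
  assumes "AE x in lborel. P (x::real)"
  shows "AE x in lborel. P (c + x)"
proof -
  have 1: "AE x in distr lborel borel ((+) c). P x" unfolding lborel_distr_plus by (rule assms)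
  show ?thesis by (rule AE_distrD[OF _ 1]) simp
qed

text \<open>Countably many translates of a null set are null. The open interval suits the cut-off
  test functions, which vanish at the end points of the period.\<close>

lemma AE_periodic:
  fixes p :: real
  assumes p: "p > 0" and ae: "AE x in lborel. x \<in> {0<..<p} \<longrightarrow> P x" and per: "\<And>x. P (x + p) \<longleftrightarrow> P x"
  shows "AE x in lborel. P x"
proof -
  have ae': "AE x in lborel. x \<in> {0..<p} \<longrightarrow> P x"
    using ae AE_lborel_singleton[of 0] by eventually_elim auto
  have pn: "P (x + real n * p) \<longleftrightarrow> P x" for x n
    by (induction n) (use per in \<open>simp_all add: distrib_right add.assoc[symmetric] add.commute[of p]\<close>)
  have pk: "P (x + of_int k * p) \<longleftrightarrow> P x" for x k
  proof (cases "k \<ge> 0")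
    case True
    then show ?thesis using pn[of x "nat k"] by simp
  next
    case False
    then show ?thesis using pn[of "x + of_int k * p" "nat (- k)"] by (simp add: algebra_simps)
  qed
  have "AE x in lborel. \<forall>k::int. (- of_int k * p + x) \<in> {0..<p} \<longrightarrow> P (- of_int k * p + x)"
    unfolding AE_all_countable by (intro allI AE_lborel_shift ae')
  then show ?thesis
  proof eventually_elim
    case (elim x)
    define k where "k = \<lfloor>x / p\<rfloor>"
    have "of_int k \<le> x / p" "x / p < of_int k + 1" unfolding k_def by linarith+
    then have "- of_int k * p + x \<in> {0..<p}" using p by (simp add: field_simps)
    then have "P (- of_int k * p + x)" using elim by blast
    then show ?case using pk[of x "-k"] by (simp add: add.commute)
  qed
qed

text \<open>A bounded measurable function is an almost everywhere limit of continuous ones, and cutting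
  these off near the end points of the period makes them periodic.\<close>

lemma fourier_coefficients_zero_imp_Re_zero:
  fixes h :: "real \<Rightarrow> complex"
  assumes p: "p > 0" and h: "h \<in> borel_measurable borel" and B: "\<And>x. norm (h x) \<le> B"
    and coef: "\<And>k::int. (LINT x:{0..<p}|lborel. ee (of_int k * x / p) * h x) = 0"
  shows "AE x in lborel. x \<in> {0<..<p} \<longrightarrow> Re (h x) = 0"
proof -
  note [measurable] = h
  have "(\<lambda>x. Re (h x)) \<in> borel_measurable (lebesgue_on UNIV)"
    by (intro measurable_restrict_space1 measurable_completion) simp
  then have "(\<lambda>x. Re (h x)) measurable_on UNIV"
    by (subst measurable_on_iff_borel_measurable) auto
  then obtain N g where N: "negligible N" and g: "\<And>n::nat. continuous_on UNIV (g n)"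
    "\<And>x. x \<notin> N \<Longrightarrow> (\<lambda>n. g n x) \<longlonglongrightarrow> Re (h x)"
    by (auto simp: measurable_on_def)
  \<comment> \<open>The first factor is a trapezoid that vanishes at 0 and p and tends to 1 in
    between; the second truncates to the range of \<open>Re h\<close>. Hence \<open>w n\<close>
    tends to \<open>Re h\<close>, and testing \<open>h\<close> against it yields the integral of (Re
    h)^2 in the limit.\<close>
  define w where "w = (\<lambda>n x. min 1 (max 0 (real n * min x (p - x))) * max (-B) (min B (g n x)))"
  have B0: "B \<ge> 0" using B[of 0] norm_ge_zero order_trans by blast
  have wc: "continuous_on A (w n)" for A n
    unfolding w_def by (intro continuous_intros continuous_on_subset[OF g(1)]) auto
  have [measurable]: "w n \<in> borel_measurable borel" for n
    by (intro borel_measurable_continuous_onI wc)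
  have wB: "\<bar>w n x\<bar> \<le> B" for n x
  proof -
    have "\<bar>w n x\<bar> \<le> 1 * B" unfolding w_def abs_mult using B0 by (intro mult_mono) auto
    then show ?thesis by simp
  qed
  have w0: "(LINT x:{0..<p}|lborel. of_real (w n x) * h x) = 0" for n
  proof (rule fourier_coefficients_zero_imp_orthogonal[OF p h B coef wc _ _ wB])
    show "w n 0 = w n p" using p by (auto simp: w_def)
  qed simp
  have w1: "(LINT x|lborel. indicator {0..<p} x * (w n x * Re (h x))) = 0" for n
  proof -
    have "set_integrable lborel {0..<p} (\<lambda>x. of_real (w n x) * h x)"
      by (rule integrable_bounded_interval[where B = "B * B"])
         (use wB B B0 in \<open>auto simp: norm_mult intro!: mult_mono\<close>)
    then have "(LINT x|lborel. Re (indicator {0..<p} x *\<^sub>R (of_real (w n x) * h x))) =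
        Re (LINT x:{0..<p}|lborel. of_real (w n x) * h x)"
      unfolding set_lebesgue_integral_def set_integrable_def by (rule integral_Re)
    then show ?thesis using w0[of n] by simp
  qed
  have aeN: "AE x in lborel. x \<notin> N"
  proof -
    have "AE x in lebesgue. x \<notin> N"
      using N by (intro AE_not_in) (simp add: negligible_iff_null_sets)
    then show ?thesis by (simp add: AE_completion_iff)
  qed
  have lim: "AE x in lborel. (\<lambda>n. indicator {0..<p} x * (w n x * Re (h x))) \<longlonglongrightarrow> indicator {0..<p} x * (Re (h x))\<^sup>2"
    using aeN AE_lborel_singleton[of 0]
  proof eventually_elim
    case (elim x)
    show ?case
    proof (cases "x \<in> {0<..<p}")
      case True
      define m where "m = min x (p - x)"
      have m: "m > 0" using True by (simp add: m_def)
      have 1: "(\<lambda>n. max (-B) (min B (g n x))) \<longlonglongrightarrow> max (-B) (min B (Re (h x)))"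
        using g(2)[of x] elim by (intro tendsto_intros) auto
      have hx: "max (-B) (min B (Re (h x))) = Re (h x)"
        using B[of x] abs_Re_le_cmod[of "h x"] by linarith
      have 2: "(\<lambda>n. min 1 (max 0 (real n * m))) \<longlonglongrightarrow> 1"
      proof (rule tendsto_eventually)
        obtain n0 :: nat where n0: "real n0 * m > 1" using ex_less_of_nat_mult[OF m] by auto
        show "\<forall>\<^sub>F n in sequentially. min 1 (max 0 (real n * m)) = 1"
          using eventually_ge_at_top[of n0]
        proof eventually_elim
          case (elim n)
          then have "real n0 * m \<le> real n * m" using m by (intro mult_right_mono) auto
          then show ?case using n0 by simp
        qed
      qed
      have "(\<lambda>n. indicator {0..<p} x * (w n x * Re (h x))) \<longlonglongrightarrow> indicator {0..<p} x * ((1 * Re (h x)) * Re (h x))"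
        unfolding w_def m_def[symmetric] using 1 2 unfolding hx by (intro tendsto_intros) auto
      then show ?thesis by (simp add: power2_eq_square)
    qed (use elim in \<open>auto simp: indicator_def\<close>)
  qed
  have dom: "AE x in lborel. norm (indicator {0..<p} x * (w n x * Re (h x))) \<le> B * B * indicator {0..<p} x" for n
  proof (rule AE_I2)
    fix x
    have "\<bar>w n x\<bar> * \<bar>Re (h x)\<bar> \<le> B * B"
      using wB[of n x] B[of x] abs_Re_le_cmod[of "h x"] B0 by (intro mult_mono) auto
    then show "norm (indicator {0..<p} x * (w n x * Re (h x))) \<le> B * B * indicator {0..<p} x"
      by (auto simp: indicator_def abs_mult)
  qed
  have dI: "integrable lborel (\<lambda>x. B * B * indicator {0..<p} x :: real)"
    by (intro integrable_mult_right integrable_real_indicator) (use p in auto)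
  have "(\<lambda>n. LINT x|lborel. indicator {0..<p} x * (w n x * Re (h x))) \<longlonglongrightarrow> (LINT x|lborel. indicator {0..<p} x * (Re (h x))\<^sup>2)"
    by (rule integral_dominated_convergence[OF _ _ dI lim dom]) auto
  then have "(LINT x|lborel. indicator {0..<p} x * (Re (h x))\<^sup>2) = 0"
    unfolding w1 by (metis LIMSEQ_const_iff)
  moreover have "integrable lborel (\<lambda>x. indicator {0..<p} x * (Re (h x))\<^sup>2)"
    by (rule integrable_dominated_convergence[OF _ _ dI lim dom]) auto
  ultimately have "AE x in lborel. indicator {0..<p} x * (Re (h x))\<^sup>2 = 0"
    by (subst (asm) integral_nonneg_eq_0_iff_AE) auto
  then show ?thesis by eventually_elim (auto simp: indicator_def)
qed

text \<open>The imaginary part of \<open>h\<close> is the real part of -i h, whose coefficients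
  vanish too.\<close>

lemma fourier_coefficients_zero_imp_zero:
  fixes h :: "real \<Rightarrow> complex"
  assumes p: "p > 0" and h: "h \<in> borel_measurable borel" and B: "\<And>x. norm (h x) \<le> B"
    and per: "\<And>x. h (x + p) = h x"
    and coef: "\<And>k::int. (LINT x:{0..<p}|lborel. ee (of_int k * x / p) * h x) = 0"
  shows "AE x in lborel. h x = 0"
proof (rule AE_periodic[OF p])
  note [measurable] = h
  have "AE x in lborel. x \<in> {0<..<p} \<longrightarrow> Re (- \<i> * h x) = 0"
  proof (rule fourier_coefficients_zero_imp_Re_zero[OF p])
    show "norm (- \<i> * h x) \<le> B" for x using B by (simp add: norm_mult)
    fix k :: int
    have "(LINT x:{0..<p}|lborel. ee (of_int k * x / p) * (- \<i> * h x)) =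
          - \<i> * (LINT x:{0..<p}|lborel. ee (of_int k * x / p) * h x)"
      by (subst set_integral_mult_right[symmetric]) (simp add: mult_ac)
    then show "(LINT x:{0..<p}|lborel. ee (of_int k * x / p) * (- \<i> * h x)) = 0" using coef by simp
  qed simp
  then show "AE x in lborel. x \<in> {0<..<p} \<longrightarrow> h x = 0"
    using fourier_coefficients_zero_imp_Re_zero[OF p h B coef]
    by eventually_elim (auto simp: complex_eq_iff)
qed (use per in auto)

section \<open>Periodic functions and Lebesgue measure on the circle\<close>

lemma one_periodic_add_of_int:
  assumes "one_periodic f"
  shows "f (x + of_int k) = f x"
proof -
  have pn: "f (x + real n) = f x" for x n
    by (induction n) (use assms in \<open>simp_all add: one_periodic_def add.assoc[symmetric] add.commute[of 1]\<close>)
  show ?thesis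
  proof (cases "k \<ge> 0")
    case True
    then show ?thesis using pn[of x "nat k"] by simp
  next
    case False
    then show ?thesis using pn[of "x + of_int k" "nat (- k)"] by simp
  qed
qed

lemma one_periodic_frac: "one_periodic f \<Longrightarrow> f (frac x) = f x"
  using one_periodic_add_of_int[of f x "- \<lfloor>x\<rfloor>"] by (simp add: frac_def)

lemma one_periodic_frac_add: "one_periodic f \<Longrightarrow> f (x + frac a) = f (x + a)"
  using one_periodic_add_of_int[of f "x + a" "- \<lfloor>a\<rfloor>"] by (simp add: frac_def algebra_simps)

text \<open>Lebesgue measure of the circle as a measure on the whole line carried by [0, 1), so that
  periodic functions on the reals are integrated as they are.\<close>

definition circle_measure :: "real measure" where
  "circle_measure = density lborel (indicator {0..<1})"

lemma sets_circle_measure [measurable_cong, simp]: "sets circle_measure = sets borel"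
  by (simp add: circle_measure_def)

lemma space_circle_measure [simp]: "space circle_measure = UNIV"
  by (simp add: circle_measure_def)

text \<open>With b the fractional part of \<open>a\<close>, cut [0, 1) at 1 - b; the shift moves the
  two pieces onto [b, 1) and, after removing one period, onto [0, b).\<close>

lemma nn_integral_circle_shift:
  fixes f :: "real \<Rightarrow> ennreal"
  assumes per: "one_periodic f" and [measurable]: "f \<in> borel_measurable borel"
  shows "(\<integral>\<^sup>+x. f (x + a) \<partial>circle_measure) = (\<integral>\<^sup>+x. f x \<partial>circle_measure)"
proof -
  define b where "b = frac a"
  have b: "0 \<le> b" "b < 1" by (auto simp: b_def frac_lt_1)
  have "(\<integral>\<^sup>+x. f (x + a) \<partial>circle_measure) = (\<integral>\<^sup>+x. indicator {0..<1} x * f (x + a) \<partial>lborel)"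
    unfolding circle_measure_def by (subst nn_integral_density) auto
  also have "\<dots> = (\<integral>\<^sup>+x. indicator {0..<1} x * f (x + b) \<partial>lborel)"
    unfolding b_def one_periodic_frac_add[OF per] ..
  also have "\<dots> = (\<integral>\<^sup>+x. indicator {0..<1-b} x * f (x + b) + indicator {1-b..<1} x * f (x + b) \<partial>lborel)"
    using b by (intro nn_integral_cong) (auto simp: indicator_def)
  also have "\<dots> = (\<integral>\<^sup>+x. indicator {0..<1-b} x * f (x + b) \<partial>lborel) + (\<integral>\<^sup>+x. indicator {1-b..<1} x * f (x + b) \<partial>lborel)"
    by (rule nn_integral_add) auto
  also have "(\<integral>\<^sup>+x. indicator {0..<1-b} x * f (x + b) \<partial>lborel) = (\<integral>\<^sup>+x. indicator {b..<1} x * f x \<partial>lborel)"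
    by (subst nn_integral_real_affine[where c = 1 and t = "-b"])
       (auto intro!: nn_integral_cong simp: indicator_def)
  also have "(\<integral>\<^sup>+x. indicator {1-b..<1} x * f (x + b) \<partial>lborel) = (\<integral>\<^sup>+x. indicator {0..<b} x * f (x + 1) \<partial>lborel)"
    by (subst nn_integral_real_affine[where c = 1 and t = "1-b"])
       (auto intro!: nn_integral_cong simp: indicator_def algebra_simps)
  also have "\<dots> = (\<integral>\<^sup>+x. indicator {0..<b} x * f x \<partial>lborel)"
    using per by (simp add: one_periodic_def)
  also have "(\<integral>\<^sup>+x. indicator {b..<1} x * f x \<partial>lborel) + (\<integral>\<^sup>+x. indicator {0..<b} x * f x \<partial>lborel) =
     (\<integral>\<^sup>+x. indicator {b..<1} x * f x + indicator {0..<b} x * f x \<partial>lborel)"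
    by (rule nn_integral_add[symmetric]) auto
  also have "\<dots> = (\<integral>\<^sup>+x. indicator {0..<1} x * f x \<partial>lborel)"
    using b by (intro nn_integral_cong) (auto simp: indicator_def)
  also have "\<dots> = (\<integral>\<^sup>+x. f x \<partial>circle_measure)"
    unfolding circle_measure_def by (subst nn_integral_density) auto
  finally show ?thesis .
qed

text \<open>Invariance as an equality of image measures, a form that transfers from nonnegative to
  vector-valued integrands.\<close>

lemma distr_circle_shift: "distr circle_measure borel (\<lambda>x. frac (x + a)) = distr circle_measure borel frac"
proof (rule measure_eqI)
  fix A :: "real set" assume "A \<in> sets (distr circle_measure borel (\<lambda>x. frac (x + a)))"
  then have [measurable]: "A \<in> sets borel" by simp
  have [measurable]: "frac \<in> borel_measurable (borel :: real measure)"
    unfolding frac_def[abs_def] by measurable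
  have em: "emeasure (distr circle_measure borel g) A = (\<integral>\<^sup>+x. indicator A (g x) \<partial>circle_measure)"
    if [measurable]: "g \<in> borel_measurable borel" for g
  proof -
    have "emeasure (distr circle_measure borel g) A = (\<integral>\<^sup>+x. indicator A x \<partial>distr circle_measure borel g)"
      by simp
    also have "\<dots> = (\<integral>\<^sup>+x. indicator A (g x) \<partial>circle_measure)"
      by (rule nn_integral_distr) auto
    finally show ?thesis .
  qed
  have "emeasure (distr circle_measure borel (\<lambda>x. frac (x + a))) A = (\<integral>\<^sup>+x. indicator A (frac (x + a)) \<partial>circle_measure)"
    by (rule em) simp
  also have "\<dots> = (\<integral>\<^sup>+x. indicator A (frac x) \<partial>circle_measure)"
    by (rule nn_integral_circle_shift[where f = "\<lambda>x. indicator A (frac x)"])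
       (auto simp: one_periodic_def frac_def)
  also have "\<dots> = emeasure (distr circle_measure borel frac) A"
    by (rule em[symmetric]) simp
  finally show "emeasure (distr circle_measure borel (\<lambda>x. frac (x + a))) A = emeasure (distr circle_measure borel frac) A" .
qed simp

lemma integral_circle_shift:
  fixes f :: "real \<Rightarrow> 'a :: {banach, second_countable_topology}"
  assumes per: "one_periodic f" and f [measurable]: "f \<in> borel_measurable borel"
  shows "(LINT x|circle_measure. f (x + a)) = (LINT x|circle_measure. f x)"
proof -
  have [measurable]: "frac \<in> borel_measurable (borel :: real measure)"
    unfolding frac_def[abs_def] by measurable
  have "(LINT x|circle_measure. f (x + a)) = (LINT x|distr circle_measure borel (\<lambda>x. frac (x + a)). f x)"
    by (subst integral_distr) (simp_all add: one_periodic_frac[OF per])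
  also have "\<dots> = (LINT x|circle_measure. f x)"
    unfolding distr_circle_shift by (subst integral_distr) (simp_all add: one_periodic_frac[OF per])
  finally show ?thesis .
qed

lemma integral_circle_measure:
  fixes f :: "real \<Rightarrow> 'a :: {banach, second_countable_topology}"
  assumes [measurable]: "f \<in> borel_measurable borel"
  shows "(LINT x|circle_measure. f x) = (LINT x:{0..<1}|lborel. f x)"
proof -
  have *: "circle_measure = density lborel (\<lambda>x. ennreal (indicator {0..<1} x))"
    by (simp add: circle_measure_def ennreal_indicator)
  show ?thesis
    unfolding * by (subst integral_density) (auto simp: set_lebesgue_integral_def)
qed

lemma emeasure_circle_measure: "emeasure circle_measure UNIV = 1"
  by (simp add: circle_measure_def emeasure_density)

lemma finite_measure_circle_measure: "finite_measure circle_measure"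
  by (rule finite_measureI) (simp add: emeasure_circle_measure)

section \<open>Irrational rotations\<close>

lemma ee_irrational_ne_1:
  assumes "\<alpha> \<notin> \<rat>" "k \<noteq> 0"
  shows "ee (of_int k * \<alpha>) \<noteq> 1"
proof
  assume "ee (of_int k * \<alpha>) = 1"
  then obtain m where "of_int k * \<alpha> = of_int m" by (auto simp: ee_eq_1_iff elim: Ints_cases)
  then have "\<alpha> = of_int m / of_int k" using assms(2) by (simp add: field_simps)
  then show False using assms(1) by (simp add: Rats_divide)
qed

lemma exists_irrational: "\<exists>\<alpha>::real. \<alpha> \<notin> \<rat>"
proof -
  have "countable (\<rat> :: real set)" by (rule countable_rat)
  then have "(UNIV :: real set) \<noteq> \<rat>" using uncountable_UNIV_real by auto
  then show ?thesis by blast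
qed

text \<open>An irrational rotation preserves the integral but multiplies it by a number different
  from 1.\<close>

lemma integral_circle_ee:
  assumes "k \<noteq> 0"
  shows "(LINT x|circle_measure. ee (of_int k * x)) = 0"
proof -
  obtain \<alpha> :: real where \<alpha>: "\<alpha> \<notin> \<rat>" using exists_irrational by auto
  define J where "J = (LINT x|circle_measure. ee (of_int k * x))"
  have "J = (LINT x|circle_measure. ee (of_int k * (x + \<alpha>)))"
    unfolding J_def
  proof (rule integral_circle_shift[symmetric])
    show "one_periodic (\<lambda>x. ee (of_int k * x))"
      by (simp add: one_periodic_def distrib_left ee_add)
  qed measurable
  also have "\<dots> = ee (of_int k * \<alpha>) * J"
    by (simp add: J_def distrib_left ee_add mult.commute)
  finally show ?thesis using ee_irrational_ne_1[OF \<alpha> assms] by (simp add: J_def)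
qed

interpretation circle: finite_measure circle_measure
  by (rule finite_measure_circle_measure)

lemma measure_circle_UNIV [simp]: "measure circle_measure UNIV = 1"
  by (simp add: measure_def emeasure_circle_measure)

lemma integrable_circle_bounded:
  fixes f :: "real \<Rightarrow> 'b::{banach, second_countable_topology}"
  assumes "f \<in> borel_measurable borel" "\<And>x. norm (f x) \<le> B"
  shows "integrable circle_measure f"
  by (rule circle.integrable_const_bound[where B = B]) (use assms in auto)

text \<open>Ergodicity of the irrational rotation: rotating multiplies the Fourier coefficient of
  index k by ee (k \<alpha>), up to inversion, so invariance leaves only the coefficient of index
  0.\<close>

lemma rotation_invariant_imp_const:
  fixes \<psi> :: "real \<Rightarrow> complex"
  assumes irr: "\<alpha> \<notin> \<rat>" and [measurable]: "\<psi> \<in> borel_measurable borel" and B: "\<And>x. norm (\<psi> x) \<le> B"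
    and per: "one_periodic \<psi>" and inv: "\<And>x. \<psi> (x + \<alpha>) = \<psi> x"
  shows "AE x in lborel. \<psi> x = (LINT x|circle_measure. \<psi> x)"
proof -
  define c where "c = (LINT x|circle_measure. \<psi> x)"
  define h where "h = (\<lambda>x. \<psi> x - c)"
  have [measurable]: "h \<in> borel_measurable borel" unfolding h_def by measurable
  have hB: "norm (h x) \<le> B + norm c" for x
    unfolding h_def using B[of x] norm_triangle_ineq4[of "\<psi> x" c] by linarith
  have "AE x in lborel. h x = 0"
  proof (rule fourier_coefficients_zero_imp_zero[of 1])
    show "h (x + 1) = h x" for x using per by (simp add: h_def one_periodic_def)
    fix k :: int
    define J where "J = (LINT x|circle_measure. ee (of_int k * x) * h x)"
    have J: "(LINT x:{0..<1}|lborel. ee (of_int k * x / 1) * h x) = J"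
      unfolding J_def by (subst integral_circle_measure) simp_all
    show "(LINT x:{0..<1}|lborel. ee (of_int k * x / 1) * h x) = 0"
    proof (cases "k = 0")
      case True
      have "integrable circle_measure \<psi>" by (rule integrable_circle_bounded[OF _ B]) simp
      then have "J = 0" unfolding J_def True h_def by (simp add: c_def)
      then show ?thesis using J by simp
    next
      case False
      have "J = (LINT x|circle_measure. ee (of_int k * (x + \<alpha>)) * h (x + \<alpha>))"
        unfolding J_def
      proof (rule integral_circle_shift[symmetric])
        show "one_periodic (\<lambda>x. ee (of_int k * x) * h x)"
          using per by (simp add: one_periodic_def distrib_left ee_add h_def)
      qed measurable
      also have "\<dots> = (LINT x|circle_measure. ee (of_int k * \<alpha>) * (ee (of_int k * x) * h x))"
        by (simp add: distrib_left ee_add h_def inv mult_ac)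
      also have "\<dots> = ee (of_int k * \<alpha>) * J" by (simp add: J_def)
      finally show ?thesis using ee_irrational_ne_1[OF irr False] J by simp
    qed
  qed (use hB in auto)
  then show ?thesis by (simp add: h_def c_def)
qed

text \<open>For a character the sum is geometric, and the starting point contributes only a
  unimodular factor. This is why the threshold does not depend on \<open>x\<close>.\<close>

lemma weyl_trig_poly:
  assumes irr: "\<alpha> \<notin> \<rat>" and f: "trig_poly 1 f" and e: "e > 0"
  shows "\<exists>n0. \<forall>n\<ge>n0. \<forall>x. norm ((\<Sum>i<n. f (x + real i * \<alpha>)) - of_nat n * (LINT x|circle_measure. f x)) \<le> e * real n"
  using f e
proof (induction arbitrary: e rule: trig_poly.induct)
  case (char c k)
  show ?case
  proof (cases "k = 0")
    case True
    then show ?thesis using char by simp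
  next
    case False
    define z where "z = ee (of_int k * \<alpha>)"
    have z: "z \<noteq> 1" unfolding z_def by (rule ee_irrational_ne_1[OF irr False])
    define K where "K = norm c * (2 / norm (1 - z))"
    obtain n0 :: nat where n0: "real n0 > K / e" using reals_Archimedean2 by blast
    show ?thesis
    proof (intro exI allI impI)
      fix n x assume n: "n \<ge> n0"
      have "(\<Sum>i<n. c * ee (of_int k * (x + real i * \<alpha>) / 1)) = c * ee (of_int k * x) * (\<Sum>i<n. z ^ i)"
        unfolding sum_distrib_left
      proof (rule sum.cong[OF refl])
        fix i
        have "z ^ i = ee (real i * (of_int k * \<alpha>))" unfolding z_def ee_mult_nat ..
        then show "c * ee (of_int k * (x + real i * \<alpha>) / 1) = c * ee (of_int k * x) * z ^ i"
          by (simp add: ee_add[symmetric] algebra_simps)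
      qed
      also have "(\<Sum>i<n. z ^ i) = (1 - z ^ n) / (1 - z)"
        using z one_diff_power_eq[of z n] by (simp add: field_simps)
      finally have "norm (\<Sum>i<n. c * ee (of_int k * (x + real i * \<alpha>) / 1)) = norm c * (norm (1 - z ^ n) / norm (1 - z))"
        by (simp add: norm_mult norm_divide)
      also have "norm (1 - z ^ n) \<le> 2"
        using norm_triangle_ineq4[of 1 "z ^ n"] by (simp add: norm_power z_def)
      then have "norm c * (norm (1 - z ^ n) / norm (1 - z)) \<le> K"
        unfolding K_def using z by (intro mult_left_mono divide_right_mono) auto
      also have "K \<le> e * real n"
      proof -
        have "K < e * real n0" using n0 char by (simp add: field_simps)
        also have "\<dots> \<le> e * real n" using n char by (intro mult_left_mono) auto
        finally show ?thesis by simp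
      qed
      finally show "norm ((\<Sum>i<n. c * ee (of_int k * (x + real i * \<alpha>) / 1)) - of_nat n * (LINT x|circle_measure. c * ee (of_int k * x / 1))) \<le> e * real n"
        using integral_circle_ee[OF False] by simp
    qed
  qed
next
  case (add f g)
  obtain n1 where n1: "\<And>n x. n \<ge> n1 \<Longrightarrow> norm ((\<Sum>i<n. f (x + real i * \<alpha>)) - of_nat n * (LINT x|circle_measure. f x)) \<le> e / 2 * real n"
    using add.IH(1)[of "e / 2"] add.prems by auto
  obtain n2 where n2: "\<And>n x. n \<ge> n2 \<Longrightarrow> norm ((\<Sum>i<n. g (x + real i * \<alpha>)) - of_nat n * (LINT x|circle_measure. g x)) \<le> e / 2 * real n"
    using add.IH(2)[of "e / 2"] add.prems by auto
  have i: "integrable circle_measure f'" if tp: "trig_poly 1 f'" for f'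
  proof -
    obtain B where "\<forall>x. norm (f' x) \<le> B" using trig_poly_bounded[OF tp] by auto
    then show ?thesis by (intro integrable_circle_bounded trig_poly_measurable[OF tp]) auto
  qed
  show ?case
  proof (intro exI allI impI)
    fix n x assume n: "n \<ge> max n1 n2"
    have "(\<Sum>i<n. f (x + real i * \<alpha>) + g (x + real i * \<alpha>)) - of_nat n * (LINT x|circle_measure. f x + g x) =
      ((\<Sum>i<n. f (x + real i * \<alpha>)) - of_nat n * (LINT x|circle_measure. f x)) +
      ((\<Sum>i<n. g (x + real i * \<alpha>)) - of_nat n * (LINT x|circle_measure. g x))"
      using i[OF add.hyps(1)] i[OF add.hyps(2)] by (simp add: sum.distrib algebra_simps)
    also have "norm \<dots> \<le> e / 2 * real n + e / 2 * real n"
      by (intro norm_triangle_le add_mono n1 n2) (use n in auto)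
    finally show "norm ((\<Sum>i<n. f (x + real i * \<alpha>) + g (x + real i * \<alpha>)) - of_nat n * (LINT x|circle_measure. f x + g x)) \<le> e * real n"
      by (simp add: field_simps)
  qed
qed

lemma one_periodic_bounded:
  fixes G :: "real \<Rightarrow> real"
  assumes "one_periodic G" "continuous_on UNIV G"
  obtains B where "\<And>x. \<bar>G x\<bar> \<le> B"
proof -
  have "compact (G ` {0..1})"
    by (intro compact_continuous_image continuous_on_subset[OF assms(2)]) auto
  then obtain B where B: "\<And>x. x \<in> {0..1} \<Longrightarrow> \<bar>G x\<bar> \<le> B"
    using compact_imp_bounded by (fastforce simp: bounded_iff)
  show thesis
  proof (rule that)
    fix x
    have "\<bar>G (frac x)\<bar> \<le> B" by (rule B) (simp add: frac_lt_1 less_imp_le)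
    then show "\<bar>G x\<bar> \<le> B" by (simp add: one_periodic_frac[OF assms(1)])
  qed
qed

lemma weyl_uniform:
  assumes irr: "\<alpha> \<notin> \<rat>" and per: "one_periodic G" and cont: "continuous_on UNIV G" and e: "e > 0"
  shows "\<exists>n0. \<forall>n\<ge>n0. \<forall>x. \<bar>birkhoff_sum \<alpha> G n x - real n * (LINT x|circle_measure. G x)\<bar> \<le> e * real n"
proof -
  obtain f where f: "trig_poly 1 f" and fG: "\<And>x. x \<in> {0..1} \<Longrightarrow> norm (of_real (G x) - f x) < e / 3"
  proof (rule trig_poly_dense[of 1 G "e / 3"])
    show "continuous_on {0..1} G" by (rule continuous_on_subset[OF cont]) simp
    show "G 0 = G 1" using per[unfolded one_periodic_def, rule_format, of 0] by simp
  qed (use e in auto)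
  have fper: "one_periodic f" using trig_poly_periodic[OF f] by (simp add: one_periodic_def)
  have fG': "norm (of_real (G x) - f x) \<le> e / 3" for x
  proof -
    have "norm (of_real (G (frac x)) - f (frac x)) < e / 3" by (rule fG) (simp add: frac_lt_1 less_imp_le)
    then show ?thesis by (simp add: one_periodic_frac[OF per] one_periodic_frac[OF fper])
  qed
  obtain B where B: "\<And>x. \<bar>G x\<bar> \<le> B" using one_periodic_bounded[OF per cont] by blast
  obtain Bf where Bf: "\<forall>x. norm (f x) \<le> Bf" using trig_poly_bounded[OF f] by auto
  note [measurable] = trig_poly_measurable[OF f] borel_measurable_continuous_onI[OF cont]
  have iG: "integrable circle_measure (\<lambda>x. complex_of_real (G x))"
    by (rule integrable_circle_bounded[where B = B]) (use B in auto)
  have iF: "integrable circle_measure f"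
    by (rule integrable_circle_bounded[where B = Bf]) (use Bf in auto)
  have int: "norm (complex_of_real (LINT x|circle_measure. G x) - (LINT x|circle_measure. f x)) \<le> e / 3"
  proof -
    have "complex_of_real (LINT x|circle_measure. G x) - (LINT x|circle_measure. f x) = (LINT x|circle_measure. of_real (G x) - f x)"
      using iG iF by (simp flip: integral_complex_of_real)
    also have "norm \<dots> \<le> (LINT x|circle_measure. norm (of_real (G x) - f x))" by (rule integral_norm_bound)
    also have "\<dots> \<le> (LINT x|circle_measure. e / 3)"
      by (rule integral_mono) (use iG iF fG' in auto)
    finally show ?thesis by simp
  qed
  obtain n0 where n0: "\<And>n x. n \<ge> n0 \<Longrightarrow> norm ((\<Sum>i<n. f (x + real i * \<alpha>)) - of_nat n * (LINT x|circle_measure. f x)) \<le> e / 3 * real n"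
    using weyl_trig_poly[OF irr f, of "e / 3"] e by auto
  show ?thesis
  proof (intro exI allI impI)
    fix n x assume n: "n \<ge> n0"
    have 1: "norm (\<Sum>i<n. of_real (G (x + real i * \<alpha>)) - f (x + real i * \<alpha>)) \<le> e / 3 * real n"
    proof -
      have "norm (\<Sum>i<n. of_real (G (x + real i * \<alpha>)) - f (x + real i * \<alpha>)) \<le> (\<Sum>i<n. e / 3)"
        by (rule sum_norm_le) (rule fG')
      then show ?thesis by (simp add: mult.commute)
    qed
    have 3: "norm (of_nat n * ((LINT x|circle_measure. f x) - complex_of_real (LINT x|circle_measure. G x))) \<le> e / 3 * real n"
    proof -
      have "norm (of_nat n * ((LINT x|circle_measure. f x) - complex_of_real (LINT x|circle_measure. G x))) \<le> real n * (e / 3)"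
        unfolding norm_mult norm_of_nat using int by (intro mult_left_mono) (simp_all add: norm_minus_commute)
      then show ?thesis by (simp only: mult.commute)
    qed
    have "complex_of_real (birkhoff_sum \<alpha> G n x - real n * (LINT x|circle_measure. G x)) =
      (\<Sum>i<n. of_real (G (x + real i * \<alpha>)) - f (x + real i * \<alpha>)) +
      (((\<Sum>i<n. f (x + real i * \<alpha>)) - of_nat n * (LINT x|circle_measure. f x)) +
      of_nat n * ((LINT x|circle_measure. f x) - complex_of_real (LINT x|circle_measure. G x)))"
      by (simp add: birkhoff_sum_def sum_subtractf algebra_simps)
    also have "norm \<dots> \<le> e / 3 * real n + (e / 3 * real n + e / 3 * real n)"
      by (intro norm_triangle_le add_mono 1 3 n0[OF n])
    finally show "\<bar>birkhoff_sum \<alpha> G n x - real n * (LINT x|circle_measure. G x)\<bar> \<le> e * real n"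
      unfolding norm_of_real by (simp add: algebra_simps)
  qed
qed

text \<open>A Borel branch of the argument divided by 2 pi. It turns a unimodular solution of a
  multiplicative cohomological equation into a real solution modulo 1.\<close>

lemma measurable_unit_argument:
  obtains a :: "complex \<Rightarrow> real" where "a \<in> borel_measurable borel" "\<And>z. norm z = 1 \<Longrightarrow> ee (a z) = z"
proof -
  \<comment> \<open>Clamping to [-1, 1] makes \<open>arccos\<close> continuous on the whole line,
    hence Borel.\<close>
  define b where "b = (\<lambda>t::real. arccos (max (-1) (min 1 t)))"
  have "continuous_on UNIV b"
    unfolding b_def by (intro continuous_on_arccos continuous_intros) auto
  then have [measurable]: "b \<in> borel_measurable borel" by (rule borel_measurable_continuous_onI)
  define a where "a = (\<lambda>z. (if Im z \<ge> 0 then b (Re z) else - b (Re z)) / (2 * pi))"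
  show thesis
  proof (rule that)
    show "a \<in> borel_measurable borel" unfolding a_def by measurable
    fix z :: complex assume z: "norm z = 1"
    have r: "-1 \<le> Re z" "Re z \<le> 1" using abs_Re_le_cmod[of z] z by auto
    then have b: "b (Re z) = arccos (Re z)" by (simp add: b_def)
    have s: "(Re z)\<^sup>2 + (Im z)\<^sup>2 = 1" using z by (simp add: cmod_def)
    have "sqrt (1 - (Re z)\<^sup>2) = \<bar>Im z\<bar>"
    proof -
      have "1 - (Re z)\<^sup>2 = (Im z)\<^sup>2" using s by simp
      then show ?thesis by simp
    qed
    then show "ee (a z) = z"
      using r by (auto simp: ee_def a_def b complex_eq_iff sin_arccos)
  qed
qed

lemma AE_lborel_scale:
  assumes c: "c \<noteq> (0::real)" and ae: "AE x in lborel. P x"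
  shows "AE x in lborel. P (c * x)"
proof -
  have "AE x in density (distr lborel borel ((*) c)) (\<lambda>_. ennreal \<bar>c\<bar>). P x"
    using ae by (simp only: lborel_distr_mult'[OF c, symmetric])
  then have 1: "AE x in distr lborel borel ((*) c). P x"
    using c by (subst (asm) AE_density) auto
  show ?thesis by (rule AE_distrD[OF _ 1]) simp
qed

section \<open>Weak mixing from the absence of eigenfunctions\<close>

lemma norm_sum_power2_le:
  fixes z :: "nat \<Rightarrow> 'a::real_normed_vector"
  shows "(norm (\<Sum>j<k. z j))\<^sup>2 \<le> real k * (\<Sum>j<k. (norm (z j))\<^sup>2)"
proof -
  have "(norm (\<Sum>j<k. z j))\<^sup>2 \<le> (\<Sum>j<k. 1 * norm (z j))\<^sup>2"
    by (intro power_mono) (simp_all add: norm_sum)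
  also have "\<dots> \<le> (\<Sum>j<k. 1\<^sup>2) * (\<Sum>j<k. (norm (z j))\<^sup>2)"
    by (rule Cauchy_Schwarz_ineq_sum)
  finally show ?thesis by simp
qed

lemma power2_norm_le_add:
  fixes u v :: "'a::real_normed_vector"
  assumes "norm (u - v) \<le> d" "norm u \<le> B" "norm v \<le> B"
  shows "(norm u)\<^sup>2 \<le> (norm v)\<^sup>2 + 2 * B * d"
proof -
  have "(norm u)\<^sup>2 - (norm v)\<^sup>2 = (norm u - norm v) * (norm u + norm v)"
    by (simp add: power2_eq_square algebra_simps)
  also have "\<dots> \<le> d * (B + B)"
  proof (rule mult_mono)
    show "norm u - norm v \<le> d" using norm_triangle_ineq2[of u v] assms(1) by linarith
    show "0 \<le> d" using assms(1) norm_ge_zero[of "u - v"] by linarith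
  qed (use assms in auto)
  finally show ?thesis by (simp add: mult_ac)
qed

lemma borel_measurable_cnj [measurable]: "cnj \<in> borel_measurable borel"
  by (intro borel_measurable_continuous_onI continuous_intros)

locale probability_preserving =
  fixes M :: "'a measure" and T :: "'a \<Rightarrow> 'a"
  assumes emeasure_space_1: "emeasure M (space M) = 1"
    and preserving: "measure_preserving_map M T"
begin

sublocale finite_measure M
  by (rule finite_measureI) (simp add: emeasure_space_1)

lemma measure_space_1 [simp]: "measure M (space M) = 1"
  by (simp add: measure_def emeasure_space_1)

lemma T_measurable [measurable]: "T \<in> measurable M M"
  using preserving by (simp add: measure_preserving_map_def)

lemma Tn_measurable [measurable]: "(T ^^ n) \<in> measurable M M"
  by (rule measurable_compose_n) simp

lemma Tn_space: "x \<in> space M \<Longrightarrow> (T ^^ n) x \<in> space M"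
  using measurable_space[OF Tn_measurable] .

lemma distr_T: "distr M M T = M"
proof (rule measure_eqI)
  fix A assume "A \<in> sets (distr M M T)"
  then have "A \<in> sets M" by simp
  then show "emeasure (distr M M T) A = emeasure M A"
    using preserving by (simp add: emeasure_distr measure_preserving_map_def)
qed simp

lemma distr_Tn: "distr M M (T ^^ n) = M"
proof (induction n)
  case 0
  have "distr M M (T ^^ 0) = distr M M (\<lambda>x. x)" by (simp add: id_def)
  then show ?case by (simp add: distr_id)
next
  case (Suc n)
  have "distr M M (T ^^ Suc n) = distr (distr M M (T ^^ n)) M T"
    by (subst distr_distr) simp_all
  then show ?case by (simp only: Suc distr_T)
qed

lemma integral_Tn:
  fixes f :: "'a \<Rightarrow> 'b::{banach, second_countable_topology}"
  assumes [measurable]: "f \<in> borel_measurable M"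
  shows "(LINT x|M. f ((T ^^ n) x)) = (LINT x|M. f x)"
  using integral_distr[of "T ^^ n" M M f] by (simp add: distr_Tn)

lemma integrable_bounded:
  fixes f :: "'a \<Rightarrow> 'b::{banach, second_countable_topology}"
  assumes "f \<in> borel_measurable M" "\<And>x. x \<in> space M \<Longrightarrow> norm (f x) \<le> B"
  shows "integrable M f"
  by (rule integrable_const_bound[where B = B]) (use assms in auto)

lemma integral_le_bound:
  fixes f :: "'a \<Rightarrow> real"
  assumes "integrable M f" "\<And>x. x \<in> space M \<Longrightarrow> f x \<le> B"
  shows "(LINT x|M. f x) \<le> B"
proof -
  have "(LINT x|M. f x) \<le> (LINT x|M. B)"
    by (rule integral_mono) (use assms in auto)
  then show ?thesis by simp
qed

text \<open>Divided by \<open>n\<close>, these sums converge in mean to the projection of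
  \<open>f\<close> onto the eigenspace of the eigenvalue \<open>ee \<theta>\<close>.\<close>

definition twisted_sum :: "real \<Rightarrow> nat \<Rightarrow> ('a \<Rightarrow> complex) \<Rightarrow> 'a \<Rightarrow> complex" where
  "twisted_sum \<theta> n f x = (\<Sum>k<n. ee (- (real k * \<theta>)) * f ((T ^^ k) x))"

lemma twisted_sum_measurable [measurable (raw)]:
  assumes [measurable]: "f \<in> borel_measurable M"
  shows "twisted_sum \<theta> n f \<in> borel_measurable M"
  unfolding twisted_sum_def[abs_def] by measurable

lemma norm_twisted_sum_le:
  assumes "\<And>x. x \<in> space M \<Longrightarrow> norm (f x) \<le> B" "x \<in> space M"
  shows "norm (twisted_sum \<theta> n f x) \<le> real n * B"
proof -
  have "norm (twisted_sum \<theta> n f x) \<le> (\<Sum>k<n. B)"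
    unfolding twisted_sum_def by (rule sum_norm_le) (use assms Tn_space in \<open>auto simp: norm_mult\<close>)
  then show ?thesis by simp
qed

lemma twisted_sum_add:
  "twisted_sum \<theta> (m + n) f x = twisted_sum \<theta> m f x + ee (- (real m * \<theta>)) * twisted_sum \<theta> n f ((T ^^ m) x)"
proof (induction n)
  case (Suc n)
  have "(T ^^ n) ((T ^^ m) x) = (T ^^ (m + n)) x"
    by (metis add.commute comp_apply funpow_add)
  moreover have "ee (- (real (m + n) * \<theta>)) = ee (- (real m * \<theta>)) * ee (- (real n * \<theta>))"
    by (simp add: ee_add[symmetric] algebra_simps)
  ultimately show ?case using Suc by (simp add: twisted_sum_def distrib_left mult.assoc)
qed (simp add: twisted_sum_def)

lemma twisted_sum_mult:
  "twisted_sum \<theta> (k * m) f x = (\<Sum>j<k. ee (- (real (j * m) * \<theta>)) * twisted_sum \<theta> m f ((T ^^ (j * m)) x))"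
proof (induction k)
  case (Suc k)
  have "twisted_sum \<theta> (Suc k * m) f x = twisted_sum \<theta> (k * m + m) f x" by (simp add: add.commute)
  then show ?case unfolding twisted_sum_add Suc by simp
qed (simp add: twisted_sum_def)

text \<open>Divided by n^2, this tends to the mass at \<open>\<theta>\<close> of the spectral
  measure of \<open>f\<close>.\<close>

definition energy :: "real \<Rightarrow> nat \<Rightarrow> ('a \<Rightarrow> complex) \<Rightarrow> real" where
  "energy \<theta> n f = (LINT x|M. (norm (twisted_sum \<theta> n f x))\<^sup>2)"

lemma integrable_power2_norm:
  assumes [measurable]: "f \<in> borel_measurable M" and B: "\<And>x. x \<in> space M \<Longrightarrow> norm (f x) \<le> B"
  shows "integrable M (\<lambda>x. (norm (f x :: complex))\<^sup>2)"
  by (rule integrable_bounded[where B = "B\<^sup>2"]) (use B in \<open>auto intro!: power_mono\<close>)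

lemma energy_nonneg: "energy \<theta> n f \<ge> 0"
  unfolding energy_def by (rule Bochner_Integration.integral_nonneg) simp

text \<open>The triangle inequality in L2, squared: by invariance all translates have the same
  norm.\<close>

lemma integral_norm_sum_power2_le:
  assumes [measurable]: "g \<in> borel_measurable M" and B: "\<And>x. x \<in> space M \<Longrightarrow> norm (g x) \<le> B"
    and c: "\<And>j. norm (c j :: complex) = 1"
  shows "(LINT x|M. (norm (\<Sum>j<k. c j * g ((T ^^ (t j)) x)))\<^sup>2) \<le> (real k)\<^sup>2 * (LINT x|M. (norm (g x))\<^sup>2)"
proof -
  have i: "integrable M (\<lambda>x. (norm (g ((T ^^ n) x)))\<^sup>2)" for n
    by (rule integrable_power2_norm[where B = B]) (use B Tn_space in auto)
  have bnd: "norm (\<Sum>j<k. c j * g ((T ^^ (t j)) x)) \<le> real k * B" if "x \<in> space M" for x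
  proof -
    have "norm (\<Sum>j<k. c j * g ((T ^^ (t j)) x)) \<le> (\<Sum>j<k. B)"
      by (rule sum_norm_le) (use B Tn_space that c in \<open>auto simp: norm_mult\<close>)
    then show ?thesis by simp
  qed
  have "(LINT x|M. (norm (\<Sum>j<k. c j * g ((T ^^ (t j)) x)))\<^sup>2) \<le>
        (LINT x|M. real k * (\<Sum>j<k. (norm (g ((T ^^ (t j)) x)))\<^sup>2))"
  proof (rule integral_mono)
    show "integrable M (\<lambda>x. (norm (\<Sum>j<k. c j * g ((T ^^ (t j)) x)))\<^sup>2)"
      by (rule integrable_power2_norm[where B = "real k * B"]) (use bnd in auto)
    show "(norm (\<Sum>j<k. c j * g ((T ^^ (t j)) x)))\<^sup>2 \<le> real k * (\<Sum>j<k. (norm (g ((T ^^ (t j)) x)))\<^sup>2)" for x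
      using norm_sum_power2_le[of "\<lambda>j. c j * g ((T ^^ (t j)) x)" k] c by (simp add: norm_mult)
  qed (use i in auto)
  also have "\<dots> = real k * (\<Sum>j<k. LINT x|M. (norm (g ((T ^^ (t j)) x)))\<^sup>2)"
    using i by (simp add: Bochner_Integration.integral_sum)
  also have "\<dots> = real k * (\<Sum>j<k. LINT x|M. (norm (g x))\<^sup>2)"
    by (intro arg_cong2[where f = "(*)"] sum.cong refl, rule integral_Tn) measurable
  finally show ?thesis by (simp add: power2_eq_square)
qed

text \<open>Cut \<open>n\<close> into blocks of length \<open>m\<close>; the block sums are
  unimodular multiples of translates of one another, and the remainder of length below
  \<open>m\<close> costs the last term. So energy over n^2 is almost bounded by each of its values,
  with an error that does not involve \<open>\<theta>\<close>. The first fact yields convergence to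
  the infimum, the second uniformity in the frequency.\<close>

lemma energy_le_block:
  assumes f [measurable]: "f \<in> borel_measurable M" and B: "\<And>x. x \<in> space M \<Longrightarrow> norm (f x) \<le> B"
    and m: "m > 0"
  shows "energy \<theta> n f / (real n)\<^sup>2 \<le> energy \<theta> m f / (real m)\<^sup>2 + 2 * real m * B\<^sup>2 / real n"
proof (cases "n = 0")
  case False
  have B0: "B \<ge> 0" using B emeasure_space_1 norm_ge_zero order_trans
    by (metis emeasure_empty ex_in_conv zero_neq_one)
  define k r where "k = n div m" and "r = n mod m"
  have n: "n = k * m + r" and r: "r \<le> m" using m by (auto simp: k_def r_def)
  have S: "norm (twisted_sum \<theta> n f x - twisted_sum \<theta> (k * m) f x) \<le> real m * B" if x: "x \<in> space M" for x
  proof -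
    have "norm (twisted_sum \<theta> n f x - twisted_sum \<theta> (k * m) f x) = norm (twisted_sum \<theta> r f ((T ^^ (k * m)) x))"
      unfolding n twisted_sum_add by (simp add: norm_mult)
    also have "\<dots> \<le> real r * B" by (rule norm_twisted_sum_le[OF B Tn_space[OF x]])
    also have "\<dots> \<le> real m * B" using r B0 by (intro mult_right_mono) auto
    finally show ?thesis .
  qed
  have km: "k * m \<le> n" using n by simp
  have sq: "(norm (twisted_sum \<theta> n f x))\<^sup>2 \<le> (norm (twisted_sum \<theta> (k * m) f x))\<^sup>2 + 2 * (real n * B) * (real m * B)"
    if x: "x \<in> space M" for x
  proof (rule power2_norm_le_add[OF S[OF x]])
    show "norm (twisted_sum \<theta> n f x) \<le> real n * B" by (rule norm_twisted_sum_le[OF B x])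
    have "norm (twisted_sum \<theta> (k * m) f x) \<le> real (k * m) * B" by (rule norm_twisted_sum_le[OF B x])
    also have "\<dots> \<le> real n * B" using km B0 by (intro mult_right_mono) (auto simp del: of_nat_mult)
    finally show "norm (twisted_sum \<theta> (k * m) f x) \<le> real n * B" .
  qed
  have int: "integrable M (\<lambda>x. (norm (twisted_sum \<theta> l f x))\<^sup>2)" for l
    by (rule integrable_power2_norm[where B = "real l * B"]) (use norm_twisted_sum_le[OF B] in auto)
  have "energy \<theta> n f \<le> (LINT x|M. (norm (twisted_sum \<theta> (k * m) f x))\<^sup>2 + 2 * (real n * B) * (real m * B))"
    unfolding energy_def by (rule integral_mono) (use int sq in auto)
  also have "\<dots> = energy \<theta> (k * m) f + 2 * (real n * B) * (real m * B)"
    using int by (simp add: energy_def)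
  also have "energy \<theta> (k * m) f \<le> (real k)\<^sup>2 * energy \<theta> m f"
    unfolding energy_def twisted_sum_mult
    by (rule integral_norm_sum_power2_le[where B = "real m * B"]) (use norm_twisted_sum_le[OF B] in auto)
  finally have "energy \<theta> n f \<le> (real k)\<^sup>2 * energy \<theta> m f + 2 * (real n * B) * (real m * B)" by simp
  also have "(real k)\<^sup>2 * energy \<theta> m f \<le> (real n / real m)\<^sup>2 * energy \<theta> m f"
  proof (intro mult_right_mono power_mono energy_nonneg)
    have "real k * real m \<le> real n" using km by (metis of_nat_le_iff of_nat_mult)
    then show "real k \<le> real n / real m" using m by (simp add: field_simps)
  qed simp
  finally have "energy \<theta> n f / (real n)\<^sup>2 \<le> ((real n / real m)\<^sup>2 * energy \<theta> m f + 2 * (real n * B) * (real m * B)) / (real n)\<^sup>2"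
    by (intro divide_right_mono) auto
  also have "\<dots> = energy \<theta> m f / (real m)\<^sup>2 + 2 * real m * B\<^sup>2 / real n"
    using False m by (simp add: field_simps power2_eq_square)
  finally show ?thesis .
qed (simp add: energy_nonneg)

lemma energy_tendsto:
  assumes f [measurable]: "f \<in> borel_measurable M" and B: "\<And>x. x \<in> space M \<Longrightarrow> norm (f x) \<le> B"
    and \<theta>: "\<theta> \<longlonglongrightarrow> \<theta>0"
  shows "(\<lambda>i. energy (\<theta> i) n f) \<longlonglongrightarrow> energy \<theta>0 n f"
  unfolding energy_def
proof (rule integral_dominated_convergence[where w = "\<lambda>x. (real n * B)\<^sup>2"])
  have "isCont ee t" for t
    using continuous_on_ee[of UNIV "\<lambda>x. x"] by (simp add: continuous_on_eq_continuous_at continuous_on_id)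
  then have "(\<lambda>i. ee (- (real k * \<theta> i))) \<longlonglongrightarrow> ee (- (real k * \<theta>0))" for k
    by (rule isCont_tendsto_compose) (intro tendsto_intros \<theta>)
  then show "AE x in M. (\<lambda>i. (norm (twisted_sum (\<theta> i) n f x))\<^sup>2) \<longlonglongrightarrow> (norm (twisted_sum \<theta>0 n f x))\<^sup>2"
    unfolding twisted_sum_def by (intro AE_I2 tendsto_intros)
  show "AE x in M. norm ((norm (twisted_sum (\<theta> i) n f x))\<^sup>2) \<le> (real n * B)\<^sup>2" for i
    using norm_twisted_sum_le[OF B] by (intro AE_I2) (simp add: power_mono)
qed simp_all

text \<open>On a probability space this is the nonnegativity of the variance of |u|.\<close>

lemma L1_le_L2:
  fixes u :: "'a \<Rightarrow> complex"
  assumes [measurable]: "u \<in> borel_measurable M" and B: "\<And>x. x \<in> space M \<Longrightarrow> norm (u x) \<le> B"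
  shows "(LINT x|M. norm (u x))\<^sup>2 \<le> (LINT x|M. (norm (u x))\<^sup>2)"
proof -
  define c where "c = (LINT x|M. norm (u x))"
  have i1: "integrable M (\<lambda>x. norm (u x))" by (rule integrable_bounded[where B = B]) (use B in auto)
  have i2: "integrable M (\<lambda>x. (norm (u x))\<^sup>2)" by (rule integrable_power2_norm) (use B in auto)
  have "0 \<le> (LINT x|M. (norm (u x) - c)\<^sup>2)" by (rule Bochner_Integration.integral_nonneg) simp
  also have "\<dots> = (LINT x|M. (norm (u x))\<^sup>2 - 2 * c * norm (u x) + c\<^sup>2)"
    by (simp add: power2_eq_square algebra_simps)
  also have "\<dots> = (LINT x|M. (norm (u x))\<^sup>2) - 2 * c * c + c\<^sup>2"
    using i1 i2 by (simp add: c_def)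
  finally show ?thesis by (simp add: c_def power2_eq_square)
qed

lemma twisted_sum_commute:
  "twisted_sum \<theta> l (twisted_sum \<theta> n f) x = twisted_sum \<theta> n (twisted_sum \<theta> l f) x"
proof -
  have "(T ^^ i) ((T ^^ j) x) = (T ^^ j) ((T ^^ i) x)" for i j
    by (metis add.commute comp_apply funpow_add)
  then show ?thesis
    unfolding twisted_sum_def sum_distrib_left
    by (subst sum.swap, intro sum.cong refl) (simp add: mult_ac)
qed

text \<open>Split the sum of length j + l at j and at l: the two decompositions differ only by two
  sums of length \<open>j\<close>, whatever \<open>l\<close> is.\<close>

lemma twisted_sum_shift:
  assumes B: "\<And>x. x \<in> space M \<Longrightarrow> norm (f x) \<le> B" and x: "x \<in> space M"
  shows "norm (ee (- (real j * \<theta>)) * twisted_sum \<theta> l f ((T ^^ j) x) - twisted_sum \<theta> l f x) \<le> 2 * real j * B"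
proof -
  have "twisted_sum \<theta> j f x + ee (- (real j * \<theta>)) * twisted_sum \<theta> l f ((T ^^ j) x) =
        twisted_sum \<theta> l f x + ee (- (real l * \<theta>)) * twisted_sum \<theta> j f ((T ^^ l) x)"
    unfolding twisted_sum_add[symmetric] by (simp add: add.commute)
  then have "ee (- (real j * \<theta>)) * twisted_sum \<theta> l f ((T ^^ j) x) - twisted_sum \<theta> l f x =
     ee (- (real l * \<theta>)) * twisted_sum \<theta> j f ((T ^^ l) x) - twisted_sum \<theta> j f x"
    by (simp add: algebra_simps)
  also have "norm \<dots> \<le> real j * B + real j * B"
  proof (rule order_trans[OF norm_triangle_ineq4 add_mono])
    have "norm (twisted_sum \<theta> j f ((T ^^ l) x)) \<le> real j * B"
      by (rule norm_twisted_sum_le[OF B Tn_space[OF x]])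
    then show "norm (ee (- (real l * \<theta>)) * twisted_sum \<theta> j f ((T ^^ l) x)) \<le> real j * B"
      by (simp add: norm_mult)
    show "norm (twisted_sum \<theta> j f x) \<le> real j * B" by (rule norm_twisted_sum_le[OF B x])
  qed
  finally show ?thesis by (simp add: mult_ac)
qed

text \<open>Summing \<open>twisted_sum_shift\<close> over the \<open>n\<close> terms of the inner
  sum. The error is independent of \<open>l\<close>, so a long twisted average does not distinguish
  \<open>f\<close> from its averages of fixed length.\<close>

lemma twisted_sum_average:
  assumes B: "\<And>x. x \<in> space M \<Longrightarrow> norm (f x) \<le> B" and x: "x \<in> space M"
  shows "norm (twisted_sum \<theta> l (twisted_sum \<theta> n f) x - of_nat n * twisted_sum \<theta> l f x) \<le> 2 * (real n)\<^sup>2 * B"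
proof -
  have B0: "B \<ge> 0" using B[OF x] norm_ge_zero order_trans by blast
  have "twisted_sum \<theta> l (twisted_sum \<theta> n f) x - of_nat n * twisted_sum \<theta> l f x =
    (\<Sum>j<n. ee (- (real j * \<theta>)) * twisted_sum \<theta> l f ((T ^^ j) x) - twisted_sum \<theta> l f x)"
    unfolding twisted_sum_commute[of \<theta> l] unfolding twisted_sum_def[of \<theta> n "twisted_sum \<theta> l f"]
    by (simp add: sum_subtractf)
  also have "norm \<dots> \<le> (\<Sum>j<n. 2 * real n * B)"
  proof (rule sum_norm_le)
    fix j assume "j \<in> {..<n}"
    then have le: "2 * real j * B \<le> 2 * real n * B" using B0 by (intro mult_right_mono) auto
    show "norm (ee (- (real j * \<theta>)) * twisted_sum \<theta> l f ((T ^^ j) x) - twisted_sum \<theta> l f x) \<le> 2 * real n * B"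
      by (rule order_trans[OF twisted_sum_shift[OF B x] le])
  qed
  finally show ?thesis by (simp add: power2_eq_square)
qed


text \<open>The eigenfunction is a limit of averages along a subsequence: their norms converge to the
  infimum over the convex hull of the orbit, so the parallelogram law makes them Cauchy.\<close>

lemma energy_tendsto_0:
  assumes f [measurable]: "f \<in> borel_measurable M" and B: "\<And>x. x \<in> space M \<Longrightarrow> norm (f x) \<le> B"
    and mean: "(LINT x|M. f x) = 0"
    and noeig: "\<And>\<phi>. \<phi> \<in> borel_measurable M \<Longrightarrow> (\<And>x. x \<in> space M \<Longrightarrow> norm (\<phi> x) \<le> B) \<Longrightarrow>
        (\<And>x. x \<in> space M \<Longrightarrow> \<phi> (T x) = ee \<theta> * \<phi> x) \<Longrightarrow> (LINT x|M. \<phi> x) = 0 \<Longrightarrow> AE x in M. \<phi> x = 0"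
  shows "(\<lambda>n. energy \<theta> n f / (real n)\<^sup>2) \<longlonglongrightarrow> 0"
proof -
  have B0: "B \<ge> 0" using B emeasure_space_1 norm_ge_zero order_trans
    by (metis emeasure_empty ex_in_conv zero_neq_one)
  define a where "a = (\<lambda>n x. twisted_sum \<theta> n f x / of_nat n)"
  define c where "c = (\<lambda>n. energy \<theta> n f / (real n)\<^sup>2)"
  have a_meas [measurable]: "a n \<in> borel_measurable M" for n unfolding a_def by measurable
  have a_bound: "norm (a n x) \<le> B" if "x \<in> space M" for n x
    using norm_twisted_sum_le[OF B that, where \<theta> = \<theta> and n = n] B0 by (cases "n = 0") (auto simp: a_def norm_divide field_simps)
  have c_eq: "c n = (LINT x|M. (norm (a n x))\<^sup>2)" for n
    by (simp add: c_def a_def energy_def norm_divide power_divide)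
  have c0: "c n \<ge> 0" for n by (simp add: c_def energy_nonneg)
  define m where "m = (INF n\<in>{0<..}. c n)"
  have m_le: "m \<le> c n" if "n > 0" for n
    unfolding m_def by (rule cINF_lower) (use that c0 in \<open>auto intro!: bdd_belowI2[where m = 0]\<close>)
  have m0: "m \<ge> 0" unfolding m_def by (rule cINF_greatest) (use c0 in \<open>auto intro: exI[of _ 1]\<close>)
  have c_lim: "c \<longlonglongrightarrow> m"
  proof (rule LIMSEQ_I)
    fix r :: real assume r: "r > 0"
    have "\<exists>k\<in>{0<..}. c k < m + r / 2"
    proof (rule ccontr)
      assume "\<not> ?thesis"
      then have "m + r / 2 \<le> (INF n\<in>{0<..}. c n)" by (intro cINF_greatest) (auto simp: not_less)
      then show False using r m_def by simp
    qed
    then obtain k where k: "k > 0" "c k < m + r / 2" by auto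
    obtain n0 :: nat where n0: "real n0 > 4 * real k * B\<^sup>2 / r" using reals_Archimedean2 by blast
    show "\<exists>no. \<forall>n\<ge>no. norm (c n - m) < r"
    proof (intro exI allI impI)
      fix n assume n: "n \<ge> Suc n0"
      then have n': "real n > 4 * real k * B\<^sup>2 / r" "n > 0" using n0 by auto
      have "c n \<le> c k + 2 * real k * B\<^sup>2 / real n"
        unfolding c_def by (rule energy_le_block[OF f B k(1)])
      moreover have "2 * real k * B\<^sup>2 / real n < r / 2" using n' r by (simp add: field_simps)
      ultimately have "c n < m + r" using k by linarith
      then show "norm (c n - m) < r" using m_le[OF n'(2)] by simp
    qed
  qed
  \<comment> \<open>For large l the twisted average of a n + a k is close to twice that of
    \<open>f\<close>, whose squared norm is at least \<open>m\<close>; averaging does not increase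
    the norm, so a n + a k itself has squared norm at least 4 m.\<close>
  have mid: "4 * m \<le> (LINT x|M. (norm (a n x + a k x))\<^sup>2)" if n: "n > 0" and k: "k > 0" for n k
  proof -
    define g where "g = (\<lambda>x. a n x + a k x)"
    have [measurable]: "g \<in> borel_measurable M" unfolding g_def by measurable
    have gB: "norm (g x) \<le> 2 * B" if "x \<in> space M" for x
      unfolding g_def using norm_triangle_le[of "a n x" "a k x" "2 * B"] a_bound[OF that, of n] a_bound[OF that, of k] by simp
    have "4 * m \<le> (LINT x|M. (norm (g x))\<^sup>2) + 16 * (real n + real k) * B\<^sup>2 / real l" if l: "l > 0" for l
    proof -
      have tw: "norm (twisted_sum \<theta> l (a n') x - twisted_sum \<theta> l f x) \<le> 2 * real n' * B"
        if x: "x \<in> space M" and n': "n' > 0" for x n'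
      proof -
        have "twisted_sum \<theta> l (a n') x - twisted_sum \<theta> l f x =
           (twisted_sum \<theta> l (twisted_sum \<theta> n' f) x - of_nat n' * twisted_sum \<theta> l f x) / of_nat n'"
          using n' by (simp add: a_def twisted_sum_def[of \<theta> l] sum_divide_distrib diff_divide_distrib)
        then have "norm (twisted_sum \<theta> l (a n') x - twisted_sum \<theta> l f x) \<le> (2 * (real n')\<^sup>2 * B) / real n'"
          using twisted_sum_average[OF B x, where \<theta> = \<theta> and l = l and n = n'] n' by (simp add: norm_divide divide_right_mono)
        then show ?thesis using n' by (simp add: power2_eq_square)
      qed
      have tg: "twisted_sum \<theta> l g x = twisted_sum \<theta> l (a n) x + twisted_sum \<theta> l (a k) x" for x
        by (simp add: twisted_sum_def g_def distrib_left sum.distrib)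
      have sq: "(norm (2 * twisted_sum \<theta> l f x))\<^sup>2 \<le> (norm (twisted_sum \<theta> l g x))\<^sup>2 + 2 * (real l * (2 * B)) * (2 * (real n + real k) * B)"
        if x: "x \<in> space M" for x
      proof (rule power2_norm_le_add)
        have "norm (twisted_sum \<theta> l (a n) x - twisted_sum \<theta> l f x + (twisted_sum \<theta> l (a k) x - twisted_sum \<theta> l f x)) \<le> 2 * real n * B + 2 * real k * B"
          by (intro norm_triangle_le add_mono tw x n k)
        then show "norm (2 * twisted_sum \<theta> l f x - twisted_sum \<theta> l g x) \<le> 2 * (real n + real k) * B"
          unfolding tg by (subst norm_minus_commute) (simp add: algebra_simps)
        show "norm (2 * twisted_sum \<theta> l f x) \<le> real l * (2 * B)"
          using norm_twisted_sum_le[OF B x] by (simp add: norm_mult)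
        show "norm (twisted_sum \<theta> l g x) \<le> real l * (2 * B)"
          by (rule norm_twisted_sum_le[OF gB x])
      qed
      have int: "integrable M (\<lambda>x. (norm (twisted_sum \<theta> l h x))\<^sup>2)" if [measurable]: "h \<in> borel_measurable M" and "\<And>x. x \<in> space M \<Longrightarrow> norm (h x) \<le> B'" for h B'
        by (rule integrable_power2_norm[where B = "real l * B'"]) (use norm_twisted_sum_le[OF that(2)] in auto)
      have i1: "integrable M (\<lambda>x. (norm (twisted_sum \<theta> l f x))\<^sup>2)" by (rule int[OF f B])
      have i2: "integrable M (\<lambda>x. (norm (twisted_sum \<theta> l g x))\<^sup>2)" by (rule int[OF _ gB]) simp
      have "4 * energy \<theta> l f = (LINT x|M. (norm (2 * twisted_sum \<theta> l f x))\<^sup>2)"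
        using i1 by (simp add: energy_def norm_mult power_mult_distrib)
      also have "\<dots> \<le> (LINT x|M. (norm (twisted_sum \<theta> l g x))\<^sup>2 + 2 * (real l * (2 * B)) * (2 * (real n + real k) * B))"
        by (rule integral_mono) (use i1 i2 sq in \<open>auto simp: norm_mult power_mult_distrib\<close>)
      also have "\<dots> = (LINT x|M. (norm (twisted_sum \<theta> l g x))\<^sup>2) + 2 * (real l * (2 * B)) * (2 * (real n + real k) * B)"
        using i2 by simp
      also have "(LINT x|M. (norm (twisted_sum \<theta> l g x))\<^sup>2) \<le> (real l)\<^sup>2 * (LINT x|M. (norm (g x))\<^sup>2)"
        unfolding twisted_sum_def by (rule integral_norm_sum_power2_le[where B = "2 * B"]) (use gB in auto)
      finally have "4 * energy \<theta> l f \<le> (real l)\<^sup>2 * (LINT x|M. (norm (g x))\<^sup>2) + 2 * (real l * (2 * B)) * (2 * (real n + real k) * B)" by simp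
      then have "4 * c l \<le> ((real l)\<^sup>2 * (LINT x|M. (norm (g x))\<^sup>2) + 2 * (real l * (2 * B)) * (2 * (real n + real k) * B)) / (real l)\<^sup>2"
        unfolding c_def using l by (simp add: divide_right_mono)
      also have "\<dots> = (LINT x|M. (norm (g x))\<^sup>2) + 8 * (real n + real k) * B\<^sup>2 / real l"
        using l by (simp add: field_simps power2_eq_square)
      also have "8 * (real n + real k) * B\<^sup>2 / real l \<le> 16 * (real n + real k) * B\<^sup>2 / real l"
        by (intro divide_right_mono mult_right_mono) auto
      finally show ?thesis using m_le[OF l] by linarith
    qed
    then have "eventually (\<lambda>l. 4 * m \<le> (LINT x|M. (norm (g x))\<^sup>2) + 16 * (real n + real k) * B\<^sup>2 / real l) sequentially"
      using eventually_gt_at_top[of 0] by (rule eventually_mono[rotated])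
    moreover have "(\<lambda>l. (LINT x|M. (norm (g x))\<^sup>2) + 16 * (real n + real k) * B\<^sup>2 / real l) \<longlonglongrightarrow> (LINT x|M. (norm (g x))\<^sup>2) + 0"
      by (intro tendsto_intros lim_const_over_n)
    ultimately have "4 * m \<le> (LINT x|M. (norm (g x))\<^sup>2) + 0"
      by (intro tendsto_lowerbound) auto
    then show ?thesis by (simp add: g_def)
  qed
  have diff: "(LINT x|M. (norm (a n x - a k x))\<^sup>2) \<le> 2 * (c n - m) + 2 * (c k - m)" if "n > 0" "k > 0" for n k
  proof -
    have par: "(norm (u - v))\<^sup>2 = 2 * (norm u)\<^sup>2 + 2 * (norm v)\<^sup>2 - (norm (u + v))\<^sup>2" for u v :: complex
      unfolding cmod_power2 by (simp add: power2_eq_square algebra_simps)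
    have i: "integrable M (\<lambda>x. (norm (a n x))\<^sup>2)" for n
      by (rule integrable_power2_norm[where B = B]) (use a_bound in auto)
    have i2: "integrable M (\<lambda>x. (norm (a n x + a k x))\<^sup>2)"
      by (rule integrable_power2_norm[where B = "2 * B"])
         (use a_bound in \<open>force intro!: norm_triangle_le[of _ _ "2 * B"] add_mono[of _ B _ B, simplified]\<close>)+
    have "(LINT x|M. (norm (a n x - a k x))\<^sup>2) = 2 * c n + 2 * c k - (LINT x|M. (norm (a n x + a k x))\<^sup>2)"
      unfolding par c_eq using i i2 by simp
    also have "\<dots> \<le> 2 * c n + 2 * c k - 4 * m" using mid[OF that] by (intro diff_left_mono)
    also have "\<dots> = 2 * (c n - m) + 2 * (c k - m)" by (simp add: algebra_simps)
    finally show ?thesis .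
  qed
  have "\<exists>N. \<forall>i\<ge>N. \<forall>j\<ge>N. (LINT x|M. norm (a i x - a j x)) < e" if e: "e > 0" for e
  proof -
    have "eventually (\<lambda>n. c n < m + e\<^sup>2 / 8) sequentially"
      using c_lim e by (intro order_tendstoD) auto
    then obtain N where N: "\<And>n. n \<ge> N \<Longrightarrow> c n < m + e\<^sup>2 / 8" by (auto simp: eventually_sequentially)
    show ?thesis
    proof (intro exI allI impI)
      fix i j assume ij: "i \<ge> Suc N" "j \<ge> Suc N"
      have "(LINT x|M. norm (a i x - a j x))\<^sup>2 \<le> (LINT x|M. (norm (a i x - a j x))\<^sup>2)"
      proof (rule L1_le_L2)
        fix x assume "x \<in> space M"
        then show "norm (a i x - a j x) \<le> 2 * B"
          using norm_triangle_ineq4[of "a i x" "a j x"] a_bound[of x i] a_bound[of x j] by linarith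
      qed simp
      also have "\<dots> \<le> 2 * (c i - m) + 2 * (c j - m)" by (rule diff) (use ij in auto)
      also have "\<dots> < e\<^sup>2"
      proof -
        have "c i < m + e\<^sup>2 / 8" "c j < m + e\<^sup>2 / 8" using N ij by auto
        then show ?thesis using zero_less_power[OF e, of 2] by argo
      qed
      finally show "(LINT x|M. norm (a i x - a j x)) < e"
        using e by (simp add: power2_less_imp_less)
    qed
  qed
  moreover have "integrable M (a n)" for n
    by (rule integrable_bounded[where B = B]) (use a_bound in auto)
  ultimately obtain r where r: "strict_mono r" "AE x in M. Cauchy (\<lambda>i. a (r i) x)"
    using cauchy_L1_AE_cauchy_subseq[of M a] by metis
  \<comment> \<open>The value 0 off the convergence set makes the eigenvalue equation hold at every
    point: x and T x lie in the convergence set together, because a n (T x) and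
    \<open>ee \<theta>\<close> times a n x become arbitrarily close.\<close>
  define \<phi> where "\<phi> = (\<lambda>x. if Cauchy (\<lambda>i. a (r i) x) then lim (\<lambda>i. a (r i) x) else 0)"
  have [measurable]: "\<phi> \<in> borel_measurable M"
    unfolding \<phi>_def by (intro measurable_If borel_measurable_lim_metric sets_Collect_Cauchy) auto
  have lim: "(\<lambda>i. a (r i) x) \<longlonglongrightarrow> \<phi> x" if "Cauchy (\<lambda>i. a (r i) x)" for x
    using that by (simp add: \<phi>_def Cauchy_convergent_iff convergent_LIMSEQ_iff)
  have \<phi>B: "norm (\<phi> x) \<le> B" if x: "x \<in> space M" for x
  proof (cases "Cauchy (\<lambda>i. a (r i) x)")
    case True
    show ?thesis by (rule tendsto_upperbound[OF tendsto_norm[OF lim[OF True]]]) (use a_bound[OF x] in auto)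
  qed (use B0 in \<open>simp add: \<phi>_def\<close>)
  have eig: "\<phi> (T x) = ee \<theta> * \<phi> x" if x: "x \<in> space M" for x
  proof -
    have aT: "norm (ee (- \<theta>) * a n (T x) - a n x) \<le> 2 * B / real n" for n
    proof -
      have "norm ((ee (- (real 1 * \<theta>)) * twisted_sum \<theta> n f ((T ^^ 1) x) - twisted_sum \<theta> n f x) / of_nat n) \<le> (2 * real 1 * B) / real n"
        unfolding norm_divide using twisted_sum_shift[OF B x, where j = 1 and \<theta> = \<theta> and l = n] by (simp add: divide_right_mono)
      then show ?thesis by (simp add: a_def diff_divide_distrib)
    qed
    have "(\<lambda>n. 2 * B / real n) \<longlonglongrightarrow> 0" by (rule lim_const_over_n)
    then have "(\<lambda>n. ee (- \<theta>) * a n (T x) - a n x) \<longlonglongrightarrow> 0"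
      by (rule Lim_null_comparison[rotated]) (use aT in auto)
    then have d: "(\<lambda>i. ee (- \<theta>) * a (r i) (T x) - a (r i) x) \<longlonglongrightarrow> 0"
      using LIMSEQ_subseq_LIMSEQ[OF _ r(1)] by (force simp: comp_def)
    have ee1: "ee \<theta> * ee (- \<theta>) = 1" by (simp flip: ee_add)
    show ?thesis
    proof (cases "Cauchy (\<lambda>i. a (r i) x)")
      case True
      have "(\<lambda>i. ee \<theta> * ((ee (- \<theta>) * a (r i) (T x) - a (r i) x) + a (r i) x)) \<longlonglongrightarrow> ee \<theta> * (0 + \<phi> x)"
        by (intro tendsto_intros d lim[OF True])
      then have l: "(\<lambda>i. a (r i) (T x)) \<longlonglongrightarrow> ee \<theta> * \<phi> x"
        using ee1 by (simp add: mult.assoc[symmetric])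
      then have "Cauchy (\<lambda>i. a (r i) (T x))" by (rule LIMSEQ_imp_Cauchy)
      from LIMSEQ_unique[OF lim[OF this] l] show ?thesis .
    next
      case False
      have "\<not> Cauchy (\<lambda>i. a (r i) (T x))"
      proof
        assume C: "Cauchy (\<lambda>i. a (r i) (T x))"
        have "(\<lambda>i. ee (- \<theta>) * a (r i) (T x) - (ee (- \<theta>) * a (r i) (T x) - a (r i) x)) \<longlonglongrightarrow> ee (- \<theta>) * \<phi> (T x) - 0"
          by (intro tendsto_intros d lim[OF C])
        then have "(\<lambda>i. a (r i) x) \<longlonglongrightarrow> ee (- \<theta>) * \<phi> (T x)" by simp
        then show False using False LIMSEQ_imp_Cauchy by blast
      qed
      then show ?thesis using False by (simp add: \<phi>_def)
    qed
  qed
  have aelim: "AE x in M. (\<lambda>i. a (r i) x) \<longlonglongrightarrow> \<phi> x"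
    using r(2) by eventually_elim (rule lim)
  have int_a: "(LINT x|M. a n x) = 0" for n
  proof -
    have "(LINT x|M. a n x) = (\<Sum>k<n. LINT x|M. ee (- (real k * \<theta>)) * f ((T ^^ k) x)) / of_nat n"
      unfolding a_def twisted_sum_def
      by (subst Bochner_Integration.integral_divide_zero, subst Bochner_Integration.integral_sum)
         (auto intro!: integrable_bounded[where B = B] simp: norm_mult B Tn_space)
    also have "\<dots> = (\<Sum>k<n. ee (- (real k * \<theta>)) * (LINT x|M. f ((T ^^ k) x))) / of_nat n"
      by simp
    also have "\<dots> = 0" unfolding integral_Tn[OF f] mean by simp
    finally show ?thesis .
  qed
  have "(\<lambda>i. LINT x|M. a (r i) x) \<longlonglongrightarrow> (LINT x|M. \<phi> x)"
    by (rule integral_dominated_convergence[where w = "\<lambda>x. B"]) (use aelim a_bound in auto)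
  then have "(LINT x|M. \<phi> x) = 0" unfolding int_a by (metis LIMSEQ_const_iff)
  then have ae0: "AE x in M. \<phi> x = 0" by (intro noeig \<phi>B eig) auto
  \<comment> \<open>The same subsequence of energies tends to \<open>m\<close> and to the squared
    norm of \<phi>, which is 0.\<close>
  have "(\<lambda>i. LINT x|M. (norm (a (r i) x))\<^sup>2) \<longlonglongrightarrow> (LINT x|M. (norm (\<phi> x))\<^sup>2)"
  proof (rule integral_dominated_convergence[where w = "\<lambda>x. B\<^sup>2"])
    show "AE x in M. (\<lambda>i. (norm (a (r i) x))\<^sup>2) \<longlonglongrightarrow> (norm (\<phi> x))\<^sup>2"
      using aelim by eventually_elim (intro tendsto_intros)
  qed (use a_bound in \<open>auto intro!: power_mono\<close>)
  moreover have "(LINT x|M. (norm (\<phi> x))\<^sup>2) = (LINT x|M. 0)"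
    by (rule integral_cong_AE) (use ae0 in auto)
  ultimately have "(\<lambda>i. c (r i)) \<longlonglongrightarrow> 0" unfolding c_eq by simp
  moreover have "(\<lambda>i. c (r i)) \<longlonglongrightarrow> m" using LIMSEQ_subseq_LIMSEQ[OF c_lim r(1)] by (simp add: comp_def)
  ultimately have "m = 0" using LIMSEQ_unique by blast
  then show ?thesis using c_lim by (simp add: c_def)
qed

text \<open>Compactness of the frequencies. Bad frequencies at ever longer times accumulate at some
  t; \<open>energy_le_block\<close> carries the lower bound from the long time down to any fixed m,
  and continuity in \<theta> carries it to t. Then the energies at t stay above \<open>e\<close>,
  against \<open>lim\<close>.\<close>

lemma energy_uniformly_small:
  assumes f [measurable]: "f \<in> borel_measurable M" and B: "\<And>x. x \<in> space M \<Longrightarrow> norm (f x) \<le> B"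
    and lim: "\<And>\<theta>. (\<lambda>n. energy \<theta> n f / (real n)\<^sup>2) \<longlonglongrightarrow> 0" and e: "e > 0"
  shows "\<exists>n0. \<forall>n\<ge>n0. \<forall>\<theta>\<in>{0..1}. energy \<theta> n f \<le> e * (real n)\<^sup>2"
proof (rule ccontr)
  assume "\<not> ?thesis"
  then have "\<forall>k. \<exists>n \<theta>. n \<ge> k \<and> \<theta> \<in> {0..1} \<and> energy \<theta> n f > e * (real n)\<^sup>2"
    by (force simp: not_le)
  then obtain N \<theta> where N: "\<And>k. N k \<ge> k" and \<theta>: "\<And>k. \<theta> k \<in> {0..1}"
    and big: "\<And>k. energy (\<theta> k) (N k) f > e * (real (N k))\<^sup>2" by metis
  obtain t r where r: "strict_mono r" and t: "(\<theta> \<circ> r) \<longlonglongrightarrow> t"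
    using compact_Icc[of 0 "1::real", unfolded compact_def] \<theta> by blast
  have "e \<le> energy t m f / (real m)\<^sup>2" if m: "m > 0" for m
  proof -
    have "e \<le> energy (\<theta> (r i)) m f / (real m)\<^sup>2 + 2 * real m * B\<^sup>2 / real i" if i: "i > 0" for i
    proof -
      have Ni: "N (r i) \<ge> i" using N[of "r i"] seq_suble[OF r, of i] by linarith
      then have "e < energy (\<theta> (r i)) (N (r i)) f / (real (N (r i)))\<^sup>2"
        using big[of "r i"] i by (simp add: field_simps)
      also have "\<dots> \<le> energy (\<theta> (r i)) m f / (real m)\<^sup>2 + 2 * real m * B\<^sup>2 / real (N (r i))"
        by (rule energy_le_block[OF f B m])
      also have "2 * real m * B\<^sup>2 / real (N (r i)) \<le> 2 * real m * B\<^sup>2 / real i"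
        using Ni i by (intro divide_left_mono) auto
      finally show ?thesis by simp
    qed
    then have ev: "eventually (\<lambda>i. e \<le> energy (\<theta> (r i)) m f / (real m)\<^sup>2 + 2 * real m * B\<^sup>2 / real i) sequentially"
      using eventually_gt_at_top[of 0] by (rule eventually_mono[rotated])
    have "(\<lambda>i. energy ((\<theta> \<circ> r) i) m f / (real m)\<^sup>2 + 2 * real m * B\<^sup>2 / real i) \<longlonglongrightarrow> energy t m f / (real m)\<^sup>2 + 0"
      using m by (intro tendsto_intros energy_tendsto[OF f B t] lim_const_over_n) auto
    then have "e \<le> energy t m f / (real m)\<^sup>2 + 0"
      using ev by (intro tendsto_lowerbound[of _ _ sequentially]) auto
    then show ?thesis by simp
  qed
  then have "eventually (\<lambda>m. e \<le> energy t m f / (real m)\<^sup>2) sequentially"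
    using eventually_gt_at_top[of 0] by (rule eventually_mono[rotated])
  then have "e \<le> 0" using lim[of t] by (intro tendsto_lowerbound[of _ _ sequentially]) auto
  then show False using e by simp
qed

section \<open>Correlations and weak mixing\<close>

definition corr :: "('a \<Rightarrow> complex) \<Rightarrow> nat \<Rightarrow> nat \<Rightarrow> complex" where
  "corr f m n = (LINT x|M. f ((T ^^ m) x) * cnj (f ((T ^^ n) x)))"

lemma corr_shift:
  assumes [measurable]: "f \<in> borel_measurable M"
  shows "corr f (m + j) (n + j) = corr f m n"
proof -
  have "corr f (m + j) (n + j) = (LINT x|M. (\<lambda>y. f ((T ^^ m) y) * cnj (f ((T ^^ n) y))) ((T ^^ j) x))"
    by (simp add: corr_def funpow_add)
  also have "\<dots> = corr f m n" unfolding corr_def by (rule integral_Tn) measurable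
  finally show ?thesis .
qed

text \<open>Two nonnegative times stand for one integer lag, since \<open>T\<close> is not assumed
  invertible; invariance shifts the earlier pair onto the later one.\<close>

lemma corr_eq:
  assumes f: "f \<in> borel_measurable M" and "int m - int n = int m' - int n'"
  shows "corr f m n = corr f m' n'"
proof (cases "m \<le> m'")
  case True
  then obtain j where j: "m' = m + j" using le_Suc_ex by blast
  with assms(2) have "n' = n + j" by simp
  then show ?thesis using corr_shift[OF f, of m j n] j by simp
next
  case False
  then obtain j where j: "m = m' + j" using le_Suc_ex[of m' m] by auto
  with assms(2) have "n = n' + j" by simp
  then show ?thesis using corr_shift[OF f, of m' j n'] j by simp
qed

text \<open>The weights are left free: they are characters in the Parseval argument and signs in the
  proof of weak mixing.\<close>

lemma energy_eq_corr:
  assumes f [measurable]: "f \<in> borel_measurable M" and B: "\<And>x. x \<in> space M \<Longrightarrow> norm (f x) \<le> B"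
  shows "complex_of_real (LINT x|M. (norm (\<Sum>k<n. z k * f ((T ^^ k) x)))\<^sup>2) = (\<Sum>k<n. \<Sum>l<n. z k * cnj (z l) * corr f k l)"
proof -
  have B0: "B \<ge> 0" using B emeasure_space_1 norm_ge_zero order_trans
    by (metis emeasure_empty ex_in_conv zero_neq_one)
  have i: "integrable M (\<lambda>x. f ((T ^^ k) x) * cnj (f ((T ^^ l) x)))" for k l
    by (rule integrable_bounded[where B = "B * B"])
       (use B Tn_space B0 in \<open>auto simp: norm_mult intro!: mult_mono\<close>)
  have "complex_of_real (LINT x|M. (norm (\<Sum>k<n. z k * f ((T ^^ k) x)))\<^sup>2) =
     (LINT x|M. complex_of_real ((norm (\<Sum>k<n. z k * f ((T ^^ k) x)))\<^sup>2))"
    by (rule integral_complex_of_real[symmetric])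
  also have "\<dots> = (LINT x|M. (\<Sum>k<n. \<Sum>l<n. z k * cnj (z l) * (f ((T ^^ k) x) * cnj (f ((T ^^ l) x)))))"
    unfolding complex_norm_square cnj_sum sum_product
    by (intro Bochner_Integration.integral_cong refl sum.cong) (simp add: mult_ac)
  also have "\<dots> = (\<Sum>k<n. \<Sum>l<n. z k * cnj (z l) * corr f k l)"
    unfolding corr_def using i by (simp add: Bochner_Integration.integral_sum)
  finally show ?thesis .
qed

text \<open>Parseval on \<open>\<int>/4k\<int>\<close>: the energies at the frequencies \<open>b/4k\<close> have mean
  \<open>2k \<parallel>f\<parallel>\<^sup>2\<close>, and their mean square dominates \<open>k\<close> times the sum of the squared correlations.\<close>

lemma sum_corr_power2_le:
  assumes f [measurable]: "f \<in> borel_measurable M" and B: "\<And>x. x \<in> space M \<Longrightarrow> norm (f x) \<le> B"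
    and k: "k > 0" and e: "\<And>\<theta>. \<theta> \<in> {0..1} \<Longrightarrow> energy \<theta> (2 * k) f \<le> e * (real (2 * k))\<^sup>2"
  shows "(\<Sum>m<k. \<Sum>n<k. (norm (corr f m n))\<^sup>2) \<le> 8 * e * (real k)\<^sup>2 * B\<^sup>2"
proof -
  define N where "N = 2 * k"
  \<comment> \<open>Lags of pairs from \<open>I\<close> differ by less than 2 N in absolute value,
    so congruence modulo \<open>P\<close> is equality.\<close>
  define P where "P = int (2 * N)"
  have P: "P > 0" "real_of_int P = 4 * real k" using k by (auto simp: P_def N_def)
  define I where "I = {..<N} \<times> {..<N}"
  define R where "R = (\<lambda>(m, n). corr f m n)"
  define t where "t = (\<lambda>(m, n). int n - int m)"
  have fI: "finite I" by (simp add: I_def)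
  have tR: "R i = R i'" if "t i = t i'" for i i'
  proof -
    obtain m n m' n' where i: "i = (m, n)" "i' = (m', n')" by (cases i; cases i')
    have "int m - int n = int m' - int n'" using that unfolding i t_def by simp
    from corr_eq[OF f this] show ?thesis by (simp add: i R_def)
  qed
  have dvd: "P dvd t i - t i' \<longleftrightarrow> t i = t i'" if "i \<in> I" "i' \<in> I" for i i'
  proof
    assume d: "P dvd t i - t i'"
    have "\<bar>t i - t i'\<bar> < P" using that by (auto simp: I_def t_def P_def split: prod.splits)
    then show "t i = t i'" using d by (metis dvd_imp_le_int not_le abs_of_pos P(1) right_minus_eq)
  qed simp
  define s where "s = (\<lambda>b::int. energy (of_int b / of_int P) N f)"
  have s: "complex_of_real (s b) = (\<Sum>i\<in>I. R i * ee (of_int (b * t i) / of_int P))" for b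
  proof -
    have "complex_of_real (s b) = (\<Sum>m<N. \<Sum>n<N. ee (- (real m * (of_int b / of_int P))) * cnj (ee (- (real n * (of_int b / of_int P)))) * corr f m n)"
      unfolding s_def energy_def twisted_sum_def by (rule energy_eq_corr[OF f B])
    also have "\<dots> = (\<Sum>m<N. \<Sum>n<N. corr f m n * ee (of_int (b * (int n - int m)) / of_int P))"
      unfolding cnj_ee ee_add[symmetric]
      by (intro sum.cong refl) (simp add: algebra_simps diff_divide_distrib)
    finally show ?thesis by (simp add: I_def sum.cartesian_product R_def t_def split_def)
  qed
  have s0: "s b \<ge> 0" for b by (simp add: s_def energy_nonneg)
  have s_le: "s b \<le> e * (real N)\<^sup>2" if "b \<in> {0..<P}" for b
    unfolding s_def N_def using that P by (intro e) (auto simp: field_simps)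
  have R0: "norm (corr f m m) \<le> B\<^sup>2" for m
  proof -
    have "norm (corr f m m) \<le> (LINT x|M. norm (f ((T ^^ m) x) * cnj (f ((T ^^ m) x))))"
      unfolding corr_def by (rule integral_norm_bound)
    also have "\<dots> \<le> B\<^sup>2"
    proof (rule integral_le_bound)
      fix x assume "x \<in> space M"
      then show "norm (f ((T ^^ m) x) * cnj (f ((T ^^ m) x))) \<le> B\<^sup>2"
        unfolding norm_mult power2_eq_square using B Tn_space
        by (intro mult_mono) (auto intro: order_trans[OF norm_ge_zero B])
    qed (rule integrable_norm, rule integrable_bounded[where B = "B * B"],
         use B Tn_space in \<open>auto simp: norm_mult intro!: mult_mono intro: order_trans[OF norm_ge_zero B]\<close>)
    finally show ?thesis .
  qed
  have sum_s: "(\<Sum>b\<in>{0..<P}. s b) \<le> of_int P * (real N * B\<^sup>2)"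
  proof -
    have "complex_of_real (\<Sum>b\<in>{0..<P}. s b) = (\<Sum>i\<in>I. R i * (\<Sum>b\<in>{0..<P}. ee (of_int (b * t i) / of_int P)))"
      unfolding of_real_sum s by (subst sum.swap) (simp add: sum_distrib_left)
    also have "\<dots> = (\<Sum>i\<in>I. if t i = 0 then of_int P * R i else 0)"
    proof (rule sum.cong[OF refl])
      fix i assume i: "i \<in> I"
      have "(0, 0) \<in> I" using k by (simp add: I_def N_def)
      then have "P dvd t i \<longleftrightarrow> t i = 0" using dvd[OF i, of "(0, 0)"] by (simp add: t_def)
      then show "R i * (\<Sum>b\<in>{0..<P}. ee (of_int (b * t i) / of_int P)) = (if t i = 0 then of_int P * R i else 0)"
        unfolding sum_ee_orthogonal[OF P(1)] by simp
    qed
    also have "\<dots> = (\<Sum>m<N. \<Sum>n<N. if m = n then of_int P * corr f m n else 0)"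
      unfolding I_def sum.cartesian_product by (intro sum.cong refl) (auto simp: t_def R_def)
    also have "\<dots> = (\<Sum>m<N. of_int P * corr f m m)" by simp
    finally have eq: "complex_of_real (\<Sum>b\<in>{0..<P}. s b) = (\<Sum>m<N. of_int P * corr f m m)" .
    have "(\<Sum>b\<in>{0..<P}. s b) \<le> norm (complex_of_real (\<Sum>b\<in>{0..<P}. s b))"
      by (subst norm_of_real) (rule abs_ge_self)
    also have "\<dots> \<le> (\<Sum>m<N. of_int P * B\<^sup>2)"
      unfolding eq by (rule sum_norm_le) (use R0 P in \<open>auto simp: norm_mult intro!: mult_left_mono\<close>)
    finally show ?thesis by (simp add: mult_ac)
  qed
  have "(\<Sum>b\<in>{0..<P}. (s b)\<^sup>2) = (\<Sum>b\<in>{0..<P}. (norm (\<Sum>i\<in>I. R i * ee (of_int (b * t i) / of_int P)))\<^sup>2)"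
    unfolding s[symmetric] by simp
  also have "\<dots> = Re (of_int P * (\<Sum>i\<in>I. \<Sum>i'\<in>I. if P dvd t i - t i' then R i * cnj (R i') else 0))"
    by (rule dft_parseval_general[OF P(1) fI])
  also have "(\<Sum>i\<in>I. \<Sum>i'\<in>I. if P dvd t i - t i' then R i * cnj (R i') else 0) =
      complex_of_real (\<Sum>i\<in>I. \<Sum>i'\<in>I. if t i = t i' then (norm (R i))\<^sup>2 else 0)"
    unfolding of_real_sum
  proof (intro sum.cong refl)
    fix i i' assume "i \<in> I" "i' \<in> I"
    then show "(if P dvd t i - t i' then R i * cnj (R i') else 0) = complex_of_real (if t i = t i' then (norm (R i))\<^sup>2 else 0)"
      using dvd[of i i'] tR[of i i'] complex_norm_square[of "R i"] by auto
  qed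
  finally have sq: "(\<Sum>b\<in>{0..<P}. (s b)\<^sup>2) = of_int P * (\<Sum>i\<in>I. \<Sum>i'\<in>I. if t i = t i' then (norm (R i))\<^sup>2 else 0)"
    by simp
  \<comment> \<open>A pair in the square of side k has k diagonal translates with the same lag
    inside the square of side N; this is the reason for N = 2 k.\<close>
  have "(\<Sum>i\<in>{..<k} \<times> {..<k}. real k * (norm (R i))\<^sup>2) \<le> (\<Sum>i\<in>I. \<Sum>i'\<in>I. if t i = t i' then (norm (R i))\<^sup>2 else 0)"
  proof (rule order_trans[OF sum_mono sum_mono2])
    fix i assume i: "i \<in> {..<k} \<times> {..<k}"
    define J where "J = (\<lambda>j. (fst i + j, snd i + j)) ` {..<k}"
    have "real k * (norm (R i))\<^sup>2 = (\<Sum>i'\<in>J. if t i = t i' then (norm (R i))\<^sup>2 else 0)"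
      unfolding J_def by (subst sum.reindex) (auto simp: inj_on_def t_def split_def)
    also have "\<dots> \<le> (\<Sum>i'\<in>I. if t i = t i' then (norm (R i))\<^sup>2 else 0)"
      using i by (intro sum_mono2) (auto simp: J_def I_def N_def)
    finally show "real k * (norm (R i))\<^sup>2 \<le> (\<Sum>i'\<in>I. if t i = t i' then (norm (R i))\<^sup>2 else 0)" .
  qed (auto simp: I_def N_def intro!: sum_nonneg split: if_splits)
  then have "real k * (\<Sum>i\<in>{..<k} \<times> {..<k}. (norm (R i))\<^sup>2) \<le> (\<Sum>i\<in>I. \<Sum>i'\<in>I. if t i = t i' then (norm (R i))\<^sup>2 else 0)"
    by (simp only: sum_distrib_left)
  then have "of_int P * (real k * (\<Sum>i\<in>{..<k} \<times> {..<k}. (norm (R i))\<^sup>2)) \<le> (\<Sum>b\<in>{0..<P}. (s b)\<^sup>2)"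
    unfolding sq using P by (intro mult_left_mono) auto
  \<comment> \<open>The sum of squares is at most the maximum, small by uniformity in the frequency,
    times the sum computed in \<open>sum_s\<close>.\<close>
  also have "\<dots> \<le> (\<Sum>b\<in>{0..<P}. (e * (real N)\<^sup>2) * s b)"
    unfolding power2_eq_square[of "s _"] by (intro sum_mono mult_right_mono s_le s0)
  also have "\<dots> = (e * (real N)\<^sup>2) * (\<Sum>b\<in>{0..<P}. s b)" by (simp add: sum_distrib_left)
  also have "\<dots> \<le> (e * (real N)\<^sup>2) * (of_int P * (real N * B\<^sup>2))"
    using order_trans[OF s0 s_le[of 0]] P by (intro mult_left_mono sum_s) auto
  finally have "of_int P * (real k * (\<Sum>i\<in>{..<k} \<times> {..<k}. (norm (R i))\<^sup>2)) \<le> of_int P * (real k * (8 * e * (real k)\<^sup>2 * B\<^sup>2))"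
    by (simp add: N_def power2_eq_square algebra_simps)
  then have "(\<Sum>i\<in>{..<k} \<times> {..<k}. (norm (R i))\<^sup>2) \<le> 8 * e * (real k)\<^sup>2 * B\<^sup>2"
    using P k by (simp only: mult_le_cancel_left_pos of_nat_0_less_iff of_int_0_less_iff)
  then show ?thesis by (simp add: sum.cartesian_product R_def split_def)
qed

text \<open>For the centred indicator of A all energies are uniformly small, so the correlations are
  small on average. To compare A with a second set A', signs turn the sum of absolute deviations
  into the integral over A' of one signed sum \<open>g\<close> of translates. It is bounded by the
  L2 norm of \<open>g\<close>, whose square is again a combination of correlations.\<close>

lemma weakly_mixing_if_no_eigenfunctions:
  assumes noeig: "\<And>\<phi> \<theta> B. \<phi> \<in> borel_measurable M \<Longrightarrow> (\<And>x. x \<in> space M \<Longrightarrow> norm (\<phi> x) \<le> B) \<Longrightarrow>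
        (\<And>x. x \<in> space M \<Longrightarrow> \<phi> (T x) = ee \<theta> * \<phi> x) \<Longrightarrow> (LINT x|M. \<phi> x) = 0 \<Longrightarrow> AE x in M. \<phi> x = 0"
  shows "weakly_mixing M T"
proof -
  have "(\<lambda>n. (\<Sum>i<n. \<bar>measure M (((T ^^ i) -` A \<inter> space M) \<inter> A') - measure M A * measure M A'\<bar>) / real n) \<longlonglongrightarrow> 0"
    if [measurable]: "A \<in> sets M" "A' \<in> sets M" for A A'
  proof -
  define a where "a = measure M A"
  have a: "0 \<le> a" "a \<le> 1" unfolding a_def using bounded_measure[of A] by auto
  define f where "f = (\<lambda>x. complex_of_real (indicator A x - a))"
  have f [measurable]: "f \<in> borel_measurable M" unfolding f_def by measurable
  have fB: "norm (f x) \<le> 1" for x unfolding f_def norm_of_real using a by (auto simp: indicator_def)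
  have mean: "(LINT x|M. f x) = 0"
    unfolding f_def integral_complex_of_real
    by (subst Bochner_Integration.integral_diff) (auto simp: a_def less_top[symmetric])
  have lim: "(\<lambda>n. energy \<theta> n f / (real n)\<^sup>2) \<longlonglongrightarrow> 0" for \<theta>
  proof (rule energy_tendsto_0[where B = 1, OF f fB mean])
    fix \<phi> :: "'a \<Rightarrow> complex"
    assume "\<phi> \<in> borel_measurable M" "\<And>x. x \<in> space M \<Longrightarrow> norm (\<phi> x) \<le> 1"
      "\<And>x. x \<in> space M \<Longrightarrow> \<phi> (T x) = ee \<theta> * \<phi> x" "(LINT x|M. \<phi> x) = 0"
    then show "AE x in M. \<phi> x = 0" by (rule noeig[where \<theta> = \<theta> and B = 1])
  qed
  define z where "z = (\<lambda>i. measure M (((T ^^ i) -` A \<inter> space M) \<inter> A') - measure M A * measure M A')"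
  have z_fold: "measure M (((T ^^ i) -` A \<inter> space M) \<inter> A') - measure M A * measure M A' = z i" for i
    by (simp add: z_def)
  have z: "z i = (LINT x|M. (indicator A ((T ^^ i) x) - a) * indicator A' x)" for i
  proof -
    have "(LINT x|M. (indicator A ((T ^^ i) x) - a) * indicator A' x) =
      (LINT x|M. indicator (((T ^^ i) -` A \<inter> space M) \<inter> A') x - a * indicator A' x)"
      by (intro Bochner_Integration.integral_cong) (auto simp: indicator_def)
    also have "\<dots> = measure M (((T ^^ i) -` A \<inter> space M) \<inter> A') - a * measure M A'"
      by (subst Bochner_Integration.integral_diff) (auto intro!: integrable_mult_right integrable_real_indicator simp: less_top[symmetric])
    finally show ?thesis by (simp add: z_def a_def)
  qed
  show "(\<lambda>n. (\<Sum>i<n. \<bar>measure M (((T ^^ i) -` A \<inter> space M) \<inter> A') - measure M A * measure M A'\<bar>) / real n) \<longlonglongrightarrow> 0"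
    unfolding z_fold
  proof (rule LIMSEQ_I)
    fix r :: real assume r: "r > 0"
    \<comment> \<open>Two square roots follow: Cauchy-Schwarz bounds the sum of |corr| by the root
      of 8 e k^4, that is (r/2)^2 k^2, and the norm of \<open>g\<close> is the root of that, (r/2)
      k.\<close>
    define e where "e = (r / 2) ^ 4 / 8"
    have e: "e > 0" using r by (simp add: e_def)
    obtain n0 where n0: "\<And>n \<theta>. n \<ge> n0 \<Longrightarrow> \<theta> \<in> {0..1} \<Longrightarrow> energy \<theta> n f \<le> e * (real n)\<^sup>2"
      using energy_uniformly_small[OF f fB lim e] by blast
    show "\<exists>no. \<forall>n\<ge>no. norm ((\<Sum>i<n. \<bar>z i\<bar>) / real n - 0) < r"
    proof (intro exI allI impI)
      fix k assume k: "k \<ge> Suc n0"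
      have corr2: "(\<Sum>m<k. \<Sum>n<k. (norm (corr f m n))\<^sup>2) \<le> 8 * e * (real k)\<^sup>2 * 1\<^sup>2"
      proof (rule sum_corr_power2_le[OF f fB])
        show "energy \<theta> (2 * k) f \<le> e * (real (2 * k))\<^sup>2" if "\<theta> \<in> {0..1}" for \<theta>
          by (rule n0) (use that k in auto)
      qed (use k in simp)
      have "(\<Sum>i\<in>{..<k}\<times>{..<k}. 1 * norm (corr f (fst i) (snd i)))\<^sup>2 \<le>
         (\<Sum>i\<in>{..<k}\<times>{..<k}. 1\<^sup>2) * (\<Sum>i\<in>{..<k}\<times>{..<k}. (norm (corr f (fst i) (snd i)))\<^sup>2)"
        by (rule Cauchy_Schwarz_ineq_sum)
      also have "\<dots> \<le> (real k)\<^sup>2 * (8 * e * (real k)\<^sup>2)"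
        using corr2 by (simp add: sum.cartesian_product split_def power2_eq_square mult_left_mono)
      also have "\<dots> = ((r / 2)\<^sup>2 * (real k)\<^sup>2)\<^sup>2" by (simp add: e_def power2_eq_square power4_eq_xxxx)
      finally have "(\<Sum>i\<in>{..<k}\<times>{..<k}. 1 * norm (corr f (fst i) (snd i))) \<le> (r / 2)\<^sup>2 * (real k)\<^sup>2"
        by (rule power2_le_imp_le) simp
      then have corr1: "(\<Sum>m<k. \<Sum>n<k. norm (corr f m n)) \<le> (r / 2)\<^sup>2 * (real k)\<^sup>2"
        by (simp add: sum.cartesian_product split_def)
      define \<sigma> where "\<sigma> = (\<lambda>i. complex_of_real (sgn (z i)))"
      have \<sigma>: "norm (\<sigma> i) \<le> 1" for i by (simp add: \<sigma>_def sgn_if)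
      define g where "g = (\<lambda>x. \<Sum>i<k. \<sigma> i * f ((T ^^ i) x))"
      have [measurable]: "g \<in> borel_measurable M" unfolding g_def by measurable
      have gB: "norm (g x) \<le> real k" for x
      proof -
        have "norm (g x) \<le> (\<Sum>i<k. 1)"
          unfolding g_def by (rule sum_norm_le) (use fB \<sigma> in \<open>auto simp: norm_mult intro!: mult_le_one\<close>)
        then show ?thesis by simp
      qed
      have ng: "norm (g x) = \<bar>\<Sum>i<k. sgn (z i) * (indicator A ((T ^^ i) x) - a)\<bar>" for x
        unfolding g_def \<sigma>_def f_def of_real_mult[symmetric] of_real_sum[symmetric] norm_of_real ..
      have iz: "integrable M (\<lambda>x. (indicator A ((T ^^ i) x) - a) * indicator A' x)" for i
        by (rule integrable_bounded[where B = 1]) (use a in \<open>auto simp: indicator_def abs_if\<close>)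
      have ig: "integrable M (\<lambda>x. norm (g x))" by (rule integrable_bounded[where B = "real k"]) (use gB in auto)
      have "(\<Sum>i<k. \<bar>z i\<bar>) = (\<Sum>i<k. sgn (z i) * z i)" by (simp add: abs_sgn mult.commute)
      also have "\<dots> = (LINT x|M. (\<Sum>i<k. sgn (z i) * ((indicator A ((T ^^ i) x) - a) * indicator A' x)))"
        unfolding z using iz by (subst Bochner_Integration.integral_sum) auto
      also have "\<dots> \<le> (LINT x|M. norm (g x))"
      proof (rule integral_mono[OF _ ig])
        fix x assume "x \<in> space M"
        have "(\<Sum>i<k. sgn (z i) * ((indicator A ((T ^^ i) x) - a) * indicator A' x)) =
          (\<Sum>i<k. sgn (z i) * (indicator A ((T ^^ i) x) - a)) * indicator A' x"
          by (simp add: sum_distrib_right mult.assoc)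
        also have "\<dots> \<le> norm (g x)" unfolding ng by (auto simp: indicator_def)
        finally show "(\<Sum>i<k. sgn (z i) * ((indicator A ((T ^^ i) x) - a) * indicator A' x)) \<le> norm (g x)" .
      qed (use iz in auto)
      also have "\<dots> \<le> r / 2 * real k"
      proof (rule power2_le_imp_le)
        have "(LINT x|M. norm (g x))\<^sup>2 \<le> (LINT x|M. (norm (g x))\<^sup>2)"
          by (rule L1_le_L2[where B = "real k"]) (use gB in auto)
        also have "\<dots> \<le> norm (complex_of_real (LINT x|M. (norm (g x))\<^sup>2))" by simp
        also have "complex_of_real (LINT x|M. (norm (g x))\<^sup>2) = (\<Sum>m<k. \<Sum>n<k. \<sigma> m * cnj (\<sigma> n) * corr f m n)"
          unfolding g_def by (rule energy_eq_corr[OF f]) (rule fB)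
        also have "norm \<dots> \<le> (\<Sum>m<k. \<Sum>n<k. norm (corr f m n))"
        proof (intro order_trans[OF norm_sum] sum_mono)
          fix m n
          have "norm (\<sigma> m) * norm (\<sigma> n) * norm (corr f m n) \<le> 1 * norm (corr f m n)"
            by (intro mult_right_mono mult_le_one \<sigma>) auto
          then show "norm (\<sigma> m * cnj (\<sigma> n) * corr f m n) \<le> norm (corr f m n)" by (simp add: norm_mult)
        qed
        also have "\<dots> \<le> (r / 2 * real k)\<^sup>2" using corr1 by (simp only: power_mult_distrib)
        finally show "(LINT x|M. norm (g x))\<^sup>2 \<le> (r / 2 * real k)\<^sup>2" .
      qed (use r in simp)
      finally have "(\<Sum>i<k. \<bar>z i\<bar>) / real k \<le> r / 2" using k by (simp add: field_simps)
      moreover have "0 \<le> (\<Sum>i<k. \<bar>z i\<bar>) / real k" by (intro divide_nonneg_nonneg sum_nonneg) auto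
      ultimately show "norm ((\<Sum>i<k. \<bar>z i\<bar>) / real k - 0) < r" using r
        unfolding real_norm_def by linarith
    qed
  qed
  qed
  then show ?thesis
    by (simp add: weakly_mixing_def emeasure_space_1 preserving)
qed

end

section \<open>Special flows\<close>

text \<open>Functions on the plane that descend to the quotient, tested on the two generators of the
  relation.\<close>

definition sf_invariant :: "real \<Rightarrow> (real \<Rightarrow> real) \<Rightarrow> (real \<times> real \<Rightarrow> 'b) \<Rightarrow> bool" where
  "sf_invariant \<alpha> F \<Phi> \<longleftrightarrow> (\<forall>x y. \<Phi> (x + 1, y) = \<Phi> (x, y) \<and> \<Phi> (x + \<alpha>, y - F x) = \<Phi> (x, y))"

lemma sf_invariant_comp_proj: "sf_invariant \<alpha> F (\<lambda>p. f (sf_proj \<alpha> F p))"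
proof -
  have "sf_proj \<alpha> F (x + 1, y) = sf_proj \<alpha> F (x, y)" "sf_proj \<alpha> F (x + \<alpha>, y - F x) = sf_proj \<alpha> F (x, y)" for x y
    unfolding sf_proj_eq_iff by (rule equivclp_sym, rule r_into_equivclp, simp add: sf_step_def)+
  then show ?thesis by (simp add: sf_invariant_def)
qed

lemma birkhoff_sum_Suc: "birkhoff_sum \<alpha> F (Suc n) x = birkhoff_sum \<alpha> F n x + F (x + real n * \<alpha>)"
  by (simp add: birkhoff_sum_def)

lemma birkhoff_sum_add: "birkhoff_sum \<alpha> F (m + n) x = birkhoff_sum \<alpha> F m x + birkhoff_sum \<alpha> F n (x + real m * \<alpha>)"
  by (induction n) (simp_all add: birkhoff_sum_def algebra_simps)

lemma sf_invariant_iterate: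
  assumes "sf_invariant \<alpha> F \<Phi>"
  shows "\<Phi> (x + real n * \<alpha>, y - birkhoff_sum \<alpha> F n x) = \<Phi> (x, y)"
proof (induction n)
  case (Suc n)
  have "\<Phi> ((x + real n * \<alpha>) + \<alpha>, (y - birkhoff_sum \<alpha> F n x) - F (x + real n * \<alpha>)) = \<Phi> (x + real n * \<alpha>, y - birkhoff_sum \<alpha> F n x)"
    using assms by (simp add: sf_invariant_def)
  then show ?case using Suc by (simp add: birkhoff_sum_Suc algebra_simps)
qed (simp add: birkhoff_sum_def)

lemma sf_invariant_one_periodic: "sf_invariant \<alpha> F \<Phi> \<Longrightarrow> one_periodic (\<lambda>x. \<Phi> (x, y))"
  by (simp add: sf_invariant_def one_periodic_def)

lemma sf_flow_iterate: "(sf_flow C ^^ n) (sf_proj \<alpha> F (x, y)) = sf_proj \<alpha> F (x, y + real n * C)"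
  by (induction n) (simp_all add: sf_flow_proj algebra_simps)

section \<open>The special flow as a probability preserving system\<close>

locale special_flow =
  fixes \<alpha> :: real and F :: "real \<Rightarrow> real"
  assumes irrational: "\<alpha> \<notin> \<rat>" and periodic_F: "one_periodic F"
    and continuous_F: "continuous_on UNIV F" and pos_F: "F x > 0"
begin

abbreviation "proj \<equiv> sf_proj \<alpha> F"
abbreviation "\<mu> \<equiv> sf_measure \<alpha> F"

lemma F_bounds:
  obtains a b where "0 < a" "\<And>x. a \<le> F x" "\<And>x. F x \<le> b"
proof -
  have cF: "continuous_on {0..1} F" by (rule continuous_on_subset[OF continuous_F]) simp
  obtain p where "\<forall>y\<in>{0..1}. F p \<le> F y"
    using continuous_attains_inf[OF _ _ cF] by auto
  then have p: "\<And>y. y \<in> {0..1} \<Longrightarrow> F p \<le> F y" by blast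
  obtain q where "\<forall>y\<in>{0..1}. F y \<le> F q"
    using continuous_attains_sup[OF _ _ cF] by auto
  then have q: "\<And>y. y \<in> {0..1} \<Longrightarrow> F y \<le> F q" by blast
  have f: "frac x \<in> {0..1}" for x :: real by (simp add: frac_lt_1 less_imp_le)
  show thesis
  proof (rule that[of "F p" "F q"])
    fix x
    show "F p \<le> F x" "F x \<le> F q"
      using p[OF f[of x]] q[OF f[of x]] by (simp_all add: one_periodic_frac[OF periodic_F])
  qed (rule pos_F)
qed

lemma birkhoff_sum_ge:
  assumes "\<And>x. a \<le> F x"
  shows "real n * a \<le> birkhoff_sum \<alpha> F n x"
proof -
  have "(\<Sum>i<n. a) \<le> birkhoff_sum \<alpha> F n x"
    unfolding birkhoff_sum_def by (rule sum_mono) (rule assms)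
  then show ?thesis by simp
qed

lemma measurable_F [measurable]: "F \<in> borel_measurable borel"
  by (rule borel_measurable_continuous_onI[OF continuous_F])

lemma proj_invariant: "sf_invariant \<alpha> F proj"
  using sf_invariant_comp_proj[of \<alpha> F "\<lambda>z. z"] .

text \<open>Go back along the identifications until the height is nonnegative, then forward as long
  as it stays so. The last clause is for all \<open>t\<close>: it replaces the whole orbit of the
  point, and not only the point.\<close>

lemma representative:
  obtains x' y' where "0 \<le> x'" "x' < 1" "0 \<le> y'" "y' < F x'" "\<And>t. proj (x, y + t) = proj (x', y' + t)"
proof -
  obtain a b where ab: "0 < a" "\<And>x. a \<le> F x" "\<And>x. F x \<le> b" using F_bounds by blast
  have ge: "real n * a \<le> birkhoff_sum \<alpha> F n x" for n x
    using birkhoff_sum_ge[OF ab(2)] .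
  have sh: "proj (x1, y1 + t) = proj (x2, y2 + t)" if "proj (x1, y1) = proj (x2, y2)" for x1 y1 x2 y2 t
    using arg_cong[OF that, of "sf_flow t"] by (simp add: sf_flow_proj)
  have "\<exists>x1 y1. y1 \<ge> 0 \<and> proj (x, y) = proj (x1, y1)"
  proof -
    obtain n :: nat where n: "real n * a > - y" using ex_less_of_nat_mult[OF ab(1)] by blast
    define x1 where "x1 = x - real n * \<alpha>"
    have "proj (x1 + real n * \<alpha>, (y + birkhoff_sum \<alpha> F n x1) - birkhoff_sum \<alpha> F n x1) = proj (x1, y + birkhoff_sum \<alpha> F n x1)"
      by (rule sf_invariant_iterate[OF proj_invariant])
    then have "proj (x, y) = proj (x1, y + birkhoff_sum \<alpha> F n x1)" by (simp add: x1_def)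
    moreover have "y + birkhoff_sum \<alpha> F n x1 \<ge> 0" using n ge[of n x1] by linarith
    ultimately show ?thesis by blast
  qed
  then obtain x1 y1 where 1: "y1 \<ge> 0" "proj (x, y) = proj (x1, y1)" by blast
  \<comment> \<open>The least such n has y1 between the Birkhoff sums of order n and n + 1, so the
    remaining height lies below the roof.\<close>
  define P where "P = (\<lambda>n. y1 < birkhoff_sum \<alpha> F (Suc n) x1)"
  have "\<exists>n. P n"
  proof -
    obtain n :: nat where n: "real n * a > y1" using ex_less_of_nat_mult[OF ab(1)] by blast
    have "real n * a \<le> real (Suc n) * a" using ab by (intro mult_right_mono) auto
    then have "P n" unfolding P_def using n ge[of "Suc n" x1] by linarith
    then show ?thesis ..
  qed
  then obtain n where n: "P n" "\<And>m. m < n \<Longrightarrow> \<not> P m"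
    using exists_least_iff[of P] by blast
  define y2 where "y2 = y1 - birkhoff_sum \<alpha> F n x1"
  have y2: "0 \<le> y2"
  proof (cases n)
    case 0
    then show ?thesis using 1 by (simp add: y2_def birkhoff_sum_def)
  next
    case (Suc m)
    then show ?thesis using n(2)[of m] by (simp add: y2_def P_def)
  qed
  define x2 where "x2 = x1 + real n * \<alpha>"
  have y2': "y2 < F (frac x2)"
    using n(1) by (simp add: y2_def P_def birkhoff_sum_Suc x2_def one_periodic_frac[OF periodic_F])
  have "proj (frac x2, y2) = proj (x2, y2)"
    by (rule one_periodic_frac[OF sf_invariant_one_periodic[OF proj_invariant]])
  also have "\<dots> = proj (x1, y1)"
    unfolding x2_def y2_def by (rule sf_invariant_iterate[OF proj_invariant])
  finally have eq: "proj (x, y) = proj (frac x2, y2)" using 1 by simp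
  show thesis by (rule that[of "frac x2" y2]) (use y2 y2' sh[OF eq] in \<open>auto simp: frac_lt_1\<close>)
qed

lemma space_sf_borel: "space (sf_borel \<alpha> F) = sf_space \<alpha> F"
  unfolding sf_borel_def by (intro space_measure_of) (auto simp: openin_sf_topology)

lemma sets_sf_measure [measurable_cong, simp]: "sets \<mu> = sets (sf_borel \<alpha> F)"
  by (simp add: sf_measure_def)

lemma space_sf_measure: "space \<mu> = sf_space \<alpha> F"
  by (simp add: sf_measure_def space_sf_borel)

lemma proj_measurable [measurable]: "proj \<in> measurable borel (sf_borel \<alpha> F)"
  by (rule measurable_sf_proj)

lemma flow_space: "z \<in> sf_space \<alpha> F \<Longrightarrow> sf_flow t z \<in> sf_space \<alpha> F"
  by (auto simp: sf_space_eq sf_flow_proj)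

lemma flow_measurable [measurable]: "sf_flow t \<in> measurable (sf_borel \<alpha> F) (sf_borel \<alpha> F)"
proof -
  have "sf_flow t \<in> measurable (sf_borel \<alpha> F) (sigma (sf_space \<alpha> F) {U. openin (sf_topology \<alpha> F) U})"
  proof (rule measurable_measure_of)
    show "{U. openin (sf_topology \<alpha> F) U} \<subseteq> Pow (sf_space \<alpha> F)" by (auto simp: openin_sf_topology)
    show "sf_flow t \<in> space (sf_borel \<alpha> F) \<rightarrow> sf_space \<alpha> F" by (auto simp: space_sf_borel flow_space)
    fix U assume "U \<in> {U. openin (sf_topology \<alpha> F) U}"
    then have U: "U \<subseteq> sf_space \<alpha> F" "open (proj -` U)" by (auto simp: openin_sf_topology)
    have "proj -` (sf_flow t -` U \<inter> sf_space \<alpha> F) = (\<lambda>(x, y). (x, y + t)) -` (proj -` U)"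
      by (auto simp: sf_flow_proj sf_proj_in_space)
    moreover have "open ((\<lambda>(x, y). (x, y + t)) -` (proj -` U))"
      by (intro open_vimage[OF U(2)]) (simp add: case_prod_unfold continuous_intros)
    ultimately have "openin (sf_topology \<alpha> F) (sf_flow t -` U \<inter> sf_space \<alpha> F)"
      by (simp add: openin_sf_topology)
    then show "sf_flow t -` U \<inter> space (sf_borel \<alpha> F) \<in> sets (sf_borel \<alpha> F)"
      unfolding space_sf_borel unfolding sf_borel_def
      by (subst sets_measure_of) (auto simp: openin_sf_topology)
  qed
  then show ?thesis by (simp add: sf_borel_def)
qed

abbreviation "D \<equiv> sf_domain F"

lemma D_measurable [measurable]: "D \<in> sets borel"
proof -
  have "D = {p \<in> space borel. 0 \<le> fst p \<and> fst p < 1 \<and> 0 \<le> snd p \<and> snd p < F (fst p)}"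
    by (auto simp: sf_domain_def)
  also have "\<dots> \<in> sets (borel :: (real \<times> real) measure)"
    unfolding borel_prod[symmetric] by measurable
  finally show ?thesis .
qed

lemma nn_integral_D:
  fixes \<Psi> :: "real \<times> real \<Rightarrow> ennreal"
  assumes [measurable]: "\<Psi> \<in> borel_measurable borel"
  shows "(\<integral>\<^sup>+p. \<Psi> p * indicator D p \<partial>lborel) =
         (\<integral>\<^sup>+x. (\<integral>\<^sup>+y. \<Psi> (x, y) * indicator {0..<F x} y \<partial>lborel) \<partial>circle_measure)"
proof -
  have [measurable]: "\<Psi> \<in> borel_measurable (borel \<Otimes>\<^sub>M borel)" "D \<in> sets (borel \<Otimes>\<^sub>M borel)"
    unfolding borel_prod by simp_all
  have m: "(\<lambda>x. \<integral>\<^sup>+y. \<Psi> (x, y) * indicator {0..<F x} y \<partial>lborel) \<in> borel_measurable borel"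
  proof -
    have "(\<lambda>x. \<integral>\<^sup>+y. \<Psi> (x, y) * indicator {0..<F x} y \<partial>lborel) = (\<lambda>x. \<integral>\<^sup>+y. \<Psi> (x, y) * (if 0 \<le> y \<and> y < F x then 1 else 0) \<partial>lborel)"
      by (intro ext nn_integral_cong) (auto simp: indicator_def)
    also have "\<dots> \<in> borel_measurable borel" by measurable
    finally show ?thesis .
  qed
  have "(\<integral>\<^sup>+p. \<Psi> p * indicator D p \<partial>lborel) = (\<integral>\<^sup>+p. \<Psi> p * indicator D p \<partial>(lborel \<Otimes>\<^sub>M lborel))"
    unfolding lborel_prod ..
  also have "\<dots> = (\<integral>\<^sup>+x. \<integral>\<^sup>+y. \<Psi> (x, y) * indicator D (x, y) \<partial>lborel \<partial>lborel)"
    by (rule lborel.nn_integral_fst[symmetric]) measurable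
  also have "\<dots> = (\<integral>\<^sup>+x. indicator {0..<1} x * (\<integral>\<^sup>+y. \<Psi> (x, y) * indicator {0..<F x} y \<partial>lborel) \<partial>lborel)"
  proof (rule nn_integral_cong)
    fix x :: real
    show "(\<integral>\<^sup>+y. \<Psi> (x, y) * indicator D (x, y) \<partial>lborel) = indicator {0..<1} x * (\<integral>\<^sup>+y. \<Psi> (x, y) * indicator {0..<F x} y \<partial>lborel)"
      by (cases "x \<in> {0..<1}") (auto simp: sf_domain_def indicator_def intro!: nn_integral_cong)
  qed
  also have "\<dots> = (\<integral>\<^sup>+x. (\<integral>\<^sup>+y. \<Psi> (x, y) * indicator {0..<F x} y \<partial>lborel) \<partial>circle_measure)"
    unfolding circle_measure_def by (rule nn_integral_density[symmetric]) (use m in auto)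
  finally show ?thesis .
qed

lemma emeasure_D: "emeasure lborel D = ennreal (LINT x|circle_measure. F x)"
proof -
  obtain a b where ab: "0 < a" "\<And>x. a \<le> F x" "\<And>x. F x \<le> b" using F_bounds by blast
  have "emeasure lborel D = (\<integral>\<^sup>+p. 1 * indicator D p \<partial>lborel)" by simp
  also have "\<dots> = (\<integral>\<^sup>+x. (\<integral>\<^sup>+y. 1 * indicator {0..<F x} y \<partial>lborel) \<partial>circle_measure)"
    by (rule nn_integral_D) simp
  also have "\<dots> = (\<integral>\<^sup>+x. ennreal (F x) \<partial>circle_measure)"
    using pos_F by (intro nn_integral_cong) (simp add: less_imp_le)
  also have "\<dots> = ennreal (LINT x|circle_measure. F x)"
  proof (rule nn_integral_eq_integral)
    show "integrable circle_measure F"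
      by (rule integrable_circle_bounded[where B = b]) (use ab less_imp_le[OF pos_F] in auto)
  qed (use pos_F in \<open>auto intro: less_imp_le\<close>)
  finally show ?thesis .
qed

lemma integral_F_pos: "(LINT x|circle_measure. F x) > 0"
proof -
  obtain a b where ab: "0 < a" "\<And>x. a \<le> F x" "\<And>x. F x \<le> b" using F_bounds by blast
  have "(LINT x|circle_measure. a) \<le> (LINT x|circle_measure. F x)"
  proof (rule integral_mono)
    show "integrable circle_measure F"
      by (rule integrable_circle_bounded[where B = b]) (use ab less_imp_le[OF pos_F] in auto)
  qed (use ab in auto)
  then show ?thesis using ab by simp
qed

lemma emeasure_D_bounds: "emeasure lborel D \<noteq> 0" "emeasure lborel D < \<infinity>" "emeasure lborel D \<noteq> top"
  using integral_F_pos by (auto simp: emeasure_D)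

text \<open>The interval [0, F x + t) splits as [0, t) and [t, F x + t), and also as [0, F x) and [F
  x, F x + t). By invariance the last piece is the bottom strip of height \<open>t\<close> over x +
  \<alpha>. Integrated over the circle, the two strips have the same finite integral and cancel. No
  comparison of \<open>t\<close> with the roof is involved.\<close>

lemma nn_integral_D_shift:
  fixes \<Psi> :: "real \<times> real \<Rightarrow> ennreal"
  assumes inv: "sf_invariant \<alpha> F \<Psi>" and [measurable]: "\<Psi> \<in> borel_measurable borel"
    and b: "\<And>p. \<Psi> p \<le> 1" and t: "t \<ge> 0"
  shows "(\<integral>\<^sup>+p. \<Psi> (fst p, snd p + t) * indicator D p \<partial>lborel) = (\<integral>\<^sup>+p. \<Psi> p * indicator D p \<partial>lborel)"
proof -
  have [measurable]: "\<Psi> \<in> borel_measurable (borel \<Otimes>\<^sub>M borel)" unfolding borel_prod by simp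
  have [measurable]: "(\<lambda>p. \<Psi> (fst p, snd p + t)) \<in> borel_measurable (borel \<Otimes>\<^sub>M borel)" by measurable
  then have m1: "(\<lambda>p. \<Psi> (fst p, snd p + t)) \<in> borel_measurable borel" unfolding borel_prod .
  define A where "A = (\<lambda>x. \<integral>\<^sup>+y. \<Psi> (x, y + t) * indicator {0..<F x} y \<partial>lborel)"
  define B where "B = (\<lambda>x. \<integral>\<^sup>+y. \<Psi> (x, y) * indicator {0..<F x} y \<partial>lborel)"
  define k where "k = (\<lambda>x. \<integral>\<^sup>+y. \<Psi> (x, y) * indicator {0..<t} y \<partial>lborel)"
  have [measurable]: "k \<in> borel_measurable borel" unfolding k_def by measurable
  have mAB: "(\<lambda>x. \<integral>\<^sup>+y. \<Psi>' (x, y) * indicator {0..<F x} y \<partial>lborel) \<in> borel_measurable borel"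
    if [measurable]: "\<Psi>' \<in> borel_measurable (borel \<Otimes>\<^sub>M borel)" for \<Psi>' :: "real \<times> real \<Rightarrow> ennreal"
  proof -
    have "(\<lambda>x. \<integral>\<^sup>+y. \<Psi>' (x, y) * indicator {0..<F x} y \<partial>lborel) = (\<lambda>x. \<integral>\<^sup>+y. \<Psi>' (x, y) * (if 0 \<le> y \<and> y < F x then 1 else 0) \<partial>lborel)"
      by (intro ext nn_integral_cong) (auto simp: indicator_def)
    also have "\<dots> \<in> borel_measurable borel" by measurable
    finally show ?thesis .
  qed
  have [measurable]: "A \<in> borel_measurable borel" "B \<in> borel_measurable borel"
    using mAB[of "\<lambda>p. \<Psi> (fst p, snd p + t)"] mAB[of \<Psi>] by (simp_all add: A_def B_def)
  have pw: "A x + k x = B x + k (x + \<alpha>)" for x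
  proof -
    have "A x = (\<integral>\<^sup>+y. \<Psi> (x, y) * indicator {t..<F x + t} y \<partial>lborel)"
      unfolding A_def by (subst (2) nn_integral_real_affine[where c = 1 and t = t])
        (auto intro!: nn_integral_cong simp: indicator_def add.commute)
    then have "A x + k x = (\<integral>\<^sup>+y. \<Psi> (x, y) * indicator {t..<F x + t} y + \<Psi> (x, y) * indicator {0..<t} y \<partial>lborel)"
      unfolding k_def by (subst nn_integral_add) auto
    also have "\<dots> = (\<integral>\<^sup>+y. \<Psi> (x, y) * indicator {0..<F x} y + \<Psi> (x, y) * indicator {F x..<F x + t} y \<partial>lborel)"
      using t pos_F[of x] by (intro nn_integral_cong) (auto simp: indicator_def)
    also have "\<dots> = B x + (\<integral>\<^sup>+y. \<Psi> (x, y) * indicator {F x..<F x + t} y \<partial>lborel)"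
      unfolding B_def by (subst nn_integral_add) auto
    also have "(\<integral>\<^sup>+y. \<Psi> (x, y) * indicator {F x..<F x + t} y \<partial>lborel) = (\<integral>\<^sup>+y. \<Psi> (x, y + F x) * indicator {0..<t} y \<partial>lborel)"
      by (subst nn_integral_real_affine[where c = 1 and t = "F x"])
         (auto intro!: nn_integral_cong simp: indicator_def add.commute)
    also have "\<dots> = k (x + \<alpha>)"
    proof -
      have "\<Psi> (x, y + F x) = \<Psi> (x + \<alpha>, y)" for y
        using inv[unfolded sf_invariant_def, rule_format, of x "y + F x"] by simp
      then show ?thesis by (simp add: k_def)
    qed
    finally show ?thesis .
  qed
  have kper: "one_periodic k" using inv by (simp add: k_def one_periodic_def sf_invariant_def)
  have kfin: "(\<integral>\<^sup>+x. k x \<partial>circle_measure) \<noteq> \<infinity>"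
  proof -
    have "k x \<le> ennreal t" for x
    proof -
      have "k x \<le> (\<integral>\<^sup>+y. 1 * indicator {0..<t} y \<partial>lborel)"
        unfolding k_def by (intro nn_integral_mono mult_right_mono b) auto
      then show ?thesis using t by simp
    qed
    then have "(\<integral>\<^sup>+x. k x \<partial>circle_measure) \<le> (\<integral>\<^sup>+x. ennreal t \<partial>circle_measure)"
      by (intro nn_integral_mono)
    also have "\<dots> < \<infinity>" by (simp add: emeasure_circle_measure)
    finally show ?thesis by simp
  qed
  have "(\<integral>\<^sup>+x. A x \<partial>circle_measure) + (\<integral>\<^sup>+x. k x \<partial>circle_measure) = (\<integral>\<^sup>+x. A x + k x \<partial>circle_measure)"
    by (rule nn_integral_add[symmetric]) auto
  also have "\<dots> = (\<integral>\<^sup>+x. B x \<partial>circle_measure) + (\<integral>\<^sup>+x. k (x + \<alpha>) \<partial>circle_measure)"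
    unfolding pw by (rule nn_integral_add) auto
  also have "(\<integral>\<^sup>+x. k (x + \<alpha>) \<partial>circle_measure) = (\<integral>\<^sup>+x. k x \<partial>circle_measure)"
    by (rule nn_integral_circle_shift[OF kper]) simp
  finally have "(\<integral>\<^sup>+x. k x \<partial>circle_measure) + (\<integral>\<^sup>+x. A x \<partial>circle_measure) =
      (\<integral>\<^sup>+x. k x \<partial>circle_measure) + (\<integral>\<^sup>+x. B x \<partial>circle_measure)"
    by (simp only: add.commute)
  then have "(\<integral>\<^sup>+x. A x \<partial>circle_measure) = (\<integral>\<^sup>+x. B x \<partial>circle_measure)"
    using kfin by (simp only: ennreal_add_left_cancel) simp
  then show ?thesis
    using nn_integral_D[OF m1] nn_integral_D[of \<Psi>] by (simp add: A_def B_def)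
qed

lemma emeasure_\<mu>:
  assumes [measurable]: "A \<in> sets (sf_borel \<alpha> F)"
  shows "emeasure \<mu> A = (\<integral>\<^sup>+p. indicator (proj -` A) p * indicator D p \<partial>lborel) / emeasure lborel D"
proof -
  have m: "proj -` A \<in> sets borel" using measurable_sets[OF proj_measurable assms] by simp
  have "emeasure \<mu> A = emeasure (uniform_measure lborel D) (proj -` A)"
    unfolding sf_measure_def by (subst emeasure_distr) simp_all
  also have "\<dots> = emeasure lborel (D \<inter> (proj -` A)) / emeasure lborel D"
    by (rule emeasure_uniform_measure) (use m in auto)
  also have "emeasure lborel (D \<inter> (proj -` A)) = (\<integral>\<^sup>+p. indicator (D \<inter> (proj -` A)) p \<partial>lborel)"
    using m by (subst nn_integral_indicator) auto
  also have "\<dots> = (\<integral>\<^sup>+p. indicator (proj -` A) p * indicator D p \<partial>lborel)"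
    by (intro nn_integral_cong) (auto simp: indicator_def)
  finally show ?thesis .
qed

lemma probability_preserving_flow:
  assumes t: "t \<ge> 0"
  shows "probability_preserving \<mu> (sf_flow t)"
proof
  show "emeasure \<mu> (space \<mu>) = 1"
  proof -
    have "emeasure \<mu> (space \<mu>) = emeasure (uniform_measure lborel D) UNIV"
      unfolding sf_measure_def using sets.top[of "sf_borel \<alpha> F"]
      by (subst emeasure_distr) (auto simp: space_sf_borel sf_proj_in_space vimage_def)
    also have "\<dots> = 1"
      using emeasure_D_bounds by (simp add: emeasure_uniform_measure ennreal_divide_self)
    finally show ?thesis .
  qed
  show "measure_preserving_map \<mu> (sf_flow t)"
    unfolding measure_preserving_map_def
  proof (intro conjI ballI)
    show "sf_flow t \<in> measurable \<mu> \<mu>"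
      using flow_measurable by (simp add: measurable_def space_sf_borel space_sf_measure)
    fix A assume "A \<in> sets \<mu>"
    then have A: "A \<in> sets (sf_borel \<alpha> F)" by simp
    have A': "sf_flow t -` A \<inter> space \<mu> \<in> sets (sf_borel \<alpha> F)"
      using measurable_sets[OF flow_measurable A] by (simp add: space_sf_borel space_sf_measure)
    define \<Psi> :: "real \<times> real \<Rightarrow> ennreal" where "\<Psi> = (\<lambda>p. indicator (proj -` A) p)"
    have 1: "indicator (proj -` (sf_flow t -` A \<inter> space \<mu>)) p = \<Psi> (fst p, snd p + t)" for p
      by (cases p) (auto simp: \<Psi>_def indicator_def sf_flow_proj space_sf_measure sf_proj_in_space)
    have m: "proj -` A \<in> sets borel" using measurable_sets[OF proj_measurable A] by simp
    have "(\<integral>\<^sup>+p. \<Psi> (fst p, snd p + t) * indicator D p \<partial>lborel) = (\<integral>\<^sup>+p. \<Psi> p * indicator D p \<partial>lborel)"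
    proof (rule nn_integral_D_shift)
      show "sf_invariant \<alpha> F \<Psi>"
        using sf_invariant_comp_proj[of \<alpha> F "indicator A"] by (simp add: \<Psi>_def indicator_def)
      show "\<Psi> \<in> borel_measurable borel" unfolding \<Psi>_def using m by measurable
    qed (use t in \<open>auto simp: \<Psi>_def indicator_def\<close>)
    then show "emeasure \<mu> (sf_flow t -` A \<inter> space \<mu>) = emeasure \<mu> A"
      unfolding emeasure_\<mu>[OF A] emeasure_\<mu>[OF A'] 1 by (simp add: \<Psi>_def)
  qed
qed

end

section \<open>Eigenfunctions of the time-\<open>C\<close> map\<close>

context special_flow
begin

lemma AE_\<mu>_if_AE_plane:
  assumes m: "{z \<in> space (sf_borel \<alpha> F). P z} \<in> sets (sf_borel \<alpha> F)"
    and ae: "AE x in lborel. AE y in lborel. P (proj (x, y))"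
  shows "AE z in \<mu>. P z"
proof -
  have m': "{p. P (proj p)} \<in> sets (borel :: (real \<times> real) measure)"
  proof -
    have "proj -` {z \<in> space (sf_borel \<alpha> F). P z} \<inter> space borel \<in> sets borel"
      by (rule measurable_sets[OF proj_measurable m])
    also have "proj -` {z \<in> space (sf_borel \<alpha> F). P z} \<inter> space borel = {p. P (proj p)}"
      by (auto simp: space_sf_borel sf_proj_in_space)
    finally show ?thesis .
  qed
  have "AE p in lborel \<Otimes>\<^sub>M lborel. P (proj p)"
  proof (rule lborel_pair.AE_pair_measure)
    have "sets (lborel \<Otimes>\<^sub>M lborel) = sets (borel :: (real \<times> real) measure)"
      by (simp only: lborel_prod sets_lborel)
    then show "{p \<in> space (lborel \<Otimes>\<^sub>M lborel). P (proj p)} \<in> sets (lborel \<Otimes>\<^sub>M lborel)"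
      using m' by (simp add: space_pair_measure)
    show "AE x in lborel. AE y in lborel. P (proj (x, y))" by (rule ae)
  qed
  then have "AE p in lborel. P (proj p)" unfolding lborel_prod .
  then have "AE p in uniform_measure lborel D. P (proj p)"
    by (subst AE_uniform_measure) (use emeasure_D_bounds in auto)
  then show ?thesis
    unfolding sf_measure_def by (subst AE_distr_iff) (use m in auto)
qed

text \<open>An eigenfunction restricted to a vertical line is quasi-periodic; its Fourier coefficients,
  as functions of the base point, are multiplied by a unimodular cocycle under the rotation.\<close>

lemma no_eigenfunction:
  fixes \<phi> :: "(real \<times> real) set \<Rightarrow> complex"
  assumes C: "C > 0"
    and noco: "\<And>s. s \<noteq> 0 \<Longrightarrow> \<not> (\<exists>p::real \<Rightarrow> real. one_periodic p \<and> p \<in> borel_measurable borel \<and>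
        (AE x in lborel. [s * F x = p (x + \<alpha>) - p x] (rmod 1)))"
    and \<phi> [measurable]: "\<phi> \<in> borel_measurable \<mu>" and B: "\<And>z. z \<in> space \<mu> \<Longrightarrow> norm (\<phi> z) \<le> B"
    and eig: "\<And>z. z \<in> space \<mu> \<Longrightarrow> \<phi> (sf_flow C z) = ee \<theta> * \<phi> z"
    and mean: "(LINT z|\<mu>. \<phi> z) = 0"
  shows "AE z in \<mu>. \<phi> z = 0"
proof -
  have \<phi>m [measurable]: "\<phi> \<in> borel_measurable (sf_borel \<alpha> F)" using \<phi> by simp
  define \<Phi> where "\<Phi> = (\<lambda>p. \<phi> (proj p))"
  have "\<Phi> \<in> borel_measurable borel" unfolding \<Phi>_def by measurable
  then have [measurable]: "\<Phi> \<in> borel_measurable (borel \<Otimes>\<^sub>M borel)" unfolding borel_prod .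
  have \<Phi>B: "norm (\<Phi> p) \<le> B" for p
    unfolding \<Phi>_def by (rule B) (simp add: space_sf_measure sf_proj_in_space)
  have inv: "sf_invariant \<alpha> F \<Phi>" unfolding \<Phi>_def by (rule sf_invariant_comp_proj)
  have \<Phi>1: "\<Phi> (x + 1, y) = \<Phi> (x, y)" and \<Phi>\<alpha>: "\<Phi> (x + \<alpha>, y) = \<Phi> (x, y + F x)" for x y
    using inv[unfolded sf_invariant_def, rule_format, of x y] inv[unfolded sf_invariant_def, rule_format, of x "y + F x"] by auto
  have \<Phi>C: "\<Phi> (x, y + C) = ee \<theta> * \<Phi> (x, y)" for x y
    using eig[of "proj (x, y)"] by (simp add: \<Phi>_def sf_flow_proj space_sf_measure sf_proj_in_space)
  \<comment> \<open>Along the vertical line, u maps to \<open>ee (- (\<theta> * u))\<close> times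
    \<Phi> (x, C u), a function of period 1 by the eigenvalue equation; these are its Fourier
    coefficients.\<close>
  define \<psi> where "\<psi> = (\<lambda>(k::int) x. LINT u|circle_measure. ee ((of_int k - \<theta>) * u) * \<Phi> (x, C * u))"
  define s where "s = (\<lambda>k::int. (of_int k - \<theta>) / C)"
  have [measurable]: "\<psi> k \<in> borel_measurable borel" for k
    unfolding \<psi>_def by measurable
  have int: "integrable circle_measure (\<lambda>u. ee ((of_int k - \<theta>) * u) * \<Phi> (x, C * u))" for k x
    by (rule integrable_circle_bounded[where B = B]) (use \<Phi>B in \<open>auto simp: norm_mult\<close>)
  have \<psi>B: "norm (\<psi> k x) \<le> B" for k x
  proof -
    have "norm (\<psi> k x) \<le> (LINT u|circle_measure. norm (ee ((of_int k - \<theta>) * u) * \<Phi> (x, C * u)))"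
      unfolding \<psi>_def by (rule integral_norm_bound)
    also have "\<dots> \<le> (LINT u|circle_measure. B)"
      by (rule integral_mono[OF integrable_norm[OF int]]) (use \<Phi>B in \<open>auto simp: norm_mult\<close>)
    finally show ?thesis by simp
  qed
  have \<psi>1: "one_periodic (\<psi> k)" for k by (simp add: one_periodic_def \<psi>_def \<Phi>1)
  \<comment> \<open>Rotating the base point is the same as moving up by \<open>F x\<close>, a
    translation of u by F x / C; it multiplies the coefficient by a character value.\<close>
  have \<psi>\<alpha>: "\<psi> k (x + \<alpha>) = ee (- (s k * F x)) * \<psi> k x" for k x
  proof -
    define E where "E = (\<lambda>u. ee ((of_int k - \<theta>) * u) * \<Phi> (x, C * u))"
    have E1: "one_periodic E"
      unfolding one_periodic_def
    proof
      fix u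
      have "\<Phi> (x, C * (u + 1)) = ee \<theta> * \<Phi> (x, C * u)"
        using \<Phi>C[of x "C * u"] by (simp add: distrib_left)
      moreover have "ee ((of_int k - \<theta>) * (u + 1)) * ee \<theta> = ee ((of_int k - \<theta>) * u)"
      proof -
        have "ee ((of_int k - \<theta>) * (u + 1)) * ee \<theta> = ee ((of_int k - \<theta>) * u + of_int k)"
          by (simp add: ee_add[symmetric] algebra_simps)
        then show ?thesis by (simp only: ee_add_of_int)
      qed
      ultimately show "E (u + 1) = E u" by (simp add: E_def mult.assoc[symmetric])
    qed
    have "ee ((of_int k - \<theta>) * u) * \<Phi> (x + \<alpha>, C * u) = ee (- (s k * F x)) * E (u + F x / C)" for u
    proof -
      have "C * (u + F x / C) = C * u + F x" using C by (simp add: field_simps)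
      moreover have "ee ((of_int k - \<theta>) * u) = ee (- (s k * F x)) * ee ((of_int k - \<theta>) * (u + F x / C))"
        unfolding ee_add[symmetric] s_def using C by (intro arg_cong[where f = ee]) (simp add: field_simps)
      ultimately show ?thesis by (simp add: E_def \<Phi>\<alpha>)
    qed
    then have "\<psi> k (x + \<alpha>) = ee (- (s k * F x)) * (LINT u|circle_measure. E (u + F x / C))"
      by (simp add: \<psi>_def)
    also have "(LINT u|circle_measure. E (u + F x / C)) = (LINT u|circle_measure. E u)"
      by (rule integral_circle_shift[OF E1]) (unfold E_def, measurable)
    finally show ?thesis by (simp add: \<psi>_def E_def)
  qed
  \<comment> \<open>The modulus of the coefficient is rotation invariant, hence almost everywhere a
    constant. If the constant is not 0, the argument of the coefficient solves the excluded equation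
    with the nonzero factor - s k.\<close>
  have zero: "AE x in lborel. \<psi> k x = 0" if k: "of_int k \<noteq> \<theta>" for k
  proof -
    define c where "c = (LINT x|circle_measure. complex_of_real (norm (\<psi> k x)))"
    have ae: "AE x in lborel. complex_of_real (norm (\<psi> k x)) = c"
      unfolding c_def
    proof (rule rotation_invariant_imp_const[OF irrational])
      show "norm (complex_of_real (norm (\<psi> k x))) \<le> B" for x using \<psi>B by simp
      show "one_periodic (\<lambda>x. complex_of_real (norm (\<psi> k x)))" using \<psi>1[of k] by (simp add: one_periodic_def)
      show "complex_of_real (norm (\<psi> k (x + \<alpha>))) = complex_of_real (norm (\<psi> k x))" for x
        by (simp add: \<psi>\<alpha> norm_mult)
    qed measurable
    show ?thesis
    proof (cases "c = 0")
      case True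
      then show ?thesis using ae by simp
    next
      case False
      obtain a where a [measurable]: "a \<in> borel_measurable borel" "\<And>z. norm z = 1 \<Longrightarrow> ee (a z) = z"
        using measurable_unit_argument by blast
      define p where "p = (\<lambda>x. a (\<psi> k x / of_real (norm (\<psi> k x))))"
      have "one_periodic p" using \<psi>1[of k] by (simp add: p_def one_periodic_def)
      moreover have "p \<in> borel_measurable borel" unfolding p_def by measurable
      moreover have "AE x in lborel. [(- s k) * F x = p (x + \<alpha>) - p x] (rmod 1)"
        using ae
      proof eventually_elim
        case (elim x)
        then have nz: "\<psi> k x \<noteq> 0" using False by auto
        have pe: "ee (p x) = \<psi> k x / of_real (norm (\<psi> k x))"
          unfolding p_def by (rule a(2)) (use nz in \<open>simp add: norm_divide\<close>)
        have "ee (p (x + \<alpha>)) = \<psi> k (x + \<alpha>) / of_real (norm (\<psi> k (x + \<alpha>)))"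
          unfolding p_def by (rule a(2)) (use nz in \<open>simp add: norm_divide \<psi>\<alpha> norm_mult\<close>)
        also have "\<dots> = ee (- (s k * F x) + p x)"
          unfolding ee_add pe by (simp add: \<psi>\<alpha> norm_mult)
        finally have "p (x + \<alpha>) - (- (s k * F x) + p x) \<in> \<int>" by (simp only: ee_eq_iff)
        then obtain n where "p (x + \<alpha>) - (- (s k * F x) + p x) = of_int n" by (auto elim: Ints_cases)
        then show ?case unfolding rcong_altdef by (intro exI[of _ n]) simp
      qed
      ultimately have False using noco[of "- s k"] k C by (auto simp: s_def)
      then show ?thesis ..
    qed
  qed
  \<comment> \<open>One frequency escapes: for integral \<open>\<theta>\<close> and k = \<theta> the
    factor s k is 0, and the coefficient itself is invariant, hence constant.\<close>
  obtain \<kappa> where \<kappa>: "\<And>k. AE x in lborel. \<psi> k x = (if of_int k = \<theta> then \<kappa> else 0)" and \<kappa>0: "\<theta> \<notin> \<int> \<Longrightarrow> \<kappa> = 0"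
  proof (cases "\<theta> \<in> \<int>")
    case True
    then obtain k0 where k0: "\<theta> = of_int k0" by (auto elim: Ints_cases)
    have "AE x in lborel. \<psi> k0 x = (LINT x|circle_measure. \<psi> k0 x)"
    proof (rule rotation_invariant_imp_const[OF irrational _ \<psi>B \<psi>1])
      show "\<psi> k0 (x + \<alpha>) = \<psi> k0 x" for x using \<psi>\<alpha>[of k0 x] by (simp add: s_def k0)
    qed measurable
    then show thesis
      using that[of "LINT x|circle_measure. \<psi> k0 x"] zero True k0 by fastforce
  next
    case False
    then show thesis using that[of 0] zero by force
  qed
  have "AE x in lborel. \<forall>k. \<psi> k x = (if of_int k = \<theta> then \<kappa> else 0)"
    unfolding AE_all_countable using \<kappa> by blast
  then have "AE x in lborel. AE y in lborel. \<Phi> (x, y) = \<kappa>"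
  proof eventually_elim
    case (elim x)
    \<comment> \<open>Subtracting \<kappa> removes the remaining coefficient. The period stays 1,
      since \<kappa> is 0 unless \<open>ee \<theta>\<close> is 1.\<close>
    define h where "h = (\<lambda>u. ee (- (\<theta> * u)) * (\<Phi> (x, C * u) - \<kappa>))"
    have [measurable]: "h \<in> borel_measurable borel" unfolding h_def by measurable
    have "AE u in lborel. h u = 0"
    proof (rule fourier_coefficients_zero_imp_zero[of 1])
      show "norm (h u) \<le> B + norm \<kappa>" for u
        unfolding h_def using norm_triangle_ineq4[of "\<Phi> (x, C * u)" \<kappa>] \<Phi>B[of "(x, C * u)"] by (simp add: norm_mult)
      show "h (u + 1) = h u" for u
      proof -
        have 1: "\<Phi> (x, C * (u + 1)) = ee \<theta> * \<Phi> (x, C * u)"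
          using \<Phi>C[of x "C * u"] by (simp add: distrib_left)
        have 2: "ee (- (\<theta> * (u + 1))) * ee \<theta> = ee (- (\<theta> * u))"
          by (simp add: ee_add[symmetric] algebra_simps)
        have 3: "ee \<theta> * \<kappa> = \<kappa>" using \<kappa>0 ee_eq_1_iff[of \<theta>] by (cases "\<theta> \<in> \<int>") auto
        have "h (u + 1) = ee (- (\<theta> * (u + 1))) * (ee \<theta> * \<Phi> (x, C * u) - ee \<theta> * \<kappa>)"
          unfolding h_def 1 3 ..
        also have "\<dots> = (ee (- (\<theta> * (u + 1))) * ee \<theta>) * (\<Phi> (x, C * u) - \<kappa>)" by (simp add: algebra_simps)
        finally show ?thesis unfolding 2 h_def .
      qed
      fix k :: int
      have ie: "integrable circle_measure (\<lambda>u. ee ((of_int k - \<theta>) * u))"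
        by (rule integrable_circle_bounded[where B = 1]) auto
      have "(LINT u:{0..<1}|lborel. ee (of_int k * u / 1) * h u) = (LINT u|circle_measure. ee (of_int k * u / 1) * h u)"
        by (rule integral_circle_measure[symmetric]) measurable
      also have "\<dots> = (LINT u|circle_measure. ee ((of_int k - \<theta>) * u) * \<Phi> (x, C * u) - \<kappa> * ee ((of_int k - \<theta>) * u))"
        unfolding h_def by (intro Bochner_Integration.integral_cong refl)
          (simp add: left_diff_distrib right_diff_distrib ee_add[of "_ * _" "- (_ * _)", simplified] mult_ac)
      also have "\<dots> = \<psi> k x - \<kappa> * (LINT u|circle_measure. ee ((of_int k - \<theta>) * u))"
        using int ie by (simp add: \<psi>_def)
      also have "\<dots> = 0"
      proof (cases "of_int k = \<theta>")
        case True
        then show ?thesis using elim by auto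
      next
        case False
        show ?thesis
        proof (cases "\<theta> \<in> \<int>")
          case True
          then obtain k0 where k0: "\<theta> = of_int k0" by (auto elim: Ints_cases)
          then have "(LINT u|circle_measure. ee (of_int (k - k0) * u)) = 0"
            using False by (intro integral_circle_ee) auto
          then show ?thesis using elim False k0 by simp
        qed (use elim False \<kappa>0 in simp)
      qed
      finally show "(LINT u:{0..<1}|lborel. ee (of_int k * u / 1) * h u) = 0" .
    qed auto
    then have "AE u in lborel. h ((1 / C) * u) = 0" by (rule AE_lborel_scale[rotated]) (use C in auto)
    then show ?case by eventually_elim (use C in \<open>simp add: h_def\<close>)
  qed
  then have "AE z in \<mu>. \<phi> z = \<kappa>"
    unfolding \<Phi>_def by (intro AE_\<mu>_if_AE_plane) measurable
  moreover have "(LINT z|\<mu>. \<phi> z) = (LINT z|\<mu>. \<kappa>)"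
    by (rule integral_cong_AE) (use calculation in auto)
  moreover have "measure \<mu> (space \<mu>) = 1"
    using probability_preserving.measure_space_1[OF probability_preserving_flow[of 0]] by simp
  ultimately have "\<kappa> = 0" using mean by simp
  then show ?thesis using \<open>AE z in \<mu>. \<phi> z = \<kappa>\<close> by simp
qed

end

section \<open>Unique ergodicity\<close>

context special_flow
begin

text \<open>The compact rectangle of height \<open>b\<close> over [0, 1] meets every class.\<close>

lemma proj_bounded:
  fixes f :: "(real \<times> real) set \<Rightarrow> 'b::real_normed_vector"
  assumes cont: "continuous_on UNIV (\<lambda>p. f (proj p))"
  obtains B where "\<And>p. norm (f (proj p)) \<le> B"
proof -
  obtain a b where ab: "0 < a" "\<And>x. a \<le> F x" "\<And>x. F x \<le> b" using F_bounds by blast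
  have "compact ((\<lambda>p. f (proj p)) ` ({0..1} \<times> {0..b}))"
    by (intro compact_continuous_image continuous_on_subset[OF cont] compact_Times) auto
  then obtain B where B: "\<And>p. p \<in> {0..1} \<times> {0..b} \<Longrightarrow> norm (f (proj p)) \<le> B"
    using compact_imp_bounded by (fastforce simp: bounded_iff)
  show thesis
  proof (rule that)
    fix p :: "real \<times> real"
    obtain x y where p: "p = (x, y)" by (cases p)
    obtain x' y' where r: "0 \<le> x'" "x' < 1" "0 \<le> y'" "y' < F x'" "\<And>t. proj (x, y + t) = proj (x', y' + t)"
      using representative by blast
    have "(x', y') \<in> {0..1} \<times> {0..b}" using r ab(3)[of x'] by auto
    from B[OF this] show "norm (f (proj p)) \<le> B" using r(5)[of 0] by (simp add: p)
  qed
qed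

text \<open>The base point is confined to the fundamental domain: elsewhere, bringing two points
  back to it changes a horizontal displacement by a difference of Birkhoff sums of \<open>F\<close>.
  The rectangle has a margin of 1 on each side, whence the cap on the displacement.\<close>

lemma proj_uniformly_continuous:
  fixes f :: "(real \<times> real) set \<Rightarrow> 'b::real_normed_vector"
  assumes cont: "continuous_on UNIV (\<lambda>p. f (proj p))" and e: "e > 0"
  obtains d where "d > 0" "\<And>x y u v. 0 \<le> x \<Longrightarrow> x < 1 \<Longrightarrow> 0 \<le> y \<Longrightarrow> y < F x \<Longrightarrow> \<bar>u\<bar> \<le> d \<Longrightarrow> \<bar>v\<bar> \<le> d \<Longrightarrow>
     norm (f (proj (x + u, y + v)) - f (proj (x, y))) \<le> e"
proof -
  obtain a b where ab: "0 < a" "\<And>x. a \<le> F x" "\<And>x. F x \<le> b" using F_bounds by blast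
  have "uniformly_continuous_on ({-1..2} \<times> {-1..b+1}) (\<lambda>p. f (proj p))"
    by (intro compact_uniformly_continuous continuous_on_subset[OF cont] compact_Times) auto
  then obtain d where d: "d > 0" "\<And>p p'. p \<in> {-1..2} \<times> {-1..b+1} \<Longrightarrow> p' \<in> {-1..2} \<times> {-1..b+1} \<Longrightarrow>
      dist p' p < d \<Longrightarrow> dist (f (proj p')) (f (proj p)) < e"
    using e by (auto simp: uniformly_continuous_on_def)
  show thesis
  proof (rule that[of "min 1 (d / 3)"])
    fix x y u v :: real
    assume *: "0 \<le> x" "x < 1" "0 \<le> y" "y < F x" "\<bar>u\<bar> \<le> min 1 (d / 3)" "\<bar>v\<bar> \<le> min 1 (d / 3)"
    have "dist (x + u, y + v) (x, y) \<le> \<bar>u\<bar> + \<bar>v\<bar>"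
      unfolding dist_Pair_Pair dist_real_def using sqrt_sum_squares_le_sum_abs[of u v] by simp
    also have "\<dots> < d" using * d by auto
    finally have "dist (f (proj (x + u, y + v))) (f (proj (x, y))) < e"
      using * ab(3)[of x] by (intro d(2)) auto
    then show "norm (f (proj (x + u, y + v)) - f (proj (x, y))) \<le> e" by (simp add: dist_norm)
  qed (use d in auto)
qed

text \<open>Vertical displacements commute with the identifications, so the modulus found in the
  fundamental domain holds at all points of the plane.\<close>

lemma proj_vertically_equicontinuous:
  fixes f :: "(real \<times> real) set \<Rightarrow> 'b::real_normed_vector"
  assumes cont: "continuous_on UNIV (\<lambda>p. f (proj p))" and e: "e > 0"
  obtains d where "d > 0" "\<And>x y v. \<bar>v\<bar> \<le> d \<Longrightarrow> norm (f (proj (x, y + v)) - f (proj (x, y))) \<le> e"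
proof -
  obtain d where d: "d > 0" "\<And>x y u v. 0 \<le> x \<Longrightarrow> x < 1 \<Longrightarrow> 0 \<le> y \<Longrightarrow> y < F x \<Longrightarrow> \<bar>u\<bar> \<le> d \<Longrightarrow> \<bar>v\<bar> \<le> d \<Longrightarrow>
     norm (f (proj (x + u, y + v)) - f (proj (x, y))) \<le> e"
    using proj_uniformly_continuous[OF cont e] by blast
  show thesis
  proof (rule that[OF d(1)])
    fix x y v :: real assume v: "\<bar>v\<bar> \<le> d"
    obtain x' y' where r: "0 \<le> x'" "x' < 1" "0 \<le> y'" "y' < F x'" "\<And>t. proj (x, y + t) = proj (x', y' + t)"
      using representative by blast
    show "norm (f (proj (x, y + v)) - f (proj (x, y))) \<le> e"
      using d(2)[OF r(1-4), of 0 v] v d(1) r(5)[of v] r(5)[of 0] by simp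
  qed
qed

lemma continuous_map_borel_measurable:
  fixes f :: "(real \<times> real) set \<Rightarrow> 'b::metric_space"
  assumes cont: "continuous_map (sf_topology \<alpha> F) euclidean f"
  shows "f \<in> borel_measurable (sf_borel \<alpha> F)"
proof (rule borel_measurableI)
  fix U :: "'b set" assume "open U"
  then have "openin (sf_topology \<alpha> F) {x \<in> topspace (sf_topology \<alpha> F). f x \<in> U}"
    using cont by (auto simp: continuous_map_def)
  moreover have "{x \<in> topspace (sf_topology \<alpha> F). f x \<in> U} = f -` U \<inter> space (sf_borel \<alpha> F)"
    by (auto simp: topspace_sf_topology space_sf_borel)
  ultimately show "f -` U \<inter> space (sf_borel \<alpha> F) \<in> sets (sf_borel \<alpha> F)"
    unfolding sf_borel_def by (subst sets_measure_of) (auto simp: openin_sf_topology)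
qed

lemma continuous_comp_proj:
  assumes cont: "continuous_map (sf_topology \<alpha> F) euclidean f"
  shows "continuous_on UNIV (\<lambda>p. f (proj p))"
proof -
  have "continuous_map euclidean (sf_topology \<alpha> F) proj"
    by (rule quotient_imp_continuous_map[OF quotient_map_sf_proj])
  from continuous_map_compose[OF this cont] show ?thesis by (simp add: comp_def)
qed

text \<open>A vertical segment up to a Birkhoff sum of \<open>F\<close> passes through
  \<open>n\<close> fibres, so the integral is a Birkhoff sum of the fibre integral \<open>G\<close>.
  Since \<open>G\<close> is continuous and periodic, Weyl's theorem applies, and the mean of
  \<open>G\<close> is the mean of \<psi> times that of \<open>F\<close>.\<close>

lemma vertical_integral_le:
  fixes \<psi> :: "(real \<times> real) set \<Rightarrow> real"
  assumes cont: "continuous_on UNIV (\<lambda>p. \<psi> (proj p))" and nonneg: "\<And>z. \<psi> z \<ge> 0"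
    and meas: "\<psi> \<in> borel_measurable (sf_borel \<alpha> F)" and e: "e > 0"
  obtains n0 where "\<And>n x. n \<ge> n0 \<Longrightarrow> integral {0..birkhoff_sum \<alpha> F n x} (\<lambda>t. \<psi> (proj (x, t))) \<le>
     real n * ((LINT x|circle_measure. F x) * (LINT z|\<mu>. \<psi> z) + e)"
proof -
  obtain a b where ab: "0 < a" "\<And>x. a \<le> F x" "\<And>x. F x \<le> b" using F_bounds by blast
  define \<Psi> where "\<Psi> = (\<lambda>p. \<psi> (proj p))"
  have inv: "sf_invariant \<alpha> F \<Psi>" unfolding \<Psi>_def by (rule sf_invariant_comp_proj)
  have c\<Psi>: "continuous_on A \<Psi>" for A unfolding \<Psi>_def by (rule continuous_on_subset[OF cont]) simp
  have cv: "continuous_on A (\<lambda>t. \<Psi> (x, h t))" if "continuous_on A h" for A x and h :: "real \<Rightarrow> real"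
    by (rule continuous_on_compose2[OF c\<Psi>[of UNIV]]) (use that in \<open>auto intro!: continuous_intros\<close>)
  have iv: "(\<lambda>t. \<Psi> (x, t)) integrable_on {c..d}" for x c d
    by (intro integrable_continuous_interval cv continuous_on_id)
  define G where "G = (\<lambda>x. integral {0..F x} (\<lambda>t. \<Psi> (x, t)))"
  have sum_G: "integral {0..birkhoff_sum \<alpha> F n x} (\<lambda>t. \<Psi> (x, t)) = birkhoff_sum \<alpha> G n x" for n x
  proof (induction n)
    case (Suc n)
    let ?S = "birkhoff_sum \<alpha> F n x"
    have S: "0 \<le> ?S" using birkhoff_sum_ge[OF ab(2), of n x] ab(1) by (smt (verit) mult_nonneg_nonneg of_nat_0_le_iff)
    have F0: "0 \<le> F (x + real n * \<alpha>)" using pos_F by (rule less_imp_le)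
    have "integral {0..birkhoff_sum \<alpha> F (Suc n) x} (\<lambda>t. \<Psi> (x, t)) =
        integral {0..?S} (\<lambda>t. \<Psi> (x, t)) + integral {?S..?S + F (x + real n * \<alpha>)} (\<lambda>t. \<Psi> (x, t))"
      unfolding birkhoff_sum_Suc by (rule Henstock_Kurzweil_Integration.integral_combine[symmetric]) (use S F0 iv in auto)
    also have "integral {?S..?S + F (x + real n * \<alpha>)} (\<lambda>t. \<Psi> (x, t)) = integral {0 + ?S..F (x + real n * \<alpha>) + ?S} (\<lambda>t. \<Psi> (x, t))"
      by (simp add: add.commute)
    also have "\<dots> = integral {0..F (x + real n * \<alpha>)} ((\<lambda>t. \<Psi> (x, t)) \<circ> (+) ?S)"
      by (rule integral_shift_Icc_real[symmetric])
    also have "(\<lambda>t. \<Psi> (x, t)) \<circ> (+) ?S = (\<lambda>t. \<Psi> (x + real n * \<alpha>, t))"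
      using sf_invariant_iterate[OF inv, of x n] by (auto simp: fun_eq_iff) (metis add_diff_cancel_left')
    finally show ?case using Suc by (simp add: birkhoff_sum_Suc G_def)
  qed (simp add: birkhoff_sum_def)
  \<comment> \<open>Rescaling each fibre to [0, 1] fixes the limits of integration, and continuity
    of \<open>G\<close> becomes that of a parameter integral.\<close>
  have G_eq: "G x = F x * integral {0..1} (\<lambda>s. \<Psi> (x, F x * s))" for x
  proof -
    have "((\<lambda>t. \<Psi> (x, t)) has_integral G x) (cbox 0 (F x))"
      unfolding G_def using iv by (simp add: has_integral_integral[symmetric])
    from has_integral_affinity'[OF this pos_F[of x], where c = 0]
    have "((\<lambda>s. \<Psi> (x, F x * s)) has_integral (G x / F x)) {0..1}"
      using pos_F[of x] by (simp add: divide_inverse mult.commute)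
    then have "integral {0..1} (\<lambda>s. \<Psi> (x, F x * s)) = G x / F x" by (rule integral_unique)
    then show ?thesis using pos_F[of x] by simp
  qed
  have Gc: "continuous_on UNIV G"
  proof -
    have "continuous_on (UNIV \<times> cbox 0 1) (\<lambda>(x, s). \<Psi> (x, F x * s))"
      unfolding case_prod_unfold
      by (rule continuous_on_compose2[OF c\<Psi>[of UNIV]])
         (auto intro!: continuous_intros continuous_on_compose2[OF continuous_F])
    then have "continuous_on UNIV (\<lambda>x. integral (cbox 0 1) (\<lambda>s. \<Psi> (x, F x * s)))"
      by (rule integral_continuous_on_param)
    then have "continuous_on UNIV (\<lambda>x. F x * integral {0..1} (\<lambda>s. \<Psi> (x, F x * s)))"
      by (intro continuous_on_mult continuous_F) simp
    then show ?thesis by (simp add: G_eq[abs_def])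
  qed
  have Gper: "one_periodic G"
    using inv periodic_F by (simp add: one_periodic_def G_def sf_invariant_def)
  have G0: "G x \<ge> 0" for x
    unfolding G_def by (intro Henstock_Kurzweil_Integration.integral_nonneg iv) (simp add: \<Psi>_def nonneg)
  have [measurable]: "G \<in> borel_measurable borel" by (rule borel_measurable_continuous_onI[OF Gc])
  have [measurable]: "\<Psi> \<in> borel_measurable borel" by (rule borel_measurable_continuous_onI[OF c\<Psi>])
  have nnG: "(\<integral>\<^sup>+y. ennreal (\<Psi> (x, y)) * indicator {0..<F x} y \<partial>lborel) = ennreal (G x)" for x
  proof -
    have "AE y in lborel. y \<noteq> F x" by (rule AE_lborel_singleton)
    then have "AE y in lborel. ennreal (\<Psi> (x, y)) * indicator {0..<F x} y = ennreal (\<Psi> (x, y)) * indicator {0..F x} y"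
      by eventually_elim (auto simp: indicator_def)
    then have "(\<integral>\<^sup>+y. ennreal (\<Psi> (x, y)) * indicator {0..<F x} y \<partial>lborel) = (\<integral>\<^sup>+y. ennreal (\<Psi> (x, y)) * indicator {0..F x} y \<partial>lborel)"
      by (rule nn_integral_cong_AE)
    also have "\<dots> = (\<integral>\<^sup>+y. ennreal (\<Psi> (x, y) * indicator {0..F x} y) \<partial>lborel)"
      by (intro nn_integral_cong) (auto simp: indicator_def)
    also have "\<dots> = ennreal (G x)"
    proof (rule nn_integral_has_integral_lborel)
      have "(\<lambda>y. \<Psi> (x, y)) \<in> borel_measurable borel"
        by (intro borel_measurable_continuous_onI cv continuous_on_id)
      then show "(\<lambda>y. \<Psi> (x, y) * indicator {0..F x} y) \<in> borel_measurable borel" by measurable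
      have "((\<lambda>y. if y \<in> {0..F x} then \<Psi> (x, y) else 0) has_integral G x) UNIV"
        unfolding has_integral_restrict_UNIV G_def using iv by (rule integrable_integral)
      then show "((\<lambda>y. \<Psi> (x, y) * indicator {0..F x} y) has_integral G x) UNIV"
        by (rule has_integral_eq[rotated]) (auto simp: indicator_def)
    qed (simp add: \<Psi>_def nonneg)
    finally show ?thesis .
  qed
  obtain Bg where Bg: "\<And>x. \<bar>G x\<bar> \<le> Bg" using one_periodic_bounded[OF Gper Gc] by blast
  have iG: "integrable circle_measure G" by (rule integrable_circle_bounded[where B = Bg]) (use Bg in auto)
  have int_eq: "(LINT x|circle_measure. G x) = (LINT x|circle_measure. F x) * (LINT z|\<mu>. \<psi> z)"
  proof -
    define d where "d = (LINT x|circle_measure. F x)"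
    have d: "d > 0" "emeasure lborel D = ennreal d" using integral_F_pos emeasure_D by (auto simp: d_def)
    have "ennreal (LINT x|circle_measure. G x) = (\<integral>\<^sup>+x. ennreal (G x) \<partial>circle_measure)"
      by (rule nn_integral_eq_integral[symmetric]) (use iG G0 in auto)
    also have "\<dots> = (\<integral>\<^sup>+p. ennreal (\<Psi> p) * indicator D p \<partial>lborel)"
      by (subst nn_integral_D) (simp_all add: nnG)
    also have "\<dots> = ennreal d * ((\<integral>\<^sup>+p. ennreal (\<Psi> p) * indicator D p \<partial>lborel) / ennreal d)"
      unfolding ennreal_times_divide mult.commute[of "ennreal d"]
      using d by (simp add: mult_divide_eq_ennreal)
    also have "(\<integral>\<^sup>+p. ennreal (\<Psi> p) * indicator D p \<partial>lborel) / ennreal d = (\<integral>\<^sup>+p. ennreal (\<Psi> p) \<partial>uniform_measure lborel D)"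
      unfolding d(2)[symmetric] by (rule nn_integral_uniform_measure[symmetric]) auto
    also have "\<dots> = (\<integral>\<^sup>+z. ennreal (\<psi> z) \<partial>\<mu>)"
      unfolding sf_measure_def \<Psi>_def using meas by (subst nn_integral_distr) auto
    also have "\<dots> = ennreal (LINT z|\<mu>. \<psi> z)"
    proof (rule nn_integral_eq_integral)
      obtain B where B: "\<And>p. norm (\<psi> (proj p)) \<le> B" using proj_bounded[OF cont] by blast
      show "integrable \<mu> \<psi>"
        by (rule probability_preserving.integrable_bounded[OF probability_preserving_flow[of 0], where B = B])
           (use meas B in \<open>auto simp: space_sf_measure sf_space_eq\<close>)
    qed (simp add: nonneg)
    finally have "ennreal (LINT x|circle_measure. G x) = ennreal (d * (LINT z|\<mu>. \<psi> z))"
      using d by (simp add: ennreal_mult')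
    then show ?thesis
      by (subst (asm) ennreal_inj) (use d G0 nonneg in \<open>auto simp: d_def intro!: Bochner_Integration.integral_nonneg mult_nonneg_nonneg\<close>)
  qed
  obtain n0 where n0: "\<And>n x. n \<ge> n0 \<Longrightarrow> \<bar>birkhoff_sum \<alpha> G n x - real n * (LINT x|circle_measure. G x)\<bar> \<le> e * real n"
    using weyl_uniform[OF irrational Gper Gc e] by blast
  show thesis
  proof (rule that)
    fix n x assume "n \<ge> n0"
    from n0[OF this, of x] have "birkhoff_sum \<alpha> G n x \<le> real n * ((LINT x|circle_measure. G x) + e)"
      by (simp add: algebra_simps abs_if split: if_splits)
    then show "integral {0..birkhoff_sum \<alpha> F n x} (\<lambda>t. \<psi> (proj (x, t))) \<le>
     real n * ((LINT x|circle_measure. F x) * (LINT z|\<mu>. \<psi> z) + e)"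
      using sum_G[of n x] by (simp add: int_eq \<Psi>_def)
  qed
qed


text \<open>Since \<open>d\<close> is at most \<open>C\<close>, the segments starting at y + n C do
  not overlap.\<close>

lemma sum_vertical_integrals_le:
  fixes v :: "real \<Rightarrow> real"
  assumes v: "continuous_on UNIV v" "\<And>t. v t \<ge> 0" and d: "0 \<le> d" "d \<le> C"
  shows "(\<Sum>n<N. integral {0..d} (\<lambda>t. v (y + t + real n * C))) \<le> integral {y..y + real N * C} v"
proof (induction N)
  case (Suc N)
  have iv: "v integrable_on {a..b}" for a b
    by (intro integrable_continuous_interval continuous_on_subset[OF v(1)]) simp
  have C: "0 \<le> C" using d by simp
  have "integral {0..d} (\<lambda>t. v (y + t + real N * C)) = integral {0..d} (v \<circ> (+) (y + real N * C))"
    by (simp add: comp_def algebra_simps)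
  also have "\<dots> = integral {0 + (y + real N * C)..d + (y + real N * C)} v"
    by (rule integral_shift_Icc_real)
  also have "\<dots> \<le> integral {y + real N * C..y + real (Suc N) * C} v"
    by (rule integral_subset_le) (use d iv v(2) in \<open>auto simp: algebra_simps\<close>)
  finally have "(\<Sum>n<Suc N. integral {0..d} (\<lambda>t. v (y + t + real n * C))) \<le>
      integral {y..y + real N * C} v + integral {y + real N * C..y + real (Suc N) * C} v"
    using Suc by simp
  also have "\<dots> = integral {y..y + real (Suc N) * C} v"
    by (rule Henstock_Kurzweil_Integration.integral_combine) (use C iv in \<open>auto simp: algebra_simps\<close>)
  finally show ?case .
qed simp

text \<open>Unique ergodicity of the time-\<open>C\<close> map: averages of \<open>f\<close> are close to averages over a short
  flow interval, and flow orbits spend little time where the \<open>K\<close>-step averages deviate,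
  because those deviations are small in mean and the flow itself is controlled by Weyl's theorem.\<close>

lemma uniform_average:
  fixes f :: "(real \<times> real) set \<Rightarrow> complex"
  assumes cont: "continuous_map (sf_topology \<alpha> F) euclidean f" and C: "C > 0"
    and noco: "\<And>s. s \<noteq> 0 \<Longrightarrow> \<not> (\<exists>p::real \<Rightarrow> real. one_periodic p \<and> p \<in> borel_measurable borel \<and>
        (AE x in lborel. [s * F x = p (x + \<alpha>) - p x] (rmod 1)))"
    and e: "e > 0"
  shows "\<exists>N0. \<forall>N\<ge>N0. \<forall>x y. norm ((\<Sum>n<N. f (proj (x, y + real n * C))) - of_nat N * (LINT z|\<mu>. f z)) \<le> e * real N"
proof -
  interpret pp: probability_preserving \<mu> "sf_flow C"
    by (rule probability_preserving_flow) (use C in simp)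
  obtain a b where ab: "0 < a" "\<And>x. a \<le> F x" "\<And>x. F x \<le> b" using F_bounds by blast
  have b0: "b > 0" using ab(1) ab(2)[of 0] ab(3)[of 0] by linarith
  have fm [measurable]: "f \<in> borel_measurable (sf_borel \<alpha> F)" by (rule continuous_map_borel_measurable[OF cont])
  have fc: "continuous_on UNIV (\<lambda>p. f (proj p))" by (rule continuous_comp_proj[OF cont])
  define c where "c = (LINT z|\<mu>. f z)"
  define h where "h = (\<lambda>z. f z - c)"
  have hm [measurable]: "h \<in> borel_measurable (sf_borel \<alpha> F)" unfolding h_def by measurable
  have hm' [measurable]: "h \<in> borel_measurable \<mu>" using hm by simp
  have hc: "continuous_on UNIV (\<lambda>p. h (proj p))" unfolding h_def by (intro continuous_intros fc)
  obtain B where B: "\<And>p. norm (h (proj p)) \<le> B" using proj_bounded[OF hc] by blast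
  have B0: "B \<ge> 0" using B[of "(0,0)"] norm_ge_zero order_trans by blast
  have BX: "norm (h z) \<le> B" if "z \<in> space \<mu>" for z
    using that B by (auto simp: space_sf_measure sf_space_eq)
  have "integrable \<mu> h" by (rule pp.integrable_bounded[OF hm' BX])
  then have "integrable \<mu> (\<lambda>z. h z + c)" by (rule Bochner_Integration.integrable_add) simp
  then have fi: "integrable \<mu> f" by (simp add: h_def)
  have mean: "(LINT z|\<mu>. h z) = 0" unfolding h_def using fi by (simp add: c_def)
  have lim: "(\<lambda>n. pp.energy 0 n h / (real n)\<^sup>2) \<longlonglongrightarrow> 0"
  proof (rule pp.energy_tendsto_0[OF hm' BX mean])
    fix \<phi> assume *: "\<phi> \<in> borel_measurable \<mu>" "\<And>z. z \<in> space \<mu> \<Longrightarrow> norm (\<phi> z) \<le> B"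
      "\<And>z. z \<in> space \<mu> \<Longrightarrow> \<phi> (sf_flow C z) = ee 0 * \<phi> z" "(LINT z|\<mu>. \<phi> z) = 0"
    show "AE z in \<mu>. \<phi> z = 0" by (rule no_eigenfunction[OF C noco *])
  qed
  define d where "d = (LINT x|circle_measure. F x)"
  have d0: "d > 0" unfolding d_def by (rule integral_F_pos)
  \<comment> \<open>N * c1 bounds the number of fibres needed to cover a vertical segment of length
    N C that starts below the roof.\<close>
  define c1 where "c1 = (C + b) / a + 1"
  have c1: "c1 \<ge> 1" using C b0 ab(1) by (simp add: c1_def)
  obtain \<delta>0 where \<delta>0: "\<delta>0 > 0" "\<And>x y v. \<bar>v\<bar> \<le> \<delta>0 \<Longrightarrow> norm (h (proj (x, y + v)) - h (proj (x, y))) \<le> e / 4"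
    using proj_vertically_equicontinuous[OF hc, of "e / 4"] e by (metis zero_less_divide_iff zero_less_numeral)
  define \<delta> where "\<delta> = min \<delta>0 C"
  have \<delta>: "0 < \<delta>" "\<delta> \<le> C" "\<And>x y v. \<bar>v\<bar> \<le> \<delta> \<Longrightarrow> norm (h (proj (x, y + v)) - h (proj (x, y))) \<le> e / 4"
    using \<delta>0 C by (auto simp: \<delta>_def)
  \<comment> \<open>Makes 2 * c1 * \<eta> equal to \<delta> * e / 4, a quarter of the allowed error
    after division by \<delta>.\<close>
  define \<eta> where "\<eta> = e * \<delta> / (8 * c1)"
  have \<eta>: "\<eta> > 0" using e \<delta> c1 by (simp add: \<eta>_def)
  have "eventually (\<lambda>n. pp.energy 0 n h / (real n)\<^sup>2 < (\<eta> / d)\<^sup>2 \<and> n > 0) sequentially"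
    using lim \<eta> d0 by (intro eventually_conj order_tendstoD eventually_gt_at_top) auto
  then obtain K where K: "pp.energy 0 K h / (real K)\<^sup>2 < (\<eta> / d)\<^sup>2" "K > 0"
    by (auto simp: eventually_sequentially)
  define \<psi> where "\<psi> = (\<lambda>z. norm (pp.twisted_sum 0 K h z) / real K)"
  have tw: "pp.twisted_sum 0 n k (proj (x, y)) = (\<Sum>i<n. k (proj (x, y + real i * C)))" for n x y and k :: "(real \<times> real) set \<Rightarrow> complex"
    by (simp add: pp.twisted_sum_def sf_flow_iterate)
  have \<psi>m: "\<psi> \<in> borel_measurable (sf_borel \<alpha> F)"
  proof -
    have "\<psi> \<in> borel_measurable \<mu>" unfolding \<psi>_def by measurable
    then show ?thesis by simp
  qed
  have \<psi>c: "continuous_on UNIV (\<lambda>p. \<psi> (proj p))"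
  proof -
    have eq: "(\<lambda>p. \<psi> (proj p)) = (\<lambda>p. norm (\<Sum>i<K. h (proj (fst p, snd p + real i * C))) / real K)"
      by (rule ext) (metis \<psi>_def tw prod.collapse)
    show ?thesis
      unfolding eq using K(2) by (intro continuous_intros continuous_on_compose2[OF hc]) auto
  qed
  have \<psi>int: "d * (LINT z|\<mu>. \<psi> z) \<le> \<eta>"
  proof -
    have "(LINT z|\<mu>. norm (pp.twisted_sum 0 K h z))\<^sup>2 \<le> pp.energy 0 K h"
      unfolding pp.energy_def
      by (rule pp.L1_le_L2[where B = "real K * B"]) (use pp.norm_twisted_sum_le[OF BX] in auto)
    then have "((LINT z|\<mu>. norm (pp.twisted_sum 0 K h z)) / real K)\<^sup>2 \<le> pp.energy 0 K h / (real K)\<^sup>2"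
      unfolding power_divide by (rule divide_right_mono) simp
    also have "\<dots> \<le> (\<eta> / d)\<^sup>2" using K(1) by simp
    finally have "(LINT z|\<mu>. norm (pp.twisted_sum 0 K h z)) / real K \<le> \<eta> / d"
      by (rule power2_le_imp_le) (use \<eta> d0 in simp)
    then have "(LINT z|\<mu>. \<psi> z) \<le> \<eta> / d" by (simp add: \<psi>_def)
    then show ?thesis using d0 by (simp add: field_simps)
  qed
  obtain n0 where n0: "\<And>n x. n \<ge> n0 \<Longrightarrow> integral {0..birkhoff_sum \<alpha> F n x} (\<lambda>t. \<psi> (proj (x, t))) \<le> real n * (d * (LINT z|\<mu>. \<psi> z) + \<eta>)"
    using vertical_integral_le[OF \<psi>c _ \<psi>m \<eta>] unfolding d_def by (auto simp: \<psi>_def)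
  obtain N1 :: nat where N1: "real N1 > 8 * real K * B / e" using reals_Archimedean2 by blast
  show ?thesis
  proof (intro exI allI impI)
    fix N :: nat and x y :: real
    assume N: "N \<ge> Suc (max n0 N1)"
    obtain x' y' where r: "0 \<le> x'" "x' < 1" "0 \<le> y'" "y' < F x'" "\<And>t. proj (x, y + t) = proj (x', y' + t)"
      using representative by blast
    define S where "S = (\<lambda>t. \<Sum>n<N. h (proj (x', y' + t + real n * C)))"
    define v where "v = (\<lambda>t. \<psi> (proj (x', t)))"
    have vc: "continuous_on A v" for A
      unfolding v_def by (rule continuous_on_compose2[OF \<psi>c]) (auto intro!: continuous_intros)
    have v0: "v t \<ge> 0" for t by (simp add: v_def \<psi>_def)
    have vi: "v integrable_on {p..q}" for p q by (intro integrable_continuous_interval vc)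
    have vi': "(\<lambda>t. v (y' + t + real n * C)) integrable_on {p..q}" for n p q
      by (intro integrable_continuous_interval continuous_on_compose2[OF vc[of UNIV]] continuous_intros) auto
    define E where "E = 2 * real K * B + real N * (e / 4)"
    \<comment> \<open>\<open>S 0\<close> is first compared with \<open>S t\<close>, by
      equicontinuity, and then with sums of the K-step averages. As the left side is free of t,
      integrating over [0, \<delta>] turns the N sampled values of \<open>v\<close> into an integral
      along the flow.\<close>
    have S0: "norm (S 0) \<le> (\<Sum>n<N. v (y' + t + real n * C)) + E" if t: "t \<in> {0..\<delta>}" for t
    proof -
      have "norm (S t - S 0) \<le> (\<Sum>n<N. e / 4)"
        unfolding S_def sum_subtractf[symmetric]
      proof (rule sum_norm_le)
        fix n
        show "norm (h (proj (x', y' + t + real n * C)) - h (proj (x', y' + 0 + real n * C))) \<le> e / 4"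
          using \<delta>(3)[of t x' "y' + real n * C"] t by (simp add: algebra_simps)
      qed
      then have 1: "norm (S 0) \<le> norm (S t) + real N * (e / 4)"
        using norm_triangle_ineq2[of "S 0" "S t"] by (simp add: norm_minus_commute)
      have st: "S t = pp.twisted_sum 0 N h (proj (x', y' + t))" by (simp add: S_def tw)
      have "norm (pp.twisted_sum 0 N (pp.twisted_sum 0 K h) (proj (x', y' + t)) - of_nat K * S t) \<le> 2 * (real K)\<^sup>2 * B"
        unfolding st by (rule pp.twisted_sum_average[OF BX]) (auto simp: space_sf_measure sf_proj_in_space)
      then have "norm (of_nat K * S t) \<le> norm (pp.twisted_sum 0 N (pp.twisted_sum 0 K h) (proj (x', y' + t))) + 2 * (real K)\<^sup>2 * B"
        using norm_triangle_ineq2[of "of_nat K * S t" "pp.twisted_sum 0 N (pp.twisted_sum 0 K h) (proj (x', y' + t))"]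
        by (simp add: norm_minus_commute)
      also have "norm (pp.twisted_sum 0 N (pp.twisted_sum 0 K h) (proj (x', y' + t))) \<le> (\<Sum>n<N. real K * v (y' + t + real n * C))"
        unfolding tw[of N] by (rule sum_norm_le) (use K(2) in \<open>simp add: v_def \<psi>_def\<close>)
      finally have "real K * norm (S t) \<le> real K * ((\<Sum>n<N. v (y' + t + real n * C)) + 2 * real K * B)"
        by (simp add: norm_mult sum_distrib_left[symmetric] algebra_simps power2_eq_square)
      then have "norm (S t) \<le> (\<Sum>n<N. v (y' + t + real n * C)) + 2 * real K * B"
        using K(2) by (simp only: mult_le_cancel_left_pos of_nat_0_less_iff)
      then show ?thesis using 1 by (simp add: E_def)
    qed
    have "\<delta> * norm (S 0) = integral {0..\<delta>} (\<lambda>t. norm (S 0))" using \<delta>(1) by simp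
    also have "\<dots> \<le> integral {0..\<delta>} (\<lambda>t. (\<Sum>n<N. v (y' + t + real n * C)) + E)"
      by (rule integral_le) (use S0 vi' in \<open>auto intro!: integrable_add integrable_sum\<close>)
    also have "\<dots> = (\<Sum>n<N. integral {0..\<delta>} (\<lambda>t. v (y' + t + real n * C))) + \<delta> * E"
      using \<delta>(1) vi' by (subst Henstock_Kurzweil_Integration.integral_add) (auto intro!: integrable_sum simp: Henstock_Kurzweil_Integration.integral_sum)
    also have "(\<Sum>n<N. integral {0..\<delta>} (\<lambda>t. v (y' + t + real n * C))) \<le> integral {y'..y' + real N * C} v"
      by (rule sum_vertical_integrals_le[OF vc v0]) (use \<delta> in auto)
    also have "\<dots> \<le> real N * c1 * (2 * \<eta>)"
    proof -
      define n where "n = max n0 (nat \<lceil>(real N * C + b) / a\<rceil>)"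
      have "(real N * C + b) / a \<le> real n"
        unfolding n_def by linarith
      then have na: "real N * C + b \<le> real n * a" using ab(1) by (simp add: field_simps)
      have n_le: "real n \<le> real N * c1"
      proof -
        have "real n0 \<le> real N * 1" using N by simp
        also have "\<dots> \<le> real N * c1" using c1 by (intro mult_left_mono) auto
        finally have 1: "real n0 \<le> real N * c1" .
        have N1: "1 \<le> real N" using N by simp
        have "0 \<le> (real N * C + b) / a" using C b0 ab(1) by simp
        then have "real (nat \<lceil>(real N * C + b) / a\<rceil>) \<le> (real N * C + b) / a + 1"
          by linarith
        also have "\<dots> \<le> (real N * C + real N * b) / a + real N"
          using N1 ab(1) b0 mult_right_mono[of 1 "real N" b] by (intro add_mono divide_right_mono) auto
        also have "\<dots> = real N * c1" by (simp add: c1_def field_simps)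
        finally show ?thesis using 1 by (simp add: n_def)
      qed
      have "integral {y'..y' + real N * C} v \<le> integral {0..birkhoff_sum \<alpha> F n x'} v"
      proof (rule integral_subset_le)
        have "y' + real N * C \<le> birkhoff_sum \<alpha> F n x'"
          using birkhoff_sum_ge[OF ab(2), of n x'] na r(4) ab(3)[of x'] by linarith
        then show "{y'..y' + real N * C} \<subseteq> {0..birkhoff_sum \<alpha> F n x'}" using r(3) by auto
      qed (use vi v0 in auto)
      also have "\<dots> \<le> real n * (d * (LINT z|\<mu>. \<psi> z) + \<eta>)"
        unfolding v_def by (rule n0) (simp add: n_def)
      also have "\<dots> \<le> (real N * c1) * (2 * \<eta>)"
      proof (rule mult_mono[OF n_le])
        have "0 \<le> (LINT z|\<mu>. \<psi> z)"
          by (rule Bochner_Integration.integral_nonneg) (simp add: \<psi>_def)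
        then show "0 \<le> d * (LINT z|\<mu>. \<psi> z) + \<eta>" using d0 \<eta> by simp
        show "d * (LINT z|\<mu>. \<psi> z) + \<eta> \<le> 2 * \<eta>" using \<psi>int by simp
      qed (use c1 in simp)
      finally show ?thesis .
    qed
    finally have "\<delta> * norm (S 0) \<le> real N * c1 * (2 * \<eta>) + \<delta> * E" by simp
    also have "real N * c1 * (2 * \<eta>) = \<delta> * (real N * (e / 4))"
      using c1 by (simp add: \<eta>_def field_simps)
    also have "\<delta> * (real N * (e / 4)) + \<delta> * E = \<delta> * (real N * (e / 4) + E)" by (simp add: distrib_left)
    finally have "norm (S 0) \<le> real N * (e / 4) + E" using \<delta>(1) by (simp only: mult_le_cancel_left_pos)
    also have "\<dots> \<le> e * real N"
    proof -
      have "real N1 \<le> real N" using N by simp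
      then have "8 * real K * B / e < real N" using N1 by linarith
      then have "8 * real K * B < e * real N" using e by (simp add: field_simps)
      moreover have "0 \<le> e * real N" using e by simp
      ultimately show ?thesis by (simp add: E_def)
    qed
    also have "S 0 = (\<Sum>n<N. f (proj (x, y + real n * C))) - of_nat N * c"
      by (simp add: S_def r(5) h_def sum_subtractf)
    finally show "norm ((\<Sum>n<N. f (proj (x, y + real n * C))) - of_nat N * (LINT z|\<mu>. f z)) \<le> e * real N"
      by (simp add: c_def)
  qed
qed

end

section \<open>Rigidity and square orbits\<close>

lemma harm_le_one_plus_ln:
  assumes "n > 0"
  shows "harm n \<le> 1 + ln (real n)"
proof -
  have "harm n - ln (real n) \<le> harm 1 - ln (real 1)"
    by (rule euler_mascheroni_sequence_decreasing) (use assms in auto)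
  then show ?thesis by (simp add: harm_def)
qed

lemma filterlim_conv_denom:
  assumes "\<alpha> \<notin> \<rat>"
  shows "filterlim (\<lambda>n. real (conv_denom \<alpha> (Suc n))) at_top sequentially"
proof (rule filterlim_at_top_mono[OF filterlim_real_sequentially])
  show "\<forall>\<^sub>F n in sequentially. real n \<le> real (conv_denom \<alpha> (Suc n))"
    using conv_denom_ge[OF assms] by (intro always_eventually allI) (meson Suc_leD of_nat_le_iff)
qed

lemma sum_lessThan_add:
  fixes s :: "nat \<Rightarrow> 'a::comm_monoid_add"
  shows "(\<Sum>n<m + k. s n) = (\<Sum>n<m. s n) + (\<Sum>i<k. s (m + i))"
  by (induction k) (simp_all add: add.assoc)

lemma norm_sum_blocks_le:
  fixes s :: "nat \<Rightarrow> 'a::real_normed_vector"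
  assumes B: "\<And>n. norm (s n) \<le> B" and P: "P > 0"
    and block: "\<And>j. j * P \<le> N \<Longrightarrow> norm (\<Sum>k<P. s (j * P + k)) \<le> e * real P" and e: "e \<ge> 0"
  shows "norm (\<Sum>n<N. s n) \<le> e * real N + B * real P"
proof -
  have B0: "B \<ge> 0" using B[of 0] norm_ge_zero order_trans by blast
  define j r where "j = N div P" and "r = N mod P"
  have N: "N = j * P + r" and r: "r < P" using P by (auto simp: j_def r_def)
  have blocks: "norm (\<Sum>n<i * P. s n) \<le> e * real (i * P)" if "i \<le> j" for i
    using that
  proof (induction i)
    case (Suc i)
    have "(\<Sum>n<Suc i * P. s n) = (\<Sum>n<i * P. s n) + (\<Sum>k<P. s (i * P + k))"
      by (simp add: add.commute[of P] sum_lessThan_add)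
    also have "norm \<dots> \<le> e * real (i * P) + e * real P"
    proof (intro norm_triangle_le add_mono block)
      have "i * P \<le> j * P" using Suc.prems by (intro mult_right_mono) auto
      then show "i * P \<le> N" unfolding N by (rule trans_le_add1)
    qed (use Suc in auto)
    finally show ?case by (simp add: algebra_simps)
  qed simp
  have "(\<Sum>n<N. s n) = (\<Sum>n<j * P. s n) + (\<Sum>k<r. s (j * P + k))"
    unfolding N by (simp add: sum_lessThan_add)
  also have "norm \<dots> \<le> e * real (j * P) + (\<Sum>k<r. B)"
    by (intro norm_triangle_le add_mono blocks order_refl sum_norm_le B)
  also have "\<dots> \<le> e * real N + B * real P"
  proof (rule add_mono)
    show "e * real (j * P) \<le> e * real N" using e N by (intro mult_left_mono) auto
    show "(\<Sum>k<r. B) \<le> B * real P" using r B0 by (simp add: mult.commute mult_left_mono)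
  qed
  finally show ?thesis .
qed

locale rigid_flow = special_flow \<alpha> "\<lambda>x. g x + C" for \<alpha> C :: real and g :: "real \<Rightarrow> real" +
  assumes C_pos: "C > 0"
    and small: "(\<lambda>n. SUP x. \<bar>birkhoff_sum \<alpha> g (conv_denom \<alpha> n) x\<bar>)
                  \<in> o(\<lambda>n. real (conv_denom \<alpha> (Suc n)) powr (- 4 / 5))"
    and no_coboundary: "\<And>s. s \<noteq> 0 \<Longrightarrow> \<not> (\<exists>p::real \<Rightarrow> real. one_periodic p \<and> p \<in> borel_measurable borel \<and>
        (AE x in lborel. [s * (g x + C) = p (x + \<alpha>) - p x] (rmod 1)))"
begin

lemma proj_time_C: "proj (x, y + real m * C) = proj (x + real m * \<alpha>, y - birkhoff_sum \<alpha> g m x)"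
proof -
  have "birkhoff_sum \<alpha> (\<lambda>x. g x + C) m x = birkhoff_sum \<alpha> g m x + real m * C"
    by (simp add: birkhoff_sum_def sum.distrib)
  then show ?thesis
    using sf_invariant_iterate[OF proj_invariant, of x m "y + real m * C"] by simp
qed

lemma g_periodic: "one_periodic g" and g_continuous: "continuous_on UNIV g"
proof -
  show "one_periodic g" using periodic_F by (simp add: one_periodic_def)
  show "continuous_on UNIV g" using continuous_on_diff[OF continuous_F continuous_on_const[of _ C]] by simp
qed

lemma birkhoff_sum_le_SUP: "\<bar>birkhoff_sum \<alpha> g n x\<bar> \<le> (SUP x. \<bar>birkhoff_sum \<alpha> g n x\<bar>)"
proof (rule cSUP_upper)
  obtain B where B: "\<And>x. \<bar>g x\<bar> \<le> B" using one_periodic_bounded[OF g_periodic g_continuous] by blast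
  have "\<bar>birkhoff_sum \<alpha> g n x\<bar> \<le> (\<Sum>i<n. B)" for x
    unfolding birkhoff_sum_def by (rule order_trans[OF sum_abs sum_mono]) (rule B)
  then show "bdd_above (range (\<lambda>x. \<bar>birkhoff_sum \<alpha> g n x\<bar>))" by (rule bdd_aboveI2)
qed simp

lemma birkhoff_sum_mult_le:
  assumes "\<And>x. \<bar>birkhoff_sum \<alpha> g q x\<bar> \<le> s"
  shows "\<bar>birkhoff_sum \<alpha> g (i * q) x\<bar> \<le> real i * s"
proof (induction i)
  case (Suc i)
  have "birkhoff_sum \<alpha> g (Suc i * q) x = birkhoff_sum \<alpha> g (i * q) x + birkhoff_sum \<alpha> g q (x + real (i * q) * \<alpha>)"
    by (subst birkhoff_sum_add[symmetric]) (simp add: add.commute)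
  then have "\<bar>birkhoff_sum \<alpha> g (Suc i * q) x\<bar> \<le> real i * s + s"
    using Suc assms[of "x + real (i * q) * \<alpha>"] by linarith
  then show ?case by (simp add: algebra_simps)
qed (simp add: birkhoff_sum_def)

text \<open>In the skew product form the displacement is i (q \<alpha> - p) horizontally, of order
  Q^(-1/5), and i-fold that of S_q(g) vertically, which (ii) makes small. The point is first moved
  into the fundamental domain, where horizontal displacements are under control.\<close>

lemma rigidity:
  fixes f :: "(real \<times> real) set \<Rightarrow> 'b::real_normed_vector"
  assumes cont: "continuous_on UNIV (\<lambda>p. f (proj p))" and e: "e > 0" and R: "R > 0"
  shows "\<forall>\<^sub>F n in sequentially. \<forall>x y i. real i \<le> R * real (conv_denom \<alpha> (Suc n)) powr (4 / 5) \<longrightarrow>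
     norm (f (proj (x, y + real (i * conv_denom \<alpha> n) * C)) - f (proj (x, y))) \<le> e"
proof -
  obtain d where d: "d > 0" "\<And>x y u v. 0 \<le> x \<Longrightarrow> x < 1 \<Longrightarrow> 0 \<le> y \<Longrightarrow> y < g x + C \<Longrightarrow> \<bar>u\<bar> \<le> d \<Longrightarrow> \<bar>v\<bar> \<le> d \<Longrightarrow>
     norm (f (proj (x + u, y + v)) - f (proj (x, y))) \<le> e"
    using proj_uniformly_continuous[OF cont e] by blast
  have ev1: "\<forall>\<^sub>F n in sequentially. norm (SUP x. \<bar>birkhoff_sum \<alpha> g (conv_denom \<alpha> n) x\<bar>) \<le> (d / R) * norm (real (conv_denom \<alpha> (Suc n)) powr (- 4 / 5))"
    using d(1) R by (intro landau_o.smallD[OF small]) simp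
  have "((\<lambda>n. real (conv_denom \<alpha> (Suc n)) powr (- 1 / 5)) \<longlonglongrightarrow> 0)"
    by (rule tendsto_neg_powr[OF _ filterlim_conv_denom[OF irrational]]) simp
  then have ev2: "\<forall>\<^sub>F n in sequentially. real (conv_denom \<alpha> (Suc n)) powr (- 1 / 5) < d / R"
    using d(1) R by (intro order_tendstoD) auto
  show ?thesis
    using ev1 ev2
  proof eventually_elim
    case (elim n)
    define q where "q = conv_denom \<alpha> n"
    define Q where "Q = real (conv_denom \<alpha> (Suc n))"
    have Q: "Q \<ge> 1" using conv_denom_pos[OF irrational, of "Suc n"] by (simp add: Q_def)
    show ?case
    proof (intro allI impI)
      fix x y :: real and i :: nat
      assume i: "real i \<le> R * real (conv_denom \<alpha> (Suc n)) powr (4 / 5)"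
      then have iQ: "real i \<le> R * Q powr (4 / 5)" by (simp add: Q_def)
      obtain x' y' where r: "0 \<le> x'" "x' < 1" "0 \<le> y'" "y' < g x' + C" "\<And>t. proj (x, y + t) = proj (x', y' + t)"
        using representative by blast
      obtain p :: int where p: "\<bar>real q * \<alpha> - of_int p\<bar> \<le> 1 / Q"
        using conv_denom_approx[OF irrational, of n] by (auto simp: q_def Q_def)
      define u where "u = real i * (real q * \<alpha> - of_int p)"
      have "\<bar>u\<bar> \<le> (R * Q powr (4 / 5)) * (1 / Q)"
        unfolding u_def abs_mult using iQ p R by (intro mult_mono) auto
      also have "\<dots> = R * (Q powr (4 / 5) * Q powr (-1))"
        using Q by (simp add: powr_minus_divide)
      also have "Q powr (4 / 5) * Q powr (-1) = Q powr (- 1 / 5)"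
        unfolding powr_add[symmetric] by simp
      also have "R * Q powr (- 1 / 5) \<le> R * (d / R)" using elim(2) R by (intro mult_left_mono) (auto simp: Q_def)
      finally have u: "\<bar>u\<bar> \<le> d" using R by simp
      define v where "v = - birkhoff_sum \<alpha> g (i * q) x'"
      have "\<bar>birkhoff_sum \<alpha> g q z\<bar> \<le> (d / R) * Q powr (- 4 / 5)" for z
        using birkhoff_sum_le_SUP[of q z] elim(1) by (simp add: q_def Q_def)
      from birkhoff_sum_mult_le[OF this, of i x']
      have "\<bar>v\<bar> \<le> real i * ((d / R) * Q powr (- 4 / 5))" by (simp add: v_def)
      also have "\<dots> \<le> (R * Q powr (4 / 5)) * ((d / R) * Q powr (- 4 / 5))"
        using iQ d(1) R by (intro mult_right_mono) auto
      also have "\<dots> = d * (Q powr (4 / 5) * Q powr (- 4 / 5))" using R by simp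
      also have "\<dots> = d" using Q by (simp flip: powr_add)
      finally have v: "\<bar>v\<bar> \<le> d" .
      have "proj (x, y + real (i * q) * C) = proj (x' + real (i * q) * \<alpha>, y' + v)"
        unfolding v_def by (subst r(5), subst proj_time_C) simp
      also have "x' + real (i * q) * \<alpha> = (x' + u) + of_int (int i * p)"
        by (simp add: u_def algebra_simps)
      also have "proj ((x' + u) + of_int (int i * p), y' + v) = proj (x' + u, y' + v)"
        by (rule one_periodic_add_of_int[OF sf_invariant_one_periodic[OF proj_invariant]])
      finally have "f (proj (x, y + real (i * q) * C)) = f (proj (x' + u, y' + v))" by simp
      then show "norm (f (proj (x, y + real (i * conv_denom \<alpha> n) * C)) - f (proj (x, y))) \<le> e"
        using d(2)[OF r(1-4) u v] r(5)[of 0] by (simp add: q_def)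
    qed
  qed
qed


text \<open>The logarithm lost in the Weyl estimate against the power Q^(-1/5) that the block length
  leaves over.\<close>

lemma weyl_error_tendsto_0:
  "(\<lambda>n. K * (harm (conv_denom \<alpha> (Suc n)) * real (conv_denom \<alpha> (Suc n)) powr (- 1 / 5))) \<longlonglongrightarrow> 0"
proof -
  define Q where "Q = (\<lambda>n. real (conv_denom \<alpha> (Suc n)))"
  have Q1: "Q n \<ge> 1" for n using conv_denom_pos[OF irrational, of "Suc n"] by (simp add: Q_def)
  have fl: "filterlim Q at_top sequentially" unfolding Q_def by (rule filterlim_conv_denom[OF irrational])
  have 1: "(\<lambda>n. Q n powr (- 1 / 5)) \<longlonglongrightarrow> 0" by (rule tendsto_neg_powr[OF _ fl]) simp
  have fn: "filterlim (\<lambda>n. conv_denom \<alpha> (Suc n)) at_top sequentially"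
  proof (rule filterlim_at_top_mono[OF filterlim_ident])
    show "\<forall>\<^sub>F n in sequentially. n \<le> conv_denom \<alpha> (Suc n)"
      using conv_denom_ge[OF irrational] by (intro always_eventually allI) (meson Suc_leD)
  qed
  have 2: "(\<lambda>n. ln (Q n) / Q n powr (1 / 5)) \<longlonglongrightarrow> 0"
    unfolding Q_def by (rule filterlim_compose[OF lim_ln_over_power fn]) simp
  have 3: "(\<lambda>n. \<bar>K\<bar> * (Q n powr (- 1 / 5) + ln (Q n) / Q n powr (1 / 5))) \<longlonglongrightarrow> \<bar>K\<bar> * (0 + 0)"
    by (intro tendsto_intros 1 2)
  have "norm (K * (harm (conv_denom \<alpha> (Suc n)) * Q n powr (- 1 / 5))) \<le> \<bar>K\<bar> * (Q n powr (- 1 / 5) + ln (Q n) / Q n powr (1 / 5))" for n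
  proof -
    have h: "harm (conv_denom \<alpha> (Suc n)) \<le> 1 + ln (Q n)"
      unfolding Q_def by (rule harm_le_one_plus_ln) (use conv_denom_pos[OF irrational, of "Suc n"] in linarith)
    have "norm (K * (harm (conv_denom \<alpha> (Suc n)) * Q n powr (- 1 / 5))) = \<bar>K\<bar> * (harm (conv_denom \<alpha> (Suc n)) * Q n powr (- 1 / 5))"
      by (simp add: abs_mult harm_nonneg)
    also have "\<dots> \<le> \<bar>K\<bar> * ((1 + ln (Q n)) * Q n powr (- 1 / 5))"
      using h by (intro mult_left_mono mult_right_mono) auto
    also have "(1 + ln (Q n)) * Q n powr (- 1 / 5) = Q n powr (- 1 / 5) + ln (Q n) / Q n powr (1 / 5)"
      by (simp add: powr_minus_divide add_divide_distrib)
    finally show ?thesis .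
  qed
  then have ev: "\<forall>\<^sub>F n in sequentially. norm (K * (harm (conv_denom \<alpha> (Suc n)) * Q n powr (- 1 / 5))) \<le> \<bar>K\<bar> * (Q n powr (- 1 / 5) + ln (Q n) / Q n powr (1 / 5))"
    by (intro always_eventually allI)
  have "(\<lambda>n. K * (harm (conv_denom \<alpha> (Suc n)) * Q n powr (- 1 / 5))) \<longlonglongrightarrow> 0"
    by (rule Lim_null_comparison[OF ev]) (use 3 in simp)
  then show ?thesis by (simp only: Q_def)
qed

section \<open>Averages of a fixed continuous function along the squares\<close>

context
  fixes f :: "(real \<times> real) set \<Rightarrow> complex"
  assumes f: "continuous_map (sf_topology \<alpha> (\<lambda>x. g x + C)) euclidean f"
begin

definition mean :: complex where "mean = (LINT z|\<mu>. f z)"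

definition dev :: "real \<Rightarrow> real \<Rightarrow> nat \<Rightarrow> complex" where
  "dev x y n = f (proj (x, y + real (n\<^sup>2) * C)) - mean"

text \<open>The range on which \<open>rigidity\<close> applies, up to a constant factor; it serves
  both as the length of a block of squares and as the number of translates.\<close>

definition block_length :: "nat \<Rightarrow> nat" where
  "block_length n = nat \<lceil>real (conv_denom \<alpha> (Suc n)) powr (4 / 5)\<rceil>"

lemma block_length_bounds:
  fixes n :: nat
  defines "Q \<equiv> real (conv_denom \<alpha> (Suc n))"
  shows "Q powr (4 / 5) \<le> real (block_length n)" "real (block_length n) \<le> Q powr (4 / 5) + 1"
    "real (block_length n) \<le> 2 * Q powr (4 / 5)" "block_length n \<le> conv_denom \<alpha> (Suc n)" "block_length n > 0"
proof -
  have Q: "Q \<ge> 1" using conv_denom_pos[OF irrational, of "Suc n"] by (simp add: Q_def)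
  have p1: "1 \<le> Q powr (4 / 5)" using Q by (intro ge_one_powr_ge_zero) auto
  show a: "Q powr (4 / 5) \<le> real (block_length n)"
    unfolding block_length_def Q_def by linarith
  show b: "real (block_length n) \<le> Q powr (4 / 5) + 1"
    unfolding block_length_def Q_def[symmetric] using p1 by linarith
  show "real (block_length n) \<le> 2 * Q powr (4 / 5)" using b p1 by linarith
  have "Q powr (4 / 5) \<le> Q powr 1" using Q by (intro powr_mono) auto
  then have "Q powr (4 / 5) \<le> of_int (int (conv_denom \<alpha> (Suc n)))" using Q by (simp add: Q_def)
  then have "\<lceil>Q powr (4 / 5)\<rceil> \<le> int (conv_denom \<alpha> (Suc n))" by (simp only: ceiling_le_iff)
  then show "block_length n \<le> conv_denom \<alpha> (Suc n)"
    unfolding block_length_def Q_def[symmetric] nat_le_iff .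
  show "block_length n > 0" using a p1 by linarith
qed

text \<open>Along a block the orbit of squares depends, up to a small error, only on the residues modulo
  \<open>q\<^sub>n\<^sub>+\<^sub>1\<close>, and as a function of the residue it is nearly invariant under translation by \<open>q\<^sub>n\<close>.\<close>

lemma block_average:
  assumes e: "e > 0" and K: "K \<ge> 1"
  shows "\<forall>\<^sub>F n in sequentially. \<forall>x y M. M \<le> K * conv_denom \<alpha> (Suc n) \<longrightarrow>
    norm (\<Sum>k<block_length n. dev x y (M + k)) \<le> e * real (block_length n)"
proof -
  \<comment> \<open>Five errors: reduction of the squares modulo Q, two from the invariance under
    translation, the Weyl sum, and the average over a full residue system.\<close>
  define e1 where "e1 = e / 5"
  have e1: "e1 > 0" using e by (simp add: e1_def)
  have fc: "continuous_on UNIV (\<lambda>p. f (proj p))" by (rule continuous_comp_proj[OF f])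
  obtain B where B: "\<And>p. norm (f (proj p)) \<le> B" using proj_bounded[OF fc] by blast
  have B0: "B \<ge> 0" using B[of "(0,0)"] norm_ge_zero order_trans by blast
  \<comment> \<open>Twice 2 K + 1: the quotients by Q reach (2 K + 1) * P, and P is at most 2 *
    Q^(4/5).\<close>
  define R where "R = 4 * real K + 2"
  have R: "R \<ge> 6" using K by (simp add: R_def)
  obtain N0 where N0: "\<And>N x y. N \<ge> N0 \<Longrightarrow> norm ((\<Sum>n<N. f (proj (x, y + real n * C))) - of_nat N * mean) \<le> e1 * real N"
    using uniform_average[OF f C_pos no_coboundary e1] unfolding mean_def by blast
  have ev1: "\<forall>\<^sub>F n in sequentially. \<forall>x y i. real i \<le> R * real (conv_denom \<alpha> (Suc n)) powr (4 / 5) \<longrightarrow>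
     norm (f (proj (x, y + real (i * conv_denom \<alpha> n) * C)) - f (proj (x, y))) \<le> e1"
    by (rule rigidity[OF fc e1]) (use R in simp)
  \<comment> \<open>Rigidity one level up: multiples of Q are almost periods on the scale of the
    denominator that follows Q.\<close>
  then have ev2: "\<forall>\<^sub>F n in sequentially. \<forall>x y i. real i \<le> R * real (conv_denom \<alpha> (Suc (Suc n))) powr (4 / 5) \<longrightarrow>
     norm (f (proj (x, y + real (i * conv_denom \<alpha> (Suc n)) * C)) - f (proj (x, y))) \<le> e1"
    by (subst eventually_sequentially_Suc)
  have ev3: "\<forall>\<^sub>F n in sequentially. (B * sqrt 180) * (harm (conv_denom \<alpha> (Suc n)) * real (conv_denom \<alpha> (Suc n)) powr (- 1 / 5)) < e1"
    using weyl_error_tendsto_0 e1 by (rule order_tendstoD)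
  show ?thesis
    using ev1 ev2 ev3 eventually_ge_at_top[of N0]
  proof eventually_elim
    case (elim n)
    define q where "q = conv_denom \<alpha> n"
    define Q where "Q = conv_denom \<alpha> (Suc n)"
    define P where "P = block_length n"
    have q0: "q \<ge> 1" and Q0: "Q \<ge> 1" and qQ: "q \<le> Q"
      using conv_denom_pos[OF irrational] conv_denom_mono[OF irrational] by (auto simp: q_def Q_def)
    have QQ: "real Q powr (4 / 5) \<le> real (conv_denom \<alpha> (Suc (Suc n))) powr (4 / 5)"
      unfolding Q_def by (intro powr_mono2) (use conv_denom_mono[OF irrational, of "Suc n"] in \<open>simp_all del: conv_denom.simps\<close>)
    note P = block_length_bounds[of n, folded P_def Q_def]
    have Q_N0: "Q \<ge> N0"
      using conv_denom_ge[OF irrational, of "Suc n"] elim(4) unfolding Q_def by linarith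
    have rig1: "norm (f (proj (x, y + real (i * q) * C)) - f (proj (x, y))) \<le> e1" if "i \<le> P" for x y i
    proof -
      have "real i \<le> 2 * real Q powr (4 / 5)" using that P(3) by linarith
      also have "\<dots> \<le> R * real Q powr (4 / 5)" using R by (intro mult_right_mono) auto
      finally show ?thesis using elim(1) by (simp add: q_def Q_def)
    qed
    have rig2: "norm (f (proj (x, y + real (i * Q) * C)) - f (proj (x, y))) \<le> e1" if "i \<le> (2 * K + 1) * P" for x y i
    proof -
      have "real i \<le> real ((2 * K + 1) * P)" using that by (simp only: of_nat_le_iff)
      also have "\<dots> = (2 * real K + 1) * real P" by (simp add: algebra_simps)
      also have "\<dots> \<le> (2 * real K + 1) * (2 * real Q powr (4 / 5))" using P(3) by (intro mult_left_mono) auto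
      also have "\<dots> = R * real Q powr (4 / 5)" by (simp add: R_def algebra_simps)
      also have "\<dots> \<le> R * real (conv_denom \<alpha> (Suc (Suc n))) powr (4 / 5)"
        using QQ R by (intro mult_left_mono) auto
      finally show ?thesis using elim(2) by (simp add: Q_def)
    qed
    show ?case
    proof (intro allI impI)
      fix x y :: real and M :: nat
      assume "M \<le> K * conv_denom \<alpha> (Suc n)"
      then have M: "M \<le> K * Q" by (simp add: Q_def)
      define Y where "Y = y + real (M\<^sup>2) * C"
      define w where "w = (\<lambda>l::nat. f (proj (x, Y + real l * C)))"
      have wQ: "norm (w l - w (l mod Q)) \<le> e1" if "l div Q \<le> (2 * K + 1) * P" for l
      proof -
        have eq: "Y + real l * C = (Y + real (l mod Q) * C) + real ((l div Q) * Q) * C"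
          by (metis (no_types) add.assoc add.commute distrib_right mod_div_mult_eq of_nat_add)
        show ?thesis unfolding w_def eq by (rule rig2[OF that])
      qed
      \<comment> \<open>With the starting point moved to the time M^2, \<open>u\<close> at n^2 is
        the value after n^2 - M^2 further steps, reduced modulo Q.\<close>
      define u where "u = (\<lambda>m::int. w (nat ((m - int (M\<^sup>2)) mod int Q)))"
      have uper: "u (m mod int Q) = u m" for m by (simp add: u_def mod_diff_left_eq)
      have uB: "norm (u m) \<le> B" for m by (simp add: u_def w_def B)
      \<comment> \<open>One error is for adding j q before reduction (rigidity of q), the other for
        reducing the sum modulo Q (rigidity of Q).\<close>
      have uinv: "norm (u (m + i * int q) - u m) \<le> 2 * e1" if i: "0 \<le> i" "i < int P" for m i
      proof -
        define r where "r = nat ((m - int (M\<^sup>2)) mod int Q)"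
        define j where "j = nat i"
        have r: "r < Q" using Q0 by (simp add: r_def nat_less_iff)
        have jP: "j < P" "i = int j" using i by (auto simp: j_def)
        have "(m + i * int q - int (M\<^sup>2)) mod int Q = ((m - int (M\<^sup>2)) mod int Q + i * int q) mod int Q"
          unfolding mod_add_left_eq by (simp add: algebra_simps)
        also have "\<dots> = (int r + int j * int q) mod int Q" using Q0 jP by (simp add: r_def)
        also have "\<dots> = int ((r + j * q) mod Q)" by (simp add: zmod_int)
        finally have u1: "u (m + i * int q) = w ((r + j * q) mod Q)" by (simp add: u_def)
        have u2: "u m = w r" by (simp add: u_def r_def)
        have "(r + j * q) div Q \<le> (2 * K + 1) * P"
        proof -
          have "j * q \<le> j * Q" using qQ by simp
          then have "r + j * q < (j + 1) * Q" using r unfolding distrib_right by linarith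
          then have "(r + j * q) div Q < j + 1" by (rule less_mult_imp_div_less)
          then have "(r + j * q) div Q \<le> P" using jP by simp
          also have "P \<le> (2 * K + 1) * P" by simp
          finally show ?thesis .
        qed
        from wQ[OF this] have 1: "norm (w ((r + j * q) mod Q) - w (r + j * q)) \<le> e1" by (simp add: norm_minus_commute)
        have 2: "norm (w (r + j * q) - w r) \<le> e1"
          using rig1[of j x "Y + real r * C"] jP by (simp add: w_def algebra_simps)
        have "norm ((w ((r + j * q) mod Q) - w (r + j * q)) + (w (r + j * q) - w r)) \<le> e1 + e1"
          by (intro norm_triangle_le add_mono 1 2)
        then show ?thesis unfolding u1 u2 by simp
      qed
      have cop: "coprime (int q) (int Q)" using coprime_conv_denom[of \<alpha> n] by (simp add: q_def Q_def)
      define W where "W = (\<Sum>k\<in>{0..<int Q}. u k)"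
      have main: "norm ((\<Sum>n\<in>{int M..<int M + int P}. u (n\<^sup>2)) - of_int (int P) / of_int (int Q) * W)
         \<le> of_int (int P) * (2 * e1) + B * (harm (nat (int Q)) * of_int (int Q) * sqrt (160 * of_int (int P) + 20 * of_int (int P))) / of_int (int P)"
        unfolding W_def
        by (rule square_sum_almost_invariant[where u = u and q = "int q", OF _ cop _ _ _ uper uB uinv])
           (use Q0 P in auto)
      have W_eq: "W = (\<Sum>r<Q. w r)"
      proof -
        have "W = (\<Sum>r\<in>{0..<int Q}. w (nat r))"
          unfolding W_def u_def
        proof (rule sum.reindex_bij_witness[of _ "\<lambda>r. (r + int (M\<^sup>2)) mod int Q" "\<lambda>k. (k - int (M\<^sup>2)) mod int Q"])
          fix k assume "k \<in> {0..<int Q}"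
          then show "((k - int (M\<^sup>2)) mod int Q + int (M\<^sup>2)) mod int Q = k" by (simp add: mod_add_left_eq)
        next
          fix k assume "k \<in> {0..<int Q}"
          then show "((k + int (M\<^sup>2)) mod int Q - int (M\<^sup>2)) mod int Q = k" by (simp add: mod_diff_left_eq)
        qed (use Q0 in auto)
        also have "\<dots> = (\<Sum>r<Q. w r)"
          by (rule sum.reindex_bij_witness[of _ int nat]) auto
        finally show ?thesis .
      qed
      have W_mean: "norm (W - of_nat Q * mean) \<le> e1 * real Q"
        unfolding W_eq w_def by (rule N0[OF Q_N0])
      have sq: "norm ((\<Sum>k<P. f (proj (x, y + real ((M + k)\<^sup>2) * C))) - (\<Sum>n\<in>{int M..<int M + int P}. u (n\<^sup>2))) \<le> real P * e1"
      proof -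
        have "(\<Sum>n\<in>{int M..<int M + int P}. u (n\<^sup>2)) = (\<Sum>k<P. u ((int M + int k)\<^sup>2))"
          by (rule sum.reindex_bij_witness[of _ "\<lambda>k. int M + int k" "\<lambda>n. nat (n - int M)"]) auto
        then have "(\<Sum>k<P. f (proj (x, y + real ((M + k)\<^sup>2) * C))) - (\<Sum>n\<in>{int M..<int M + int P}. u (n\<^sup>2)) =
           (\<Sum>k<P. f (proj (x, y + real ((M + k)\<^sup>2) * C)) - u ((int M + int k)\<^sup>2))"
          by (simp add: sum_subtractf)
        also have "norm \<dots> \<le> (\<Sum>k<P. e1)"
        proof (rule sum_norm_le)
          fix k assume "k \<in> {..<P}"
          then have k: "k < P" by simp
          define l where "l = 2 * M * k + k\<^sup>2"
          have l: "(M + k)\<^sup>2 = M\<^sup>2 + l" by (simp add: l_def power2_eq_square algebra_simps)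
          have 1: "f (proj (x, y + real ((M + k)\<^sup>2) * C)) = w l"
            unfolding l w_def Y_def by (simp add: algebra_simps)
          have "(int M + int k)\<^sup>2 - int (M\<^sup>2) = int l" using l by (metis add_diff_cancel_left' of_nat_add of_nat_power)
          then have 2: "u ((int M + int k)\<^sup>2) = w (l mod Q)" by (simp add: u_def zmod_int[symmetric])
          \<comment> \<open>The cross term 2 M k is at most 2 K Q P because M is O(Q), and k^2 is at
            most P Q because P does not exceed Q.\<close>
          have "l \<le> ((2 * K + 1) * P) * Q"
          proof -
            have "2 * M * k \<le> 2 * (K * Q) * P" using M k by (intro mult_mono) auto
            moreover have "k\<^sup>2 \<le> P * Q" unfolding power2_eq_square using k P(4) by (intro mult_mono) auto
            ultimately show ?thesis by (simp add: l_def algebra_simps)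
          qed
          then have "l div Q \<le> ((2 * K + 1) * P) * Q div Q" by (rule div_le_mono)
          then have "l div Q \<le> (2 * K + 1) * P" using Q0 by simp
          then show "norm (f (proj (x, y + real ((M + k)\<^sup>2) * C)) - u ((int M + int k)\<^sup>2)) \<le> e1"
            unfolding 1 2 by (rule wQ)
        qed
        finally show ?thesis by simp
      qed
      have err: "B * (harm (nat (int Q)) * of_int (int Q) * sqrt (160 * of_int (int P) + 20 * of_int (int P))) / of_int (int P) \<le> e1 * real P"
      proof -
        have P0: "real P > 0" using P(5) by simp
        have Qr: "real Q > 0" using Q0 by simp
        have "real Q * (real P * real Q powr (2 / 5)) \<le> real P * real P * (sqrt (real P) * real Q powr (- 1 / 5) * real Q powr (2 / 5))"
        proof -
          have a: "real Q powr (2 / 5) \<le> sqrt (real P)"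
          proof (rule real_le_rsqrt)
            have "(real Q powr (2 / 5))\<^sup>2 = real Q powr (4 / 5)" using Qr by (simp add: power2_eq_square flip: powr_add)
            then show "(real Q powr (2 / 5))\<^sup>2 \<le> real P" using P(1) by simp
          qed
          \<comment> \<open>The exponents add up to 1; the first two powers are bounded by
            \<open>P\<close> and by its square root, and the third is the gain.\<close>
          have "real Q = real Q powr (4 / 5) * real Q powr (2 / 5) * real Q powr (- 1 / 5)"
            using Qr by (simp flip: powr_add)
          also have "\<dots> \<le> real P * sqrt (real P) * real Q powr (- 1 / 5)"
            using P(1) a by (intro mult_right_mono mult_mono) auto
          finally have "real Q * (real P * real Q powr (2 / 5)) \<le> (real P * sqrt (real P) * real Q powr (- 1 / 5)) * (real P * real Q powr (2 / 5))"
            by (intro mult_right_mono) auto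
          then show ?thesis by (simp add: mult_ac)
        qed
        then have key: "real Q \<le> real P * sqrt (real P) * real Q powr (- 1 / 5)"
          using P0 Qr by (simp add: mult_ac)
        have s: "sqrt (160 * real P + 20 * real P) = sqrt 180 * sqrt (real P)"
          by (simp add: real_sqrt_mult[symmetric])
        have "B * (harm Q * real Q * sqrt (160 * real P + 20 * real P)) \<le>
          B * (harm Q * (real P * sqrt (real P) * real Q powr (- 1 / 5)) * (sqrt 180 * sqrt (real P)))"
          unfolding s using key B0 by (intro mult_left_mono mult_right_mono) (auto simp: harm_nonneg)
        also have "\<dots> = (B * sqrt 180 * (harm Q * real Q powr (- 1 / 5))) * real P * (sqrt (real P) * sqrt (real P))"
          by (simp only: mult_ac)
        also have "\<dots> = (B * sqrt 180 * (harm Q * real Q powr (- 1 / 5))) * (real P * real P)"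
          using P0 by simp
        also have "\<dots> \<le> e1 * (real P * real P)"
          using elim(3) by (intro mult_right_mono) (auto simp: Q_def)
        finally show ?thesis using P0 by (simp add: field_simps)
      qed
      have "(\<Sum>k<P. dev x y (M + k)) = ((\<Sum>k<P. f (proj (x, y + real ((M + k)\<^sup>2) * C))) - (\<Sum>n\<in>{int M..<int M + int P}. u (n\<^sup>2)))
         + (((\<Sum>n\<in>{int M..<int M + int P}. u (n\<^sup>2)) - of_int (int P) / of_int (int Q) * W)
         + of_nat P / of_nat Q * (W - of_nat Q * mean))"
        using Q0 by (simp add: dev_def sum_subtractf right_diff_distrib)
      also have "norm \<dots> \<le> real P * e1 + ((real P * (2 * e1) + e1 * real P) + real P * e1)"
      proof (intro norm_triangle_le add_mono sq)
        show "norm ((\<Sum>n\<in>{int M..<int M + int P}. u (n\<^sup>2)) - of_int (int P) / of_int (int Q) * W) \<le> real P * (2 * e1) + e1 * real P"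
          using main err unfolding of_int_of_nat_eq by linarith
        have "norm (of_nat P / of_nat Q * (W - of_nat Q * mean)) = real P / real Q * norm (W - of_nat Q * mean)"
          by (simp add: norm_mult norm_divide)
        also have "\<dots> \<le> real P / real Q * (e1 * real Q)" using W_mean by (intro mult_left_mono) auto
        also have "\<dots> = real P * e1" using Q0 by simp
        finally show "norm (of_nat P / of_nat Q * (W - of_nat Q * mean)) \<le> real P * e1" .
      qed
      also have "\<dots> = e * real P" by (simp add: e1_def)
      finally show "norm (\<Sum>k<block_length n. dev x y (M + k)) \<le> e * real (block_length n)"
        by (simp add: P_def)
    qed
  qed
qed


lemma dev_bounded:
  obtains B where "B > 0" "\<And>x y n. norm (dev x y n) \<le> B"
proof -
  obtain B where B: "\<And>p. norm (f (proj p)) \<le> B" using proj_bounded[OF continuous_comp_proj[OF f]] by blast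
  have "norm (dev x y n) \<le> \<bar>B\<bar> + norm mean + 1" for x y n
    unfolding dev_def using norm_triangle_ineq4[of "f (proj (x, y + real (n\<^sup>2) * C))" mean] B[of "(x, y + real (n\<^sup>2) * C)"] by linarith
  moreover have "\<bar>B\<bar> + norm mean + 1 > 0" by (simp add: add_nonneg_pos)
  ultimately show thesis using that by blast
qed

text \<open>Blocks starting below Q tile the first Q squares; the incomplete last one has relative
  size Q^(-1/5). The statement is proved for the denominator of index n + 1 and then
  reindexed.\<close>

lemma initial_average:
  assumes e: "e > 0"
  shows "\<forall>\<^sub>F n in sequentially. \<forall>x y. norm (\<Sum>k<conv_denom \<alpha> n. dev x y k) \<le> e * real (conv_denom \<alpha> n)"
proof -
  obtain B where B: "B > 0" "\<And>x y n. norm (dev x y n) \<le> B" using dev_bounded by blast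
  have ev1: "\<forall>\<^sub>F n in sequentially. \<forall>x y M. M \<le> 1 * conv_denom \<alpha> (Suc n) \<longrightarrow>
    norm (\<Sum>k<block_length n. dev x y (M + k)) \<le> (e / 2) * real (block_length n)"
    by (rule block_average) (use e in auto)
  have "(\<lambda>n. 2 * B * real (conv_denom \<alpha> (Suc n)) powr (- 1 / 5)) \<longlonglongrightarrow> 2 * B * 0"
    by (intro tendsto_intros tendsto_neg_powr[OF _ filterlim_conv_denom[OF irrational]]) simp
  then have ev2: "\<forall>\<^sub>F n in sequentially. 2 * B * real (conv_denom \<alpha> (Suc n)) powr (- 1 / 5) < e / 2"
    using e by (intro order_tendstoD) auto
  have "\<forall>\<^sub>F n in sequentially. \<forall>x y. norm (\<Sum>k<conv_denom \<alpha> (Suc n). dev x y k) \<le> e * real (conv_denom \<alpha> (Suc n))"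
    using ev1 ev2
  proof eventually_elim
    case (elim n)
    define Q where "Q = conv_denom \<alpha> (Suc n)"
    have Q0: "real Q > 0" using conv_denom_pos[OF irrational, of "Suc n"] by (simp add: Q_def)
    note P = block_length_bounds[of n, folded Q_def]
    have "B * real (block_length n) \<le> B * (2 * real Q powr (4 / 5))" using P(3) B(1) by (intro mult_left_mono) auto
    also have "real Q powr (4 / 5) = real Q powr (- 1 / 5) * real Q"
    proof -
      have "real Q powr (- 1 / 5) * real Q powr 1 = real Q powr (4 / 5)" unfolding powr_add[symmetric] by simp
      then show ?thesis using Q0 by simp
    qed
    also have "B * (2 * (real Q powr (- 1 / 5) * real Q)) = (2 * B * real Q powr (- 1 / 5)) * real Q" by simp
    also have "\<dots> \<le> e / 2 * real Q" using elim(2) by (intro mult_right_mono) (auto simp: Q_def)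
    finally have err: "B * real (block_length n) \<le> e / 2 * real Q" .
    show ?case
    proof (intro allI)
      fix x y
      have "norm (\<Sum>k<Q. dev x y k) \<le> e / 2 * real Q + B * real (block_length n)"
        by (rule norm_sum_blocks_le[OF B(2) P(5)]) (use elim(1) e in \<open>auto simp: Q_def\<close>)
      also have "\<dots> \<le> e * real Q" using err by simp
      finally show "norm (\<Sum>k<conv_denom \<alpha> (Suc n). dev x y k) \<le> e * real (conv_denom \<alpha> (Suc n))"
        by (simp only: Q_def)
    qed
  qed
  then show ?thesis by (subst (asm) eventually_sequentially_Suc)
qed

text \<open>Write \<open>m = j q\<^sub>n + k\<close>. As long as \<open>m\<close> is at most a multiple of \<open>q\<^sub>n\<^sub>+\<^sub>1\<^sup>4\<^sup>/\<^sup>5\<close>, the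
  cross term \<open>2 j k q\<^sub>n\<close> of the square is harmless by rigidity.\<close>

lemma short_range_average:
  assumes e: "e > 0" and R: "R > 0"
  shows "\<forall>\<^sub>F n in sequentially. \<forall>x y j. real (j * conv_denom \<alpha> n) \<le> R * real (conv_denom \<alpha> (Suc n)) powr (4 / 5) \<longrightarrow>
    norm (\<Sum>k<conv_denom \<alpha> n. dev x y (j * conv_denom \<alpha> n + k)) \<le> e * real (conv_denom \<alpha> n)"
proof -
  \<comment> \<open>The factor 2 comes from the cross term: 2 j k is at most 2 j q.\<close>
  have ev1: "\<forall>\<^sub>F n in sequentially. \<forall>x y i. real i \<le> (2 * R) * real (conv_denom \<alpha> (Suc n)) powr (4 / 5) \<longrightarrow>
     norm (f (proj (x, y + real (i * conv_denom \<alpha> n) * C)) - f (proj (x, y))) \<le> e / 2"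
    by (rule rigidity[OF continuous_comp_proj[OF f]]) (use e R in auto)
  have ev2: "\<forall>\<^sub>F n in sequentially. \<forall>x y. norm (\<Sum>k<conv_denom \<alpha> n. dev x y k) \<le> (e / 2) * real (conv_denom \<alpha> n)"
    by (rule initial_average) (use e in simp)
  show ?thesis
    using ev1 ev2
  proof eventually_elim
    case (elim n)
    define q where "q = conv_denom \<alpha> n"
    show ?case
    proof (intro allI impI)
      fix x y :: real and j :: nat
      assume j: "real (j * conv_denom \<alpha> n) \<le> R * real (conv_denom \<alpha> (Suc n)) powr (4 / 5)"
      \<comment> \<open>In (j q + k)^2 the term (j q)^2 only moves the starting point, in which
        \<open>initial_average\<close> is uniform; k^2 remains, and 2 j k q is removed by
        rigidity.\<close>
      define Y where "Y = y + real ((j * q)\<^sup>2) * C"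
      have "norm ((\<Sum>k<q. dev x y (j * q + k)) - (\<Sum>k<q. dev x Y k)) \<le> (\<Sum>k<q. e / 2)"
        unfolding sum_subtractf[symmetric]
      proof (rule sum_norm_le)
        fix k assume "k \<in> {..<q}"
        then have "j * k \<le> j * q" by simp
        then have "real (j * k) \<le> real (j * q)" by (simp only: of_nat_le_iff)
        then have i: "real (2 * j * k) \<le> (2 * R) * real (conv_denom \<alpha> (Suc n)) powr (4 / 5)"
          using j unfolding q_def by (simp add: mult.assoc)
        have sq: "(j * q + k)\<^sup>2 = (j * q)\<^sup>2 + k\<^sup>2 + (2 * j * k) * q"
          by (simp add: power2_eq_square algebra_simps)
        have eq: "y + real ((j * q + k)\<^sup>2) * C = (Y + real (k\<^sup>2) * C) + real ((2 * j * k) * q) * C"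
          unfolding sq Y_def of_nat_add by (simp only: distrib_right add.assoc)
        have "dev x y (j * q + k) - dev x Y k = f (proj (x, (Y + real (k\<^sup>2) * C) + real ((2 * j * k) * q) * C)) - f (proj (x, Y + real (k\<^sup>2) * C))"
          unfolding dev_def eq by simp
        then show "norm (dev x y (j * q + k) - dev x Y k) \<le> e / 2"
          using elim(1) i unfolding q_def by metis
      qed
      moreover have "norm (\<Sum>k<q. dev x Y k) \<le> e / 2 * real q" using elim(2) by (simp add: q_def)
      ultimately have "norm (\<Sum>k<q. dev x y (j * q + k)) \<le> e / 2 * real q + e / 2 * real q"
        using norm_triangle_ineq2[of "\<Sum>k<q. dev x y (j * q + k)" "\<Sum>k<q. dev x Y k"] by (simp add: mult.commute)
      then show "norm (\<Sum>k<conv_denom \<alpha> n. dev x y (j * conv_denom \<alpha> n + k)) \<le> e * real (conv_denom \<alpha> n)"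
        by (simp add: q_def)
    qed
  qed
qed

text \<open>Choose n so that N lies between K times two consecutive denominators q and Q. Up to R *
  Q^(4/5) use blocks of length q, beyond it blocks of length about Q^(4/5).\<close>

lemma square_average:
  assumes e: "e > 0"
  shows "\<forall>\<^sub>F N in sequentially. \<forall>x y. norm (\<Sum>n<N. dev x y n) \<le> e * real N"
proof -
  obtain B where B: "B > 0" "\<And>x y n. norm (dev x y n) \<le> B" using dev_bounded by blast
  \<comment> \<open>\<open>K\<close> and \<open>R\<close> make the incomplete block cost at most e N
    / 2: B q is at most B N / K in the first range, and 2 B Q^(4/5) equals (e / 2) * R * Q^(4/5) in
    the second.\<close>
  obtain K :: nat where K: "real K > 2 * B / e" using reals_Archimedean2 by blast
  have "0 < 2 * B / e" using B e by simp
  then have K1: "K \<ge> 1" using K by linarith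
  define R where "R = 4 * B / e"
  have R: "R > 0" using B e by (simp add: R_def)
  have ev1: "\<forall>\<^sub>F n in sequentially. \<forall>x y j. real (j * conv_denom \<alpha> n) \<le> R * real (conv_denom \<alpha> (Suc n)) powr (4 / 5) \<longrightarrow>
    norm (\<Sum>k<conv_denom \<alpha> n. dev x y (j * conv_denom \<alpha> n + k)) \<le> (e / 2) * real (conv_denom \<alpha> n)"
    by (rule short_range_average) (use e R in auto)
  have ev2: "\<forall>\<^sub>F n in sequentially. \<forall>x y M. M \<le> K * conv_denom \<alpha> (Suc n) \<longrightarrow>
    norm (\<Sum>k<block_length n. dev x y (M + k)) \<le> (e / 2) * real (block_length n)"
    by (rule block_average) (use e K1 in auto)
  obtain n0 where n0: "\<And>n x y j. n \<ge> n0 \<Longrightarrow> real (j * conv_denom \<alpha> n) \<le> R * real (conv_denom \<alpha> (Suc n)) powr (4 / 5) \<Longrightarrow>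
      norm (\<Sum>k<conv_denom \<alpha> n. dev x y (j * conv_denom \<alpha> n + k)) \<le> (e / 2) * real (conv_denom \<alpha> n)"
    and n0': "\<And>n x y M. n \<ge> n0 \<Longrightarrow> M \<le> K * conv_denom \<alpha> (Suc n) \<Longrightarrow>
      norm (\<Sum>k<block_length n. dev x y (M + k)) \<le> (e / 2) * real (block_length n)"
    using eventually_conj[OF ev1 ev2] unfolding eventually_sequentially by blast
  show ?thesis
    using eventually_ge_at_top[of "K * conv_denom \<alpha> n0"]
  proof eventually_elim
    case (elim N)
    have "\<exists>m. N < K * conv_denom \<alpha> m"
    proof
      have "Suc N \<le> conv_denom \<alpha> (Suc N)" by (rule conv_denom_ge[OF irrational])
      also have "\<dots> \<le> K * conv_denom \<alpha> (Suc N)" using K1 by simp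
      finally show "N < K * conv_denom \<alpha> (Suc N)" by simp
    qed
    then obtain m where m: "N < K * conv_denom \<alpha> m" "\<And>i. i < m \<Longrightarrow> \<not> N < K * conv_denom \<alpha> i"
      using exists_least_iff[of "\<lambda>m. N < K * conv_denom \<alpha> m"] by blast
    have mono: "conv_denom \<alpha> i \<le> conv_denom \<alpha> j" if "i \<le> j" for i j
      by (rule lift_Suc_mono_le[of "conv_denom \<alpha>", OF conv_denom_mono[OF irrational] that])
    have "m > n0"
    proof (rule ccontr)
      assume "\<not> m > n0"
      then have "K * conv_denom \<alpha> m \<le> K * conv_denom \<alpha> n0" by (intro mult_left_mono mono) auto
      then show False using m(1) elim by linarith
    qed
    then obtain n where n: "m = Suc n" "n \<ge> n0" by (cases m) auto
    have lo: "K * conv_denom \<alpha> n \<le> N" using m(2)[of n] n by simp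
    have hi: "N \<le> K * conv_denom \<alpha> (Suc n)" using m(1) n by simp
    define q where "q = conv_denom \<alpha> n"
    define Q where "Q = conv_denom \<alpha> (Suc n)"
    note P = block_length_bounds[of n, folded Q_def]
    show ?case
    proof (intro allI)
      fix x y
      show "norm (\<Sum>n<N. dev x y n) \<le> e * real N"
      proof (cases "real N \<le> R * real Q powr (4 / 5)")
        case True
        have "norm (\<Sum>n<N. dev x y n) \<le> e / 2 * real N + B * real q"
        proof (rule norm_sum_blocks_le[OF B(2)])
          show "q > 0" using conv_denom_pos[OF irrational, of n] by (simp add: q_def)
          fix j assume "j * q \<le> N"
          then have "real (j * q) \<le> R * real Q powr (4 / 5)" using True by (meson of_nat_le_iff order_trans)
          then show "norm (\<Sum>k<q. dev x y (j * q + k)) \<le> e / 2 * real q"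
            unfolding q_def Q_def by (rule n0[OF n(2)])
        qed (use e in simp)
        also have "B * real q \<le> e / 2 * real N"
        proof -
          have "2 * B \<le> real K * e" using K e by (simp add: field_simps)
          then have "2 * B * real q \<le> real K * e * real q" by (intro mult_right_mono) auto
          also have "\<dots> = e * real (K * q)" by simp
          also have "\<dots> \<le> e * real N" using lo e unfolding q_def by (intro mult_left_mono) (simp_all only: of_nat_le_iff)
          finally show ?thesis by simp
        qed
        finally show ?thesis by simp
      next
        case False
        have "norm (\<Sum>n<N. dev x y n) \<le> e / 2 * real N + B * real (block_length n)"
        proof (rule norm_sum_blocks_le[OF B(2) P(5)])
          fix j assume "j * block_length n \<le> N"
          then have "j * block_length n \<le> K * conv_denom \<alpha> (Suc n)" using hi by simp
          then show "norm (\<Sum>k<block_length n. dev x y (j * block_length n + k)) \<le> e / 2 * real (block_length n)"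
            by (rule n0'[OF n(2)])
        qed (use e in simp)
        also have "B * real (block_length n) \<le> e / 2 * real N"
        proof -
          have "B * real (block_length n) \<le> B * (2 * real Q powr (4 / 5))" using P(3) B(1) by (intro mult_left_mono) auto
          also have "\<dots> = e / 2 * (R * real Q powr (4 / 5))" using e by (simp add: R_def)
          also have "\<dots> \<le> e / 2 * real N" using False e by (intro mult_left_mono) auto
          finally show ?thesis .
        qed
        finally show ?thesis by simp
      qed
    qed
  qed
qed

lemma square_orbit_equidistributed:
  assumes z: "z \<in> sf_space \<alpha> (\<lambda>x. g x + C)"
  shows "(\<lambda>N. (\<Sum>n<N. f ((sf_flow C ^^ (n ^ 2)) z)) / of_nat N) \<longlonglongrightarrow> (LINT z|\<mu>. f z)"
proof (rule LIMSEQ_I)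
  fix r :: real assume r: "r > 0"
  obtain x y where z: "z = proj (x, y)" using z by (auto simp: sf_space_eq)
  have "\<forall>\<^sub>F N in sequentially. \<forall>x y. norm (\<Sum>n<N. dev x y n) \<le> r / 2 * real N"
    by (rule square_average) (use r in simp)
  then obtain N0 where N0: "\<And>N x y. N \<ge> N0 \<Longrightarrow> norm (\<Sum>n<N. dev x y n) \<le> r / 2 * real N"
    by (auto simp: eventually_sequentially)
  show "\<exists>no. \<forall>N\<ge>no. norm ((\<Sum>n<N. f ((sf_flow C ^^ (n ^ 2)) z)) / of_nat N - (LINT z|\<mu>. f z)) < r"
  proof (intro exI allI impI)
    fix N assume N: "N \<ge> Suc N0"
    have "(\<Sum>n<N. dev x y n) = (\<Sum>n<N. f ((sf_flow C ^^ (n ^ 2)) z)) - of_nat N * (LINT z|\<mu>. f z)"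
      by (simp add: dev_def mean_def sum_subtractf z sf_flow_iterate)
    then have "(\<Sum>n<N. f ((sf_flow C ^^ (n ^ 2)) z)) / of_nat N - (LINT z|\<mu>. f z) = (\<Sum>n<N. dev x y n) / of_nat N"
      using N by (simp add: diff_divide_distrib)
    then have "norm ((\<Sum>n<N. f ((sf_flow C ^^ (n ^ 2)) z)) / of_nat N - (LINT z|\<mu>. f z)) = norm (\<Sum>n<N. dev x y n) / real N"
      by (simp add: norm_divide)
    also have "\<dots> \<le> (r / 2 * real N) / real N" using N by (intro divide_right_mono N0) auto
    also have "\<dots> < r" using N r by simp
    finally show "norm ((\<Sum>n<N. f ((sf_flow C ^^ (n ^ 2)) z)) / of_nat N - (LINT z|\<mu>. f z)) < r" .
  qed
qed

end

lemma weakly_mixing_time_C: "weakly_mixing \<mu> (sf_flow C)"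
proof -
  interpret pp: probability_preserving \<mu> "sf_flow C"
    by (rule probability_preserving_flow) (use C_pos in simp)
  show ?thesis
  proof (rule pp.weakly_mixing_if_no_eigenfunctions)
    fix \<phi> \<theta> B
    assume *: "\<phi> \<in> borel_measurable \<mu>" "\<And>z. z \<in> space \<mu> \<Longrightarrow> norm (\<phi> z) \<le> B"
      "\<And>z. z \<in> space \<mu> \<Longrightarrow> \<phi> (sf_flow C z) = ee \<theta> * \<phi> z" "(LINT z|\<mu>. \<phi> z) = 0"
    show "AE z in \<mu>. \<phi> z = 0" by (rule no_eigenfunction[OF C_pos no_coboundary *])
  qed
qed

end

theorem theorem9:
  fixes \<alpha> C :: real and g :: "real \<Rightarrow> real"
  assumes irrational: "\<alpha> \<notin> \<rat>"
    and circle: "one_periodic g"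
    and cont: "continuous_on UNIV g"
    and small: "(\<lambda>n. SUP x. \<bar>birkhoff_sum \<alpha> g (conv_denom \<alpha> n) x\<bar>)
                  \<in> o(\<lambda>n. real (conv_denom \<alpha> (Suc n)) powr (- 4 / 5))"
    and no_coboundary: "\<And>r \<beta> :: real. r \<noteq> 0 \<Longrightarrow>
          \<not> (\<exists>\<psi> :: real \<Rightarrow> real. one_periodic \<psi> \<and> \<psi> \<in> borel_measurable borel \<and>
                (AE x in lborel. [r * g x = \<psi> (x + \<alpha>) - \<psi> x + \<beta>] (rmod 1)))"
    and C: "C > - (INF x. g x)"
  shows "weakly_mixing (sf_measure \<alpha> (\<lambda>x. g x + C)) (sf_flow C) \<and>
         (\<forall>z \<in> sf_space \<alpha> (\<lambda>x. g x + C). \<forall>f :: (real \<times> real) set \<Rightarrow> complex.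
            continuous_map (sf_topology \<alpha> (\<lambda>x. g x + C)) euclidean f \<longrightarrow>
            (\<lambda>N. (\<Sum>n<N. f ((sf_flow C ^^ (n ^ 2)) z)) / of_nat N)
              \<longlonglongrightarrow> integral\<^sup>L (sf_measure \<alpha> (\<lambda>x. g x + C)) f)"
proof -
  obtain B where B: "\<And>x. \<bar>g x\<bar> \<le> B" using one_periodic_bounded[OF circle cont] by blast
  have "- B \<le> g x" for x using B[of x] by linarith
  then have bdd: "bdd_below (range g)" by (rule bdd_belowI2)
  have inf: "(INF x. g x) \<le> g x" for x by (rule cINF_lower[OF bdd]) simp
  \<comment> \<open>A positive infimum m would keep all sums over q_n steps above m, against (ii).
    So the lower bound on \<open>C\<close> makes \<open>C\<close> positive, and
    \<open>sf_flow C\<close> moves upwards.\<close>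
  have "(INF x. g x) \<le> 0"
  proof (rule ccontr)
    assume neg: "\<not> (INF x. g x) \<le> 0"
    define m where "m = (INF x. g x)"
    have m: "m > 0" using neg by (simp add: m_def)
    have "\<forall>\<^sub>F n in sequentially. norm (SUP x. \<bar>birkhoff_sum \<alpha> g (conv_denom \<alpha> n) x\<bar>) \<le> (m / 2) * norm (real (conv_denom \<alpha> (Suc n)) powr (- 4 / 5))"
      using m by (intro landau_o.smallD[OF small]) simp
    then obtain n where n: "norm (SUP x. \<bar>birkhoff_sum \<alpha> g (conv_denom \<alpha> n) x\<bar>) \<le> (m / 2) * norm (real (conv_denom \<alpha> (Suc n)) powr (- 4 / 5))"
      by (auto simp: eventually_sequentially)
    define q where "q = conv_denom \<alpha> n"
    have q: "real q \<ge> 1" using conv_denom_pos[OF irrational, of n] by (simp add: q_def)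
    have Q: "real (conv_denom \<alpha> (Suc n)) \<ge> 1" using conv_denom_pos[OF irrational, of "Suc n"] by linarith
    have "1 * m \<le> real q * m" using q m by (intro mult_right_mono) auto
    also have "real q * m = (\<Sum>i<q. m)" by simp
    also have "\<dots> \<le> birkhoff_sum \<alpha> g q 0"
      unfolding birkhoff_sum_def m_def by (intro sum_mono inf)
    also have "\<dots> \<le> \<bar>birkhoff_sum \<alpha> g q 0\<bar>" by simp
    also have "\<dots> \<le> (SUP x. \<bar>birkhoff_sum \<alpha> g q x\<bar>)"
    proof (rule cSUP_upper)
      have "\<bar>birkhoff_sum \<alpha> g q x\<bar> \<le> (\<Sum>i<q. B)" for x
        unfolding birkhoff_sum_def by (rule order_trans[OF sum_abs sum_mono]) (rule B)
      then show "bdd_above (range (\<lambda>x. \<bar>birkhoff_sum \<alpha> g q x\<bar>))" by (rule bdd_aboveI2)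
    qed simp
    also have "\<dots> \<le> (m / 2) * real (conv_denom \<alpha> (Suc n)) powr (- 4 / 5)"
      using n by (simp add: q_def)
    also have "\<dots> \<le> (m / 2) * 1"
    proof (rule mult_left_mono)
      have "real (conv_denom \<alpha> (Suc n)) powr (- 4 / 5) \<le> real (conv_denom \<alpha> (Suc n)) powr 0"
        using Q by (intro powr_mono) auto
      then show "real (conv_denom \<alpha> (Suc n)) powr (- 4 / 5) \<le> 1" using Q by simp
    qed (use m in simp)
    finally show False using m by simp
  qed
  then have C0: "C > 0" using C by linarith
  interpret rigid_flow \<alpha> C g
  proof
    show "one_periodic (\<lambda>x. g x + C)" using circle by (simp add: one_periodic_def)
    show "continuous_on UNIV (\<lambda>x. g x + C)" by (intro continuous_intros cont)
    show "g x + C > 0" for x using inf[of x] C by linarith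
    fix s :: real assume s: "s \<noteq> 0"
    show "\<not> (\<exists>p::real \<Rightarrow> real. one_periodic p \<and> p \<in> borel_measurable borel \<and>
        (AE x in lborel. [s * (g x + C) = p (x + \<alpha>) - p x] (rmod 1)))"
    proof
      assume "\<exists>p::real \<Rightarrow> real. one_periodic p \<and> p \<in> borel_measurable borel \<and>
        (AE x in lborel. [s * (g x + C) = p (x + \<alpha>) - p x] (rmod 1))"
      then obtain p :: "real \<Rightarrow> real" where p: "one_periodic p" "p \<in> borel_measurable borel"
        "AE x in lborel. [s * (g x + C) = p (x + \<alpha>) - p x] (rmod 1)" by blast
      \<comment> \<open>The constant by which the roof function differs from \<open>g\<close> is
        absorbed by \<beta> = - (s * C).\<close>
      have "AE x in lborel. [s * g x = p (x + \<alpha>) - p x + - (s * C)] (rmod 1)"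
        using p(3)
      proof eventually_elim
        case (elim x)
        then obtain k where "p (x + \<alpha>) - p x = s * (g x + C) + of_int k * 1" by (auto simp: rcong_altdef)
        then show ?case unfolding rcong_altdef by (intro exI[of _ k]) (simp add: algebra_simps)
      qed
      then show False using no_coboundary[OF s, of "- (s * C)"] p by blast
    qed
  qed (use irrational C0 small in auto)
  show ?thesis using weakly_mixing_time_C square_orbit_equidistributed by blast
qed

end
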